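(* Let ${\bf P}=(\mathcal L,l_0,l_f,\Gamma,b,k,L,(Z_i)_{0\le i\le L},{\rm Stm}_P)$ be a generalized Turing machine and for $0\le i\le L$ let $\delta_i:\Sigma^\omega\rightrightarrows Z_i$ be a multi-representation of $Z_i$. If ${\bf P}$ is $(\delta_i)_{0\le i\le L}$-computable, then the multi-function $f_P:Z_1\times\cdots\times Z_k\rightrightarrows Z_0$ computed by ${\bf P}$ is $(\delta_1,\ldots,\delta_k,\delta_0)$-computable. Correspondingly, if ${\bf P}$ is $(\delta_i)_{0\le i\le L}$-continuous, then $f_P$ is $(\delta_1,\ldots,\delta_k,\delta_0)$-continuous.
   Context: **Multi-functions.** A multi-function $f:A\rightrightarrows B$ is a triple $(A,B,R_f)$ with $R_f\subseteq A\times B$; $f(a):=\{b\mid (a,b)\in R_f\}$, $\mathrm{dom}(f):=\{a\mid f(a)\ne\emptyset\}$, $\mathrm{range}(f):=\bigcup_{a\in A} f(a)$. If every $f(a)$ has at most one element, $f$ is a partial function, written $f:\subseteq A\to B$. $\Sigma$ is a fixed finite alphabet with $0,1\in\Sigma$; $\Sigma^*$ is the set of finite words (discrete topology), $\Sigma^\omega$ the set of infinite sequences (Cantor topology, basis $\{u\Sigma^\omega\mid u\in\Sigma^*\}$); $\mathrm{id}_*$ is the identity on $\Sigma^*$. A multi-representation of $Z$ is a multi-function $\delta:\Sigma^\omega\rightrightarrows Z$ with $\mathrm{range}(\delta)=Z$. **Computability on $\Sigma^*,\Sigma^\omega$.** For $U_0,\ldots,U_n\in\{\Sigma^*,\Sigma^\omega\}$,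 a Type-2 machine of type $(U_1,\ldots,U_n\to U_0)$ is a multi-tape Turing machine with $n$ input tapes, finitely many work tapes and one one-way output tape. It computes $f:\subseteq U_1\times\cdots\times U_n\to U_0$ where: if $U_0=\Sigma^*$, $f(p)=w$ iff the machine on input $p$ halts with $w$ on the output tape; if $U_0=\Sigma^\omega$, $f(p)=q$ iff it computes forever and writes $q\in\Sigma^\omega$ on the output tape. Functions so computed are Turing computable; a partial function is called computable if it has a Turing computable extension. A partial function is continuous if it is continuous on its domain (subspace topology). **Realization and relative computability.** Let $f:X_1\times\cdots\times X_n\rightrightarrows X_0$, $g:Z_1\times\cdots\times Z_n\rightrightarrows Z_0$ be multi-functions and let $\gamma_i:X_i\rightrightarrows Z_i$ be multi-functions with $\mathrm{range}(\gamma_i)=Z_i$ ($0\le i\le n$). Put $\gamma(x):=\gamma_1(x_1)\times\cdots\times\gamma_n(x_n)$. Then $f$ is a $(\gamma_1,\ldots,\gamma_n,\gamma_0)$-realization of $g$ iff for all $x,z$: if $z\in\gamma(x)\cap\mathrm{dom}(g)$ then $f(x)\ne\emptyset$ and for all $x_0\in f(x)$, $g(z)\cap\gamma_0(x_0)\ne\emptyset$. If all $X_i\in\{\Sigma^*,\Sigma^\omega\}$, then $g$ is called $(\gamma_1,\ldots,\gamma_n,\gamma_0)$-computable (-continuous) iff it has a $(\gamma_1,\ldots,\gamma_n,\gamma_0)$-realization that is a computable (continuous) partial function $f:\subseteq X_1\times\cdots\times X_n\to X_0$. **Generalized Turing machine (GTM).** A GTM is a tuple $(\mathcal L,l_0,l_f,\Gamma,b,k,L,(Z_i)_{0\le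 i\le L},{\rm Stm})$ where $\mathcal L$ is a finite set (labels) with $l_0,l_f\in\mathcal L$ (initial, final label); $\Gamma$ is a finite set with $\Sigma\cap\Gamma=\emptyset$ and $b\in\Gamma$ (blank); $k,L\in\mathbb N$, $k\le L$ (tapes $0,\ldots,L$; input tapes $1,\ldots,k$; output tape $0$); each $Z_i$ is a set with $Z_i\cap\Gamma=\emptyset$; and ${\rm Stm}$ assigns to each $l\in\mathcal L\setminus\{l_f\}$ a statement of one of the forms (with $i,i_1,\ldots,i_n\in\{0,\ldots,L\}$, $l',l''\in\mathcal L$, $a\in\Gamma$): (a) $(i,{\rm right},l')$; (b) $(i,{\rm left},l')$; (c) $(i:=a,l')$; (d) $(i,{\rm if}\ a\ {\rm then}\ l',\ {\rm else}\ l'')$; (e) $(i:=f(i_1,\ldots,i_n),l')$ with $f:Z_{i_1}\times\cdots\times Z_{i_n}\rightrightarrows Z_i$; (f) $({\rm if}\ f(i_1,\ldots,i_n)\ {\rm then}\ l',\ {\rm else}\ l'')$ with $f:\subseteq Z_{i_1}\times\cdots\times Z_{i_n}\to\Sigma^*$, $\mathrm{range}(f)\subseteq\{0,1\}$. **Semantics.** A configuration is $\kappa=(l,(\alpha_0,m_0),\ldots,(\alpha_L,m_L))$ with $l\in\mathcal L$, $\alpha_i:\mathbb Z\to Z_i\cup\Gamma$ (tape inscription), $m_i\in\mathbb Z$ (head position). Let $x_j:=\alpha_j(m_j)$. The successor relation $\kappa\vdash\kappa'$ is determined by ${\rm Stm}(l)$ (no successor if $l=l_f$): in case (a)/(b),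 $\kappa'$ is $\kappa$ with $m_i$ replaced by $m_i+1$ / $m_i-1$ and label $l'$; (c) $\alpha_i(m_i)$ is replaced by $a$, label $l'$; (d) label $l'$ if $x_i=a$, label $l''$ if $x_i\ne a$; (e) $\alpha_i(m_i)$ is replaced by some $x\in f(x_{i_1},\ldots,x_{i_n})$, label $l'$ (no successor if there is no such $x$, in particular if some $x_{i_j}\notin Z_{i_j}$); (f) label $l'$ if $f(x_{i_1},\ldots,x_{i_n})=0$, label $l''$ if $f(x_{i_1},\ldots,x_{i_n})=1$ (no successor otherwise). A computation is a finite or infinite sequence of configurations, each the $\vdash$-predecessor of the next; it is maximal if it is infinite or its last configuration has no successor. A configuration is accepting if $l=l_f$ and $\alpha_0(0)\in Z_0$; an accepting computation is a finite computation whose last configuration is accepting. The initial configuration ${\rm IC}(x_1,\ldots,x_k)$ has label $l_0$, all heads at position $0$, $\alpha_i(0)=x_i$ for $1\le i\le k$, and $b$ in all other cells. The multi-function computed by the machine: $x_0\in f_P(x_1,\ldots,x_k)$ iff every maximal computation starting with ${\rm IC}(x_1,\ldots,x_k)$ is accepting and there is an accepting computation starting with it whose last configuration has $\alpha_0(0)=x_0$. **Computable machine.** ${\bf P}$ is $(\delta_i)_{0\le i\le L}$-computable iff for every statement $(i:=f(i_1,\ldots,i_n),l')$ in ${\bf P}$ the multi-function $f$ is $(\delta_{i_1},\ldots,\delta_{i_n},\delta_i)$-computable, and for every statement $({\rm if}\ f(i_1,\ldots,i_n)\ {\rm then}\ l',\ {\rm else}\ l'')$ in ${\bf P}$ the partial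 function $f$ is $(\delta_{i_1},\ldots,\delta_{i_n},\mathrm{id}_* )$-computable. "$(\delta_i)_{0\le i\le L}$-continuous" is defined in the same way with "continuous" replacing "computable". *)

theory Defs
  imports "HOL-Analysis.Analysis"
begin

text \<open>
  Conventions. The finite alphabet \<open>\<Sigma>\<close> is a finite type of class \<^class>\<open>zero_neq_one\<close>, so that
  \<open>0\<close> and \<open>1\<close> are two distinct letters. A multi-function from \<open>A\<close> to \<open>B\<close> is a set-valued
  function that is empty outside \<open>A\<close>; a partial function is an option-valued one.
  An \<open>n\<close>-tuple is an extensional function on \<open>{..<n}\<close>, so a product of \<open>n\<close> sets is a \<^const>\<open>PiE\<close>;
  components are therefore counted from 0.
\<close>

section \<open>Multi-functions, words and sequences\<close>

definition multifun :: "'a set \<Rightarrow> 'b set \<Rightarrow> ('a \<Rightarrow> 'b set) \<Rightarrow> bool" where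
  "multifun A B f \<longleftrightarrow> (\<forall>a. f a \<subseteq> B) \<and> (\<forall>a. a \<notin> A \<longrightarrow> f a = {})"

definition mdom :: "('a \<Rightarrow> 'b set) \<Rightarrow> 'a set" where
  "mdom f = {a. f a \<noteq> {}}"

definition mrange :: "('a \<Rightarrow> 'b set) \<Rightarrow> 'b set" where
  "mrange f = (\<Union>a. f a)"

definition partial_fun :: "'a set \<Rightarrow> 'b set \<Rightarrow> ('a \<rightharpoonup> 'b) \<Rightarrow> bool" where
  "partial_fun A B f \<longleftrightarrow> dom f \<subseteq> A \<and> ran f \<subseteq> B"

definition mfun_of :: "('a \<rightharpoonup> 'b) \<Rightarrow> 'a \<Rightarrow> 'b set" where
  "mfun_of f = (\<lambda>x. set_option (f x))"

text \<open>One type for the elements of \<open>\<Sigma>\<^sup>* \<union> \<Sigma>\<^sup>\<omega>\<close>, so that products may mix the two kinds.\<close>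

datatype 's str = Word "'s list" | Seq "nat \<Rightarrow> 's"

definition words :: "'s str set" where
  "words = range Word"

definition seqs :: "'s str set" where
  "seqs = range Seq"

definition id_words :: "'s str \<Rightarrow> 's str set" where
  "id_words x = (if x \<in> words then {x} else {})"

definition multi_representation :: "'z set \<Rightarrow> ('s str \<Rightarrow> 'z set) \<Rightarrow> bool" where
  "multi_representation Z \<delta> \<longleftrightarrow> multifun seqs Z \<delta> \<and> mrange \<delta> = Z"

definition cylinder :: "'s list \<Rightarrow> 's str set" where
  "cylinder u = Seq ` {p. \<forall>i<length u. p i = u ! i}"

text \<open>The topology of the disjoint union of the discrete space \<open>\<Sigma>\<^sup>*\<close> and the Cantor space \<open>\<Sigma>\<^sup>\<omega>\<close>
  (see the two lemmas below).\<close>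

definition str_topology :: "'s str topology" where
  "str_topology = topology_generated_by (range (\<lambda>w. {Word w}) \<union> range cylinder)"

lemma str_topology_words: "subtopology str_topology words = discrete_topology words"
proof -
  have "openin str_topology {Word w}" for w :: "'s list"
    unfolding str_topology_def by (rule topology_generated_by_Basis) auto
  then have "openin (subtopology str_topology words) {x}" if "x \<in> words" for x :: "'s str"
    using that unfolding words_def openin_subtopology by fast
  moreover have "topspace (subtopology str_topology words) = (words :: 's str set)"
    by (auto simp: str_topology_def words_def)
  ultimately show ?thesis
    using discrete_topology_unique[of words "subtopology str_topology words"] by metis
qed

lemma str_topology_seqs:
  "subtopology str_topology seqs = topology_generated_by (range cylinder)"
proof (rule topology_eq[THEN iffD2], intro allI iffI)
  have inter: "{Word w} \<inter> seqs = {}" "cylinder u \<inter> seqs = cylinder u" for w u :: "'s list"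
    by (auto simp: seqs_def cylinder_def)
  fix S :: "'s str set"
  {
    assume "openin (subtopology str_topology seqs) S"
    then obtain T where T: "generate_topology_on (range (\<lambda>w. {Word w}) \<union> range cylinder) T"
      and S: "S = T \<inter> seqs"
      by (auto simp: openin_subtopology str_topology_def openin_topology_generated_by_iff)
    from T have "openin (topology_generated_by (range cylinder)) (T \<inter> seqs)"
    proof induction
      case (Int A B)
      have "openin (topology_generated_by (range cylinder)) ((A \<inter> seqs) \<inter> (B \<inter> seqs))"
        by (rule openin_Int[OF Int.IH])
      moreover have "(A \<inter> seqs) \<inter> (B \<inter> seqs) = A \<inter> B \<inter> seqs" by auto
      ultimately show ?case by simp
    next
      case (UN K)
      have "openin (topology_generated_by (range cylinder)) (\<Union>A\<in>K. A \<inter> seqs)"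
        using UN by blast
      then show ?case by (simp only: Int_Union2)
    next
      case (Basis A)
      then consider (word) w where "A = {Word w}" | (cyl) u where "A = cylinder u" by blast
      then show ?case
      proof cases
        case word
        show ?thesis by (simp only: word inter openin_empty)
      next
        case cyl
        show ?thesis unfolding cyl inter by (rule topology_generated_by_Basis) blast
      qed
    qed auto
    then show "openin (topology_generated_by (range cylinder)) S"
      by (simp add: S)
  next
    assume "openin (topology_generated_by (range cylinder)) S"
    then have "generate_topology_on (range cylinder) S"
      by (simp add: openin_topology_generated_by_iff)
    then show "openin (subtopology str_topology seqs) S"
    proof induction
      case (UN K)
      then show ?case by blast
    next
      case (Basis A)
      then obtain u where u: "A = cylinder u" by blast
      have "openin str_topology (cylinder u)"
        unfolding str_topology_def by (rule topology_generated_by_Basis) auto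
      then show ?case
        unfolding u openin_subtopology using inter(2) by blast
    qed auto
  }
qed


section \<open>Type-2 machines\<close>

text \<open>A Type-2 machine is given by a flowchart program, i.e. a list of statements.
  The labels are the positions in the list and its length; \<open>0\<close> is the initial label and
  the length of the list is the final label. Tapes \<open>0, \<dots>, n - 1\<close> are the (read-only) input tapes,
  tapes \<open>n, \<dots>, N - 1\<close> are the work tapes; the one-way output tape is a word that
  can only be extended. The tape symbols are the letters, a blank and auxiliary symbols,
  of which a program mentions only finitely many.\<close>

datatype 's sym = Blank | Letter 's | Aux nat

datatype 's t2_stm =
    MoveRight nat nat
  | MoveLeft nat nat
  | Put nat "'s sym" nat
  | Branch nat "'s sym" nat nat
  | Emit 's nat

type_synonym 's t2_prog = "'s t2_stm list"

fun t2_stm_wf :: "nat \<Rightarrow> nat \<Rightarrow> nat \<Rightarrow> 's t2_stm \<Rightarrow> bool" where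
  "t2_stm_wf n N e (MoveRight i l) \<longleftrightarrow> i < N \<and> l \<le> e"
| "t2_stm_wf n N e (MoveLeft i l) \<longleftrightarrow> i < N \<and> l \<le> e"
| "t2_stm_wf n N e (Put i a l) \<longleftrightarrow> n \<le> i \<and> i < N \<and> l \<le> e"
| "t2_stm_wf n N e (Branch i a l l') \<longleftrightarrow> i < N \<and> l \<le> e \<and> l' \<le> e"
| "t2_stm_wf n N e (Emit c l) \<longleftrightarrow> l \<le> e"

definition t2_wf :: "nat \<Rightarrow> nat \<Rightarrow> 's t2_prog \<Rightarrow> bool" where
  "t2_wf n N M \<longleftrightarrow> n \<le> N \<and> (\<forall>s \<in> set M. t2_stm_wf n N (length M) s)"

text \<open>Label, tape inscriptions, head positions, output.\<close>

type_synonym 's t2_conf = "nat \<times> (nat \<Rightarrow> int \<Rightarrow> 's sym) \<times> (nat \<Rightarrow> int) \<times> 's list"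

fun t2_exec :: "'s t2_stm \<Rightarrow> 's t2_conf \<Rightarrow> 's t2_conf" where
  "t2_exec (MoveRight i l) (_, \<alpha>, m, w) = (l, \<alpha>, m(i := m i + 1), w)"
| "t2_exec (MoveLeft i l) (_, \<alpha>, m, w) = (l, \<alpha>, m(i := m i - 1), w)"
| "t2_exec (Put i a l) (_, \<alpha>, m, w) = (l, \<alpha>(i := (\<alpha> i)(m i := a)), m, w)"
| "t2_exec (Branch i a l l') (_, \<alpha>, m, w) = ((if \<alpha> i (m i) = a then l else l'), \<alpha>, m, w)"
| "t2_exec (Emit c l) (_, \<alpha>, m, w) = (l, \<alpha>, m, w @ [c])"

fun t2_label :: "'s t2_conf \<Rightarrow> nat" where
  "t2_label (l, \<alpha>, m, w) = l"

fun t2_output :: "'s t2_conf \<Rightarrow> 's list" where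
  "t2_output (l, \<alpha>, m, w) = w"

definition t2_step :: "'s t2_prog \<Rightarrow> 's t2_conf \<Rightarrow> 's t2_conf" where
  "t2_step M c = (if t2_label c < length M then t2_exec (M ! t2_label c) c else c)"

text \<open>An input string starts at cell \<open>0\<close>, and all other cells are blank.\<close>

fun str_tape :: "'s str \<Rightarrow> int \<Rightarrow> 's sym" where
  "str_tape (Word w) z = (if 0 \<le> z \<and> z < int (length w) then Letter (w ! nat z) else Blank)"
| "str_tape (Seq p) z = (if 0 \<le> z then Letter (p (nat z)) else Blank)"

definition t2_initial :: "nat \<Rightarrow> (nat \<Rightarrow> 's str) \<Rightarrow> 's t2_conf" where
  "t2_initial n x = (0, (\<lambda>i. if i < n then str_tape (x i) else (\<lambda>_. Blank)), (\<lambda>_. 0), [])"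

definition t2_run :: "nat \<Rightarrow> 's t2_prog \<Rightarrow> (nat \<Rightarrow> 's str) \<Rightarrow> nat \<Rightarrow> 's t2_conf" where
  "t2_run n M x t = (t2_step M ^^ t) (t2_initial n x)"

fun t2_yields :: "nat \<Rightarrow> 's t2_prog \<Rightarrow> (nat \<Rightarrow> 's str) \<Rightarrow> 's str \<Rightarrow> bool" where
  "t2_yields n M x (Word w) \<longleftrightarrow>
     (\<exists>t. t2_label (t2_run n M x t) = length M \<and> t2_output (t2_run n M x t) = w)"
| "t2_yields n M x (Seq q) \<longleftrightarrow>
     (\<forall>t. t2_label (t2_run n M x t) \<noteq> length M) \<and>
     (\<forall>t. \<forall>i < length (t2_output (t2_run n M x t)). t2_output (t2_run n M x t) ! i = q i) \<and>
     (\<forall>k. \<exists>t. k \<le> length (t2_output (t2_run n M x t)))"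

lemma t2_yields_unique:
  assumes "t2_yields n M x y" "t2_yields n M x y'"
  shows "y = y'"
proof -
  have stay: "t2_run n M x (t + k) = t2_run n M x t"
    if "t2_label (t2_run n M x t) = length M" for t k
    using that by (induction k) (auto simp: t2_run_def t2_step_def)
  have halt: "t2_run n M x t = t2_run n M x t'"
    if "t2_label (t2_run n M x t) = length M" "t2_label (t2_run n M x t') = length M" for t t'
    using stay[OF that(1), of "t' - t"] stay[OF that(2), of "t - t'"]
    by (cases "t \<le> t'") auto
  have seq: "q i = q' i" if q: "t2_yields n M x (Seq q)" "t2_yields n M x (Seq q')" for q q' i
  proof -
    have "\<exists>t. Suc i \<le> length (t2_output (t2_run n M x t))"
      using q(1) unfolding t2_yields.simps by blast
    then obtain t where t: "i < length (t2_output (t2_run n M x t))"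
      by (auto simp: Suc_le_eq)
    have "t2_output (t2_run n M x t) ! i = q i"
      using q(1) t unfolding t2_yields.simps by blast
    moreover have "t2_output (t2_run n M x t) ! i = q' i"
      using q(2) t unfolding t2_yields.simps by blast
    ultimately show ?thesis by simp
  qed
  show ?thesis
  proof (cases y)
    case y: (Word w)
    show ?thesis
    proof (cases y')
      case y': (Word w')
      obtain t t' where
        "t2_label (t2_run n M x t) = length M" "t2_output (t2_run n M x t) = w"
        "t2_label (t2_run n M x t') = length M" "t2_output (t2_run n M x t') = w'"
        using assms unfolding y y' t2_yields.simps by blast
      then show ?thesis
        using halt[of t t'] y y' by simp
    next
      case y': (Seq q')
      show ?thesis
        using assms unfolding y y' t2_yields.simps by blast
    qed
  next
    case y: (Seq q)
    show ?thesis
    proof (cases y')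
      case y': (Word w')
      show ?thesis
        using assms unfolding y y' t2_yields.simps by blast
    next
      case y': (Seq q')
      have "q = q'"
        using assms seq unfolding y y' by blast
      then show ?thesis
        using y y' by simp
    qed
  qed
qed

text \<open>In the following definitions each of the sets \<open>U i\<close> and \<open>U0\<close> is \<^const>\<open>words\<close> or \<^const>\<open>seqs\<close>;
  they are the type of the machine, or of the partial function.\<close>

definition turing_computable ::
  "nat \<Rightarrow> (nat \<Rightarrow> 's str set) \<Rightarrow> 's str set \<Rightarrow> ((nat \<Rightarrow> 's str) \<rightharpoonup> 's str) \<Rightarrow> bool" where
  "turing_computable n U U0 f \<longleftrightarrow>
     (\<exists>N M. t2_wf n N M \<and>
        (\<forall>x y. f x = Some y \<longleftrightarrow> x \<in> PiE {..<n} U \<and> y \<in> U0 \<and> t2_yields n M x y))"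

definition computable_pfun ::
  "nat \<Rightarrow> (nat \<Rightarrow> 's str set) \<Rightarrow> 's str set \<Rightarrow> ((nat \<Rightarrow> 's str) \<rightharpoonup> 's str) \<Rightarrow> bool" where
  "computable_pfun n U U0 f \<longleftrightarrow> (\<exists>h. turing_computable n U U0 h \<and> f \<subseteq>\<^sub>m h)"

definition continuous_pfun ::
  "nat \<Rightarrow> (nat \<Rightarrow> 's str set) \<Rightarrow> 's str set \<Rightarrow> ((nat \<Rightarrow> 's str) \<rightharpoonup> 's str) \<Rightarrow> bool" where
  "continuous_pfun n U U0 f \<longleftrightarrow>
     partial_fun (PiE {..<n} U) U0 f \<and>
     continuous_map
       (subtopology (product_topology (\<lambda>i. subtopology str_topology (U i)) {..<n}) (dom f))
       (subtopology str_topology U0) (\<lambda>x. the (f x))"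


section \<open>Realization and relative computability\<close>

definition realization ::
  "nat \<Rightarrow> (nat \<Rightarrow> 'x set) \<Rightarrow> (nat \<Rightarrow> 'x \<Rightarrow> 'z set) \<Rightarrow> ('y \<Rightarrow> 'w set) \<Rightarrow>
   ((nat \<Rightarrow> 'x) \<Rightarrow> 'y set) \<Rightarrow> ((nat \<Rightarrow> 'z) \<Rightarrow> 'w set) \<Rightarrow> bool" where
  "realization n X \<gamma> \<gamma>0 f g \<longleftrightarrow>
     (\<forall>x \<in> PiE {..<n} X. \<forall>z \<in> PiE {..<n} (\<lambda>i. \<gamma> i (x i)) \<inter> mdom g.
        f x \<noteq> {} \<and> (\<forall>x0 \<in> f x. g z \<inter> \<gamma>0 x0 \<noteq> {}))"

definition rel_computable ::
  "nat \<Rightarrow> (nat \<Rightarrow> 's str set) \<Rightarrow> 's str set \<Rightarrow> (nat \<Rightarrow> 's str \<Rightarrow> 'z set) \<Rightarrow> ('s str \<Rightarrow> 'w set) \<Rightarrow>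
   ((nat \<Rightarrow> 'z) \<Rightarrow> 'w set) \<Rightarrow> bool" where
  "rel_computable n U U0 \<gamma> \<gamma>0 g \<longleftrightarrow>
     (\<exists>f. computable_pfun n U U0 f \<and> realization n U \<gamma> \<gamma>0 (mfun_of f) g)"

definition rel_continuous ::
  "nat \<Rightarrow> (nat \<Rightarrow> 's str set) \<Rightarrow> 's str set \<Rightarrow> (nat \<Rightarrow> 's str \<Rightarrow> 'z set) \<Rightarrow> ('s str \<Rightarrow> 'w set) \<Rightarrow>
   ((nat \<Rightarrow> 'z) \<Rightarrow> 'w set) \<Rightarrow> bool" where
  "rel_continuous n U U0 \<gamma> \<gamma>0 g \<longleftrightarrow>
     (\<exists>f. continuous_pfun n U U0 f \<and> realization n U \<gamma> \<gamma>0 (mfun_of f) g)"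


section \<open>Generalized Turing machines\<close>

text \<open>The sets \<open>Z\<^sub>i\<close> and the set \<open>\<Gamma>\<close> are subsets of one type \<open>'u\<close>; \<open>\<Sigma> \<inter> \<Gamma> = \<emptyset>\<close> is a matter of typing.
  The list in \<open>Assign\<close> and \<open>Test\<close> is \<open>(i\<^sub>1, \<dots>, i\<^sub>n)\<close>.\<close>

datatype ('l, 'u, 's) gtm_stm =
    GoRight nat 'l
  | GoLeft nat 'l
  | Write nat 'u 'l
  | IfSym nat 'u 'l 'l
  | Assign nat "(nat \<Rightarrow> 'u) \<Rightarrow> 'u set" "nat list" 'l
  | Test "(nat \<Rightarrow> 'u) \<rightharpoonup> 's str" "nat list" 'l 'l

record ('l, 'u, 's) gtm =
  labels :: "'l set"
  init_label :: 'l
  final_label :: 'l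
  aux_syms :: "'u set"
  blank :: 'u
  num_inputs :: nat
  last_tape :: nat
  tape_set :: "nat \<Rightarrow> 'u set"
  stm :: "'l \<Rightarrow> ('l, 'u, 's) gtm_stm"

definition arg_set :: "('l, 'u, 's) gtm \<Rightarrow> nat list \<Rightarrow> (nat \<Rightarrow> 'u) set" where
  "arg_set P is = PiE {..<length is} (\<lambda>j. tape_set P (is ! j))"

fun gtm_stm_wf :: "('l, 'u, 's :: zero_neq_one) gtm \<Rightarrow> ('l, 'u, 's) gtm_stm \<Rightarrow> bool" where
  "gtm_stm_wf P (GoRight i l) \<longleftrightarrow> i \<le> last_tape P \<and> l \<in> labels P"
| "gtm_stm_wf P (GoLeft i l) \<longleftrightarrow> i \<le> last_tape P \<and> l \<in> labels P"
| "gtm_stm_wf P (Write i a l) \<longleftrightarrow> i \<le> last_tape P \<and> a \<in> aux_syms P \<and> l \<in> labels P"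
| "gtm_stm_wf P (IfSym i a l l') \<longleftrightarrow>
     i \<le> last_tape P \<and> a \<in> aux_syms P \<and> l \<in> labels P \<and> l' \<in> labels P"
| "gtm_stm_wf P (Assign i f is l) \<longleftrightarrow>
     i \<le> last_tape P \<and> set is \<subseteq> {..last_tape P} \<and> l \<in> labels P \<and>
     multifun (arg_set P is) (tape_set P i) f"
| "gtm_stm_wf P (Test f is l l') \<longleftrightarrow>
     set is \<subseteq> {..last_tape P} \<and> l \<in> labels P \<and> l' \<in> labels P \<and>
     partial_fun (arg_set P is) words f \<and> ran f \<subseteq> {Word [0], Word [1]}"

definition is_gtm :: "('l, 'u, 's :: zero_neq_one) gtm \<Rightarrow> bool" where
  "is_gtm P \<longleftrightarrow>
     finite (labels P) \<and> init_label P \<in> labels P \<and> final_label P \<in> labels P \<and>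
     finite (aux_syms P) \<and> blank P \<in> aux_syms P \<and>
     num_inputs P \<le> last_tape P \<and>
     (\<forall>i \<le> last_tape P. tape_set P i \<inter> aux_syms P = {}) \<and>
     (\<forall>l \<in> labels P - {final_label P}. gtm_stm_wf P (stm P l))"

text \<open>Label, tape inscriptions, head positions. (Only the tapes \<open>0, \<dots>, last_tape P\<close> matter.)\<close>

type_synonym ('l, 'u) gtm_conf = "'l \<times> (nat \<Rightarrow> int \<Rightarrow> 'u) \<times> (nat \<Rightarrow> int)"

definition args :: "(nat \<Rightarrow> int \<Rightarrow> 'u) \<Rightarrow> (nat \<Rightarrow> int) \<Rightarrow> nat list \<Rightarrow> nat \<Rightarrow> 'u" where
  "args \<alpha> m is = (\<lambda>j \<in> {..<length is}. \<alpha> (is ! j) (m (is ! j)))"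

inductive gtm_step ::
  "('l, 'u, 's :: zero_neq_one) gtm \<Rightarrow> ('l, 'u) gtm_conf \<Rightarrow> ('l, 'u) gtm_conf \<Rightarrow> bool"
  for P where
  right: "l \<noteq> final_label P \<Longrightarrow> stm P l = GoRight i l' \<Longrightarrow>
    gtm_step P (l, \<alpha>, m) (l', \<alpha>, m(i := m i + 1))"
| left: "l \<noteq> final_label P \<Longrightarrow> stm P l = GoLeft i l' \<Longrightarrow>
    gtm_step P (l, \<alpha>, m) (l', \<alpha>, m(i := m i - 1))"
| write_sym: "l \<noteq> final_label P \<Longrightarrow> stm P l = Write i a l' \<Longrightarrow>
    gtm_step P (l, \<alpha>, m) (l', \<alpha>(i := (\<alpha> i)(m i := a)), m)"
| if_eq: "l \<noteq> final_label P \<Longrightarrow> stm P l = IfSym i a l' l'' \<Longrightarrow> \<alpha> i (m i) = a \<Longrightarrow>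
    gtm_step P (l, \<alpha>, m) (l', \<alpha>, m)"
| if_neq: "l \<noteq> final_label P \<Longrightarrow> stm P l = IfSym i a l' l'' \<Longrightarrow> \<alpha> i (m i) \<noteq> a \<Longrightarrow>
    gtm_step P (l, \<alpha>, m) (l'', \<alpha>, m)"
| assign: "l \<noteq> final_label P \<Longrightarrow> stm P l = Assign i f is l' \<Longrightarrow> x \<in> f (args \<alpha> m is) \<Longrightarrow>
    gtm_step P (l, \<alpha>, m) (l', \<alpha>(i := (\<alpha> i)(m i := x)), m)"
| test_0: "l \<noteq> final_label P \<Longrightarrow> stm P l = Test f is l' l'' \<Longrightarrow> f (args \<alpha> m is) = Some (Word [0]) \<Longrightarrow>
    gtm_step P (l, \<alpha>, m) (l', \<alpha>, m)"
| test_1: "l \<noteq> final_label P \<Longrightarrow> stm P l = Test f is l' l'' \<Longrightarrow> f (args \<alpha> m is) = Some (Word [1]) \<Longrightarrow>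
    gtm_step P (l, \<alpha>, m) (l'', \<alpha>, m)"

text \<open>Component \<open>j\<close> of the input is written on tape \<open>j + 1\<close>.\<close>

definition gtm_initial :: "('l, 'u, 's) gtm \<Rightarrow> (nat \<Rightarrow> 'u) \<Rightarrow> ('l, 'u) gtm_conf" where
  "gtm_initial P x =
     (init_label P,
      (\<lambda>i z. if 1 \<le> i \<and> i \<le> num_inputs P \<and> z = 0 then x (i - 1) else blank P),
      (\<lambda>_. 0))"

fun gtm_result :: "('l, 'u) gtm_conf \<Rightarrow> 'u" where
  "gtm_result (l, \<alpha>, m) = \<alpha> 0 0"

definition gtm_accepting :: "('l, 'u, 's) gtm \<Rightarrow> ('l, 'u) gtm_conf \<Rightarrow> bool" where
  "gtm_accepting P \<kappa> \<longleftrightarrow> fst \<kappa> = final_label P \<and> gtm_result \<kappa> \<in> tape_set P 0"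

definition fin_computation ::
  "('l, 'u, 's :: zero_neq_one) gtm \<Rightarrow> ('l, 'u) gtm_conf list \<Rightarrow> bool" where
  "fin_computation P \<kappa>s \<longleftrightarrow> \<kappa>s \<noteq> [] \<and> successively (gtm_step P) \<kappa>s"

definition inf_computation ::
  "('l, 'u, 's :: zero_neq_one) gtm \<Rightarrow> (nat \<Rightarrow> ('l, 'u) gtm_conf) \<Rightarrow> bool" where
  "inf_computation P \<kappa> \<longleftrightarrow> (\<forall>t. gtm_step P (\<kappa> t) (\<kappa> (Suc t)))"

definition accepting_computation ::
  "('l, 'u, 's :: zero_neq_one) gtm \<Rightarrow> ('l, 'u) gtm_conf list \<Rightarrow> bool" where
  "accepting_computation P \<kappa>s \<longleftrightarrow> fin_computation P \<kappa>s \<and> gtm_accepting P (last \<kappa>s)"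

text \<open>Infinite computations are maximal and never accepting.\<close>

definition all_maximal_accepting ::
  "('l, 'u, 's :: zero_neq_one) gtm \<Rightarrow> ('l, 'u) gtm_conf \<Rightarrow> bool" where
  "all_maximal_accepting P \<kappa>0 \<longleftrightarrow>
     \<not> (\<exists>\<kappa>. inf_computation P \<kappa> \<and> \<kappa> 0 = \<kappa>0) \<and>
     (\<forall>\<kappa>s. fin_computation P \<kappa>s \<and> hd \<kappa>s = \<kappa>0 \<and> \<not> (\<exists>\<kappa>'. gtm_step P (last \<kappa>s) \<kappa>')
        \<longrightarrow> accepting_computation P \<kappa>s)"

definition gtm_inputs :: "('l, 'u, 's) gtm \<Rightarrow> (nat \<Rightarrow> 'u) set" where
  "gtm_inputs P = PiE {..<num_inputs P} (\<lambda>j. tape_set P (Suc j))"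

definition gtm_fun :: "('l, 'u, 's :: zero_neq_one) gtm \<Rightarrow> (nat \<Rightarrow> 'u) \<Rightarrow> 'u set" where
  "gtm_fun P x = {x0. x \<in> gtm_inputs P \<and> all_maximal_accepting P (gtm_initial P x) \<and>
     (\<exists>\<kappa>s. accepting_computation P \<kappa>s \<and> hd \<kappa>s = gtm_initial P x \<and> gtm_result (last \<kappa>s) = x0)}"

lemma multifun_gtm_fun: "multifun (gtm_inputs P) (tape_set P 0) (gtm_fun P)"
  by (auto simp: multifun_def gtm_fun_def accepting_computation_def gtm_accepting_def)

definition gtm_computable ::
  "('l, 'u, 's :: {finite, zero_neq_one}) gtm \<Rightarrow> (nat \<Rightarrow> 's str \<Rightarrow> 'u set) \<Rightarrow> bool" where
  "gtm_computable P \<delta> \<longleftrightarrow>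
     (\<forall>l \<in> labels P - {final_label P}.
        (\<forall>i f is l'. stm P l = Assign i f is l' \<longrightarrow>
           rel_computable (length is) (\<lambda>_. seqs) seqs (\<lambda>j. \<delta> (is ! j)) (\<delta> i) f) \<and>
        (\<forall>f is l' l''. stm P l = Test f is l' l'' \<longrightarrow>
           rel_computable (length is) (\<lambda>_. seqs) words (\<lambda>j. \<delta> (is ! j)) id_words (mfun_of f)))"

definition gtm_continuous ::
  "('l, 'u, 's :: {finite, zero_neq_one}) gtm \<Rightarrow> (nat \<Rightarrow> 's str \<Rightarrow> 'u set) \<Rightarrow> bool" where
  "gtm_continuous P \<delta> \<longleftrightarrow>
     (\<forall>l \<in> labels P - {final_label P}.
        (\<forall>i f is l'. stm P l = Assign i f is l' \<longrightarrow>
           rel_continuous (length is) (\<lambda>_. seqs) seqs (\<lambda>j. \<delta> (is ! j)) (\<delta> i) f) \<and>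
        (\<forall>f is l' l''. stm P l = Test f is l' l'' \<longrightarrow>
           rel_continuous (length is) (\<lambda>_. seqs) words (\<lambda>j. \<delta> (is ! j)) id_words (mfun_of f)))"

end

theory Submission
  imports Defs "HOL-Library.Sublist"
begin

text \<open>
  Choose a realization of the function in every statement. If each cell content of a generalized
  Turing machine is replaced by a name of it, a run becomes deterministic. It follows some
  computation of the machine on the named elements. For an input in the domain of \<^const>\<open>gtm_fun\<close>
  every computation ends and accepts, so the run on names reaches the final label, and then
  cell \<open>0\<close> of tape \<open>0\<close> holds a name of a result (\<open>name_run\<close>).

  Names are infinite, but each finite part of a value of a realization depends on finite parts of
  the arguments: a realization is approximated by a function on finite words which yields correct
  prefixes of the value, and arbitrarily long ones if its arguments are long enough
  (\<open>approximates\<close>). With such functions the run on names can be carried out on finite prefixes of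
  the input names. An assignment stores the prefix that is known; a test whose answer is not yet
  known waits. Within a given number of steps this produces a prefix of the name of the result, and
  every prefix of it once the inputs and the number of steps are large (\<open>simulation_approximates\<close>). So
  the run on names, which realizes \<^const>\<open>gtm_fun\<close>, is itself approximated by a function on finite words.

  It remains to see that approximability expresses the two notions in question. A continuous
  partial function has an approximation on its domain (\<open>continuous_approximation\<close>), and every
  approximation defines a continuous function (\<open>approximation_continuous\<close>). A Type-2 machine has a
  primitive recursive approximation, namely its output after a given number of steps
  (\<open>machine_prim_rec_approximation\<close>), and a sequence-valued function with a primitive recursive
  approximation is computed by a machine that evaluates the approximation on longer and longer
  prefixes and writes the letters that become known
  (\<open>prim_rec_approximation_machine\<close>). The simulation is primitive recursive if the approximations
  of the realizations are (\<open>prim_rec_simulation\<close>).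

  Primitive recursive functions enter because their closure properties make it easy to see that
  one step of a coded machine belongs to them, while on a Turing machine they can be evaluated with
  counters, a counter being the position of a head on a work tape.
\<close>

section \<open>Primitive recursive functions on coded data\<close>

abbreviation pfst :: "nat \<Rightarrow> nat" where "pfst x \<equiv> fst (prod_decode x)"
abbreviation psnd :: "nat \<Rightarrow> nat" where "psnd x \<equiv> snd (prod_decode x)"
abbreviation pair :: "nat \<Rightarrow> nat \<Rightarrow> nat" where "pair a b \<equiv> prod_encode (a, b)"

text \<open>The primitive recursive functions in a form with one argument. Since tuples are coded by
  \<^const>\<open>prod_encode\<close>, iteration of a unary function replaces recursion with parameters.\<close>

inductive prim_rec :: "(nat \<Rightarrow> nat) \<Rightarrow> bool" where
  zero: "prim_rec (\<lambda>_. 0)"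
| ident: "prim_rec (\<lambda>x. x)"
| succ: "prim_rec Suc"
| first: "prim_rec (\<lambda>x. pfst x)"
| second: "prim_rec (\<lambda>x. psnd x)"
| pairing: "prim_rec f \<Longrightarrow> prim_rec g \<Longrightarrow> prim_rec (\<lambda>x. pair (f x) (g x))"
| compose: "prim_rec f \<Longrightarrow> prim_rec g \<Longrightarrow> prim_rec (\<lambda>x. f (g x))"
| iterate: "prim_rec f \<Longrightarrow> prim_rec (\<lambda>x. (f ^^ pfst x) (psnd x))"

lemma prim_rec_Suc: "prim_rec f \<Longrightarrow> prim_rec (\<lambda>x. Suc (f x))"
  by (rule compose[OF succ])

lemma prim_rec_pfst: "prim_rec f \<Longrightarrow> prim_rec (\<lambda>x. pfst (f x))"
  by (rule compose[OF first])

lemma prim_rec_psnd: "prim_rec f \<Longrightarrow> prim_rec (\<lambda>x. psnd (f x))"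
  by (rule compose[OF second])

lemma prim_rec_const: "prim_rec (\<lambda>_. c)"
  by (induction c) (auto intro: zero prim_rec_Suc)

lemma prim_rec_iter:
  assumes "prim_rec f" "prim_rec n" "prim_rec a"
  shows "prim_rec (\<lambda>x. (f ^^ n x) (a x))"
  using compose[OF iterate[OF assms(1)] pairing[OF assms(2,3)]] by simp

text \<open>Iterating \<open>(a, b) \<mapsto> (a + 1, a)\<close> from \<open>(0, 0)\<close> keeps the predecessor of the number of steps in the
  second component.\<close>

lemma prim_rec_pred:
  assumes "prim_rec f"
  shows "prim_rec (\<lambda>x. f x - 1)"
proof -
  let ?F = "\<lambda>y. pair (Suc (pfst y)) (pfst y)"
  have "(?F ^^ n) (pair 0 0) = pair n (n - 1)" for n
    by (induction n) auto
  then have "psnd ((?F ^^ n) (pair 0 0)) = n - 1" for n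
    by simp
  moreover have "prim_rec (\<lambda>x. psnd ((?F ^^ f x) (pair 0 0)))"
    by (intro prim_rec_psnd prim_rec_iter pairing prim_rec_Suc prim_rec_pfst ident assms prim_rec_const)
  ultimately show ?thesis by simp
qed

lemma prim_rec_add:
  assumes "prim_rec f" "prim_rec g"
  shows "prim_rec (\<lambda>x. f x + g x)"
proof -
  have "(Suc ^^ n) m = n + m" for n m
    by (induction n) auto
  then show ?thesis
    using prim_rec_iter[OF succ assms] by simp
qed

lemma prim_rec_diff:
  assumes "prim_rec f" "prim_rec g"
  shows "prim_rec (\<lambda>x. f x - g x)"
proof -
  have "((\<lambda>x. x - 1) ^^ n) m = m - n" for n m :: nat
    by (induction n) auto
  then show ?thesis
    using prim_rec_iter[OF prim_rec_pred[OF ident] assms(2,1)] by simp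
qed

text \<open>The map \<open>(a, b) \<mapsto> (b, b)\<close> overwrites the first branch by the second when it is applied at least
  once, and not at all when it is applied zero times.\<close>

lemma prim_rec_if_0:
  assumes "prim_rec c" "prim_rec f" "prim_rec g"
  shows "prim_rec (\<lambda>x. if c x = 0 then f x else g x)"
proof -
  let ?F = "\<lambda>y. pair (psnd y) (psnd y)"
  have "pfst ((?F ^^ n) (pair a b)) = (if n = 0 then a else b)" for n a b
  proof -
    have "(?F ^^ n) (pair a b) = (if n = 0 then pair a b else pair b b)"
      by (induction n) auto
    then show ?thesis by simp
  qed
  moreover have "prim_rec (\<lambda>x. pfst ((?F ^^ c x) (pair (f x) (g x))))"
    by (intro prim_rec_pfst prim_rec_iter pairing prim_rec_psnd ident assms)
  ultimately show ?thesis by simp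
qed

lemma prim_rec_if_eq:
  assumes "prim_rec f" "prim_rec g" "prim_rec a" "prim_rec b"
  shows "prim_rec (\<lambda>x. if f x = g x then a x else b x)"
proof -
  have "(f x = g x) = ((f x - g x) + (g x - f x) = 0)" for x by auto
  then show ?thesis
    by (simp only:) (intro prim_rec_if_0 prim_rec_add prim_rec_diff assms)
qed

lemmas prim_rec_intros = ident prim_rec_const prim_rec_Suc prim_rec_pfst prim_rec_psnd pairing
  prim_rec_iter prim_rec_pred prim_rec_if_eq

lemma prim_rec_double: "prim_rec f \<Longrightarrow> prim_rec (\<lambda>x. 2 * f x)"
  using prim_rec_add[of f f] by (simp add: mult_2)

text \<open>Parity and halving in one iteration: the pair \<open>(n div 2, n mod 2)\<close> is updated when \<open>n\<close> grows.\<close>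

lemma prim_rec_divmod_2:
  shows prim_rec_div_2: "prim_rec f \<Longrightarrow> prim_rec (\<lambda>x. f x div 2)"
    and prim_rec_mod_2: "prim_rec f \<Longrightarrow> prim_rec (\<lambda>x. f x mod 2)"
proof -
  let ?F = "\<lambda>y. if psnd y = 0 then pair (pfst y) 1 else pair (Suc (pfst y)) 0"
  have eq: "(?F ^^ n) (pair 0 0) = pair (n div 2) (n mod 2)" for n
    by (induction n) (auto, presburger+)
  assume f: "prim_rec f"
  have "prim_rec (\<lambda>x. (?F ^^ f x) (pair 0 0))"
    by (intro prim_rec_intros f)
  from prim_rec_pfst[OF this] prim_rec_psnd[OF this]
  show "prim_rec (\<lambda>x. f x div 2)" "prim_rec (\<lambda>x. f x mod 2)"
    unfolding eq by simp_all
qed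

text \<open>The list operations on the codes given by \<^const>\<open>list_encode\<close>.\<close>

definition lcons :: "nat \<Rightarrow> nat \<Rightarrow> nat" where "lcons a l = Suc (pair a l)"
definition lhd :: "nat \<Rightarrow> nat" where "lhd l = pfst (l - 1)"
definition ltl :: "nat \<Rightarrow> nat" where "ltl l = psnd (l - 1)"

lemma prod_decode_0 [simp]: "prod_decode 0 = (0, 0)"
  by (simp add: prod_decode_def prod_decode_aux.simps)

lemma list_code_simps [simp]:
  "lcons a (list_encode xs) = list_encode (a # xs)"
  "lhd (list_encode (a # xs)) = a"
  "ltl (list_encode xs) = list_encode (tl xs)"
  "list_encode xs = 0 \<longleftrightarrow> xs = []"
  by (auto simp: lcons_def lhd_def ltl_def, (cases xs; simp)+)

declare list_encode.simps(2) [simp del]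

lemma prim_rec_lcons: "prim_rec f \<Longrightarrow> prim_rec g \<Longrightarrow> prim_rec (\<lambda>x. lcons (f x) (g x))"
  unfolding lcons_def by (intro prim_rec_intros)

lemma prim_rec_lhd: "prim_rec f \<Longrightarrow> prim_rec (\<lambda>x. lhd (f x))"
  unfolding lhd_def by (intro prim_rec_intros)

lemma prim_rec_ltl: "prim_rec f \<Longrightarrow> prim_rec (\<lambda>x. ltl (f x))"
  unfolding ltl_def by (intro prim_rec_intros)

lemmas prim_rec_list_intros = prim_rec_intros prim_rec_lcons prim_rec_lhd prim_rec_ltl

definition ldrop :: "nat \<Rightarrow> nat \<Rightarrow> nat" where "ldrop n l = (ltl ^^ n) l"

lemma ldrop [simp]: "ldrop n (list_encode xs) = list_encode (drop n xs)"
proof (induction n arbitrary: xs)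
  case (Suc n)
  have "ldrop (Suc n) (list_encode xs) = ldrop n (list_encode (tl xs))"
    by (simp add: ldrop_def funpow_swap1)
  then show ?case by (simp add: Suc drop_Suc)
qed (simp add: ldrop_def)

lemma prim_rec_ldrop: "prim_rec n \<Longrightarrow> prim_rec f \<Longrightarrow> prim_rec (\<lambda>x. ldrop (n x) (f x))"
  unfolding ldrop_def by (intro prim_rec_list_intros)

lemma length_le_list_encode: "length xs \<le> list_encode xs"
proof (induction xs)
  case (Cons a xs)
  have "list_encode xs \<le> pair a (list_encode xs)" by (rule le_prod_encode_2)
  with Cons show ?case by (simp add: list_encode.simps)
qed simp

text \<open>Lists are traversed by iterating a step as often as the code of the list says, which is at
  least its length; the step therefore does nothing on the empty list.\<close>

definition lrev :: "nat \<Rightarrow> nat" where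
  "lrev l = psnd (((\<lambda>y. if pfst y = 0 then y
     else pair (ltl (pfst y)) (lcons (lhd (pfst y)) (psnd y))) ^^ l) (pair l 0))"

lemma lrev [simp]: "lrev (list_encode xs) = list_encode (rev xs)"
proof -
  let ?F = "\<lambda>y. if pfst y = 0 then y
     else pair (ltl (pfst y)) (lcons (lhd (pfst y)) (psnd y))"
  have "(?F ^^ n) (pair (list_encode xs) (list_encode ys)) = pair 0 (list_encode (rev xs @ ys))"
    if "length xs \<le> n" for n xs ys
    using that
  proof (induction n arbitrary: xs ys)
    case (Suc n)
    then show ?case
      using Suc.IH[of "[]" ys] by (cases xs) (simp_all del: funpow.simps add: funpow_Suc_right)
  qed simp
  from this[of xs "list_encode xs" "[]"] length_le_list_encode show ?thesis
    by (simp add: lrev_def)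
qed

lemma prim_rec_lrev: "prim_rec f \<Longrightarrow> prim_rec (\<lambda>x. lrev (f x))"
  unfolding lrev_def by (intro prim_rec_list_intros)

definition lsnoc :: "nat \<Rightarrow> nat \<Rightarrow> nat" where "lsnoc l a = lrev (lcons a (lrev l))"

lemma lsnoc [simp]: "lsnoc (list_encode xs) a = list_encode (xs @ [a])"
  by (simp add: lsnoc_def)

lemma prim_rec_lsnoc: "prim_rec f \<Longrightarrow> prim_rec g \<Longrightarrow> prim_rec (\<lambda>x. lsnoc (f x) (g x))"
  unfolding lsnoc_def by (intro prim_rec_lrev prim_rec_lcons)

text \<open>A memory with addresses and contents in \<open>\<nat>\<close>, almost all contents being \<open>0\<close>, is coded by the
  list of all write operations, the latest first.\<close>

definition mem_put :: "nat \<Rightarrow> nat \<Rightarrow> nat \<Rightarrow> nat" where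
  "mem_put s k v = lcons (pair k v) s"

definition mem_get :: "nat \<Rightarrow> nat \<Rightarrow> nat" where
  "mem_get s k = (let r = psnd (((\<lambda>y. if psnd y = 0 then y
     else if pfst (lhd (psnd y)) = pfst y then y
     else pair (pfst y) (ltl (psnd y))) ^^ s) (pair k s))
   in if r = 0 then 0 else psnd (lhd r))"

lemma mem_get_list_encode:
  "mem_get (list_encode xs) k =
    (case dropWhile (\<lambda>e. pfst e \<noteq> k) xs of [] \<Rightarrow> 0 | e # _ \<Rightarrow> psnd e)"
proof -
  let ?F = "\<lambda>y. if psnd y = 0 then y
     else if pfst (lhd (psnd y)) = pfst y then y
     else pair (pfst y) (ltl (psnd y))"
  have *: "(?F ^^ n) (pair k (list_encode xs)) = pair k (list_encode (dropWhile (\<lambda>e. pfst e \<noteq> k) xs))"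
    if "length xs \<le> n" for n xs
    using that
  proof (induction n arbitrary: xs)
    case (Suc n)
    have stay: "(?F ^^ m) (pair k (list_encode (e # es))) = pair k (list_encode (e # es))"
      if "pfst e = k" for m e es
      using that by (induction m) auto
    show ?case
    proof (cases xs)
      case (Cons e es)
      then show ?thesis
        using Suc stay[of e]
        by (cases "pfst e = k") (simp_all del: funpow.simps add: funpow_Suc_right)
    qed (use Suc.IH[of "[]"] in \<open>simp del: funpow.simps add: funpow_Suc_right\<close>)
  qed simp
  show ?thesis
    unfolding mem_get_def Let_def *[OF length_le_list_encode]
    by (simp split: list.split del: dropWhile_eq_Nil_conv)
qed

lemma mem_get_put [simp]: "mem_get (mem_put s k v) k' = (if k = k' then v else mem_get s k')"
proof -
  obtain xs where "s = list_encode xs" using list_decode_inverse by metis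
  then show ?thesis by (simp add: mem_put_def mem_get_list_encode)
qed

lemma mem_get_0 [simp]: "mem_get 0 k = 0"
  using mem_get_list_encode[of "[]" k] by simp

lemma prim_rec_mem_put:
  "prim_rec s \<Longrightarrow> prim_rec k \<Longrightarrow> prim_rec v \<Longrightarrow> prim_rec (\<lambda>x. mem_put (s x) (k x) (v x))"
  unfolding mem_put_def by (intro prim_rec_list_intros)

lemma prim_rec_mem_get:
  "prim_rec s \<Longrightarrow> prim_rec k \<Longrightarrow> prim_rec (\<lambda>x. mem_get (s x) (k x))"
  unfolding mem_get_def Let_def by (intro prim_rec_list_intros)

text \<open>The successor and predecessor of an integer under \<^const>\<open>int_encode\<close>, which maps \<open>z \<ge> 0\<close> to
  \<open>2 * z\<close> and \<open>z < 0\<close> to \<open>- 2 * z - 1\<close>.\<close>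

definition zsucc :: "nat \<Rightarrow> nat" where
  "zsucc n = (if n mod 2 = 0 then Suc (Suc n) else if n = 1 then 0 else n - 1 - 1)"
definition zpred :: "nat \<Rightarrow> nat" where
  "zpred n = (if n mod 2 = 1 then Suc (Suc n) else if n = 0 then 1 else n - 1 - 1)"

lemma zsucc [simp]: "zsucc (int_encode i) = int_encode (i + 1)"
  by (auto simp: zsucc_def int_encode_def sum_encode_def nat_add_distrib nat_diff_distrib; presburger)

lemma zpred [simp]: "zpred (int_encode i) = int_encode (i - 1)"
  by (auto simp: zpred_def int_encode_def sum_encode_def nat_add_distrib nat_diff_distrib; presburger)

lemma prim_rec_zsucc: "prim_rec f \<Longrightarrow> prim_rec (\<lambda>x. zsucc (f x))"
  unfolding zsucc_def by (intro prim_rec_intros prim_rec_mod_2)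

lemma prim_rec_zpred: "prim_rec f \<Longrightarrow> prim_rec (\<lambda>x. zpred (f x))"
  unfolding zpred_def by (intro prim_rec_intros prim_rec_mod_2)

text \<open>The step function of a machine is a case distinction on the label. There are finitely many labels,
  so the step function is primitive recursive if the branches are.\<close>

primrec dispatch :: "('a \<Rightarrow> nat) \<Rightarrow> ('k \<Rightarrow> nat) \<Rightarrow> ('k \<Rightarrow> 'a \<Rightarrow> 'b) \<Rightarrow> ('a \<Rightarrow> 'b) \<Rightarrow> 'k list \<Rightarrow> 'a \<Rightarrow> 'b"
  where
    "dispatch c code F d [] = d"
  | "dispatch c code F d (k # ks) = (\<lambda>x. if c x = code k then F k x else dispatch c code F d ks x)"

lemma prim_rec_dispatch:
  assumes "prim_rec c" "prim_rec d" "\<And>k. k \<in> set ks \<Longrightarrow> prim_rec (F k)"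
  shows "prim_rec (dispatch c code F d ks)"
  using assms(3) by (induction ks) (auto intro!: prim_rec_if_eq prim_rec_const assms(1,2))

lemma dispatch_eq:
  assumes "k \<in> set ks" "inj_on code (set ks)" "c x = code k"
  shows "dispatch c code F d ks x = F k x"
  using assms by (induction ks) (auto simp: inj_on_def)

lemma dispatch_default:
  assumes "\<And>k. k \<in> set ks \<Longrightarrow> c x \<noteq> code k"
  shows "dispatch c code F d ks x = d x"
  using assms by (induction ks) auto

lemmas prim_rec_mem_intros = prim_rec_list_intros prim_rec_ldrop prim_rec_lsnoc prim_rec_mem_put prim_rec_mem_get
  prim_rec_zsucc prim_rec_zpred prim_rec_div_2 prim_rec_mod_2 prim_rec_double

section \<open>Structured programs for Type-2 machines\<close>

datatype 's com =
    CSkip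
  | CRight nat
  | CLeft nat
  | COut 's
  | CSeq "'s com" "'s com" (infixr \<open>;;\<close> 60)
  | CIf nat "'s sym" "'s com" "'s com"
  | CUntil nat "'s sym" "'s com"

text \<open>The programs do not write on tapes. So the inscriptions \<open>\<alpha>\<close> are a parameter, and a state consists
  of the head positions and the output.\<close>

inductive exec :: "(nat \<Rightarrow> int \<Rightarrow> 's sym) \<Rightarrow> 's com \<Rightarrow> (nat \<Rightarrow> int) \<times> 's list \<Rightarrow>
    (nat \<Rightarrow> int) \<times> 's list \<Rightarrow> bool" for \<alpha> where
  skip: "exec \<alpha> CSkip \<sigma> \<sigma>"
| right: "exec \<alpha> (CRight i) (m, w) (m(i := m i + 1), w)"
| left: "exec \<alpha> (CLeft i) (m, w) (m(i := m i - 1), w)"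
| out: "exec \<alpha> (COut a) (m, w) (m, w @ [a])"
| seq: "exec \<alpha> c \<sigma> \<sigma>' \<Longrightarrow> exec \<alpha> d \<sigma>' \<sigma>'' \<Longrightarrow> exec \<alpha> (c ;; d) \<sigma> \<sigma>''"
| if_eq: "\<alpha> i (m i) = a \<Longrightarrow> exec \<alpha> c (m, w) \<sigma> \<Longrightarrow> exec \<alpha> (CIf i a c d) (m, w) \<sigma>"
| if_neq: "\<alpha> i (m i) \<noteq> a \<Longrightarrow> exec \<alpha> d (m, w) \<sigma> \<Longrightarrow> exec \<alpha> (CIf i a c d) (m, w) \<sigma>"
| until_end: "\<alpha> i (m i) = a \<Longrightarrow> exec \<alpha> (CUntil i a c) (m, w) (m, w)"
| until_loop: "\<alpha> i (m i) \<noteq> a \<Longrightarrow> exec \<alpha> c (m, w) \<sigma> \<Longrightarrow> exec \<alpha> (CUntil i a c) \<sigma> \<sigma>' \<Longrightarrow>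
    exec \<alpha> (CUntil i a c) (m, w) \<sigma>'"

primrec tapes :: "'s com \<Rightarrow> nat set" where
  "tapes CSkip = {}"
| "tapes (CRight i) = {i}"
| "tapes (CLeft i) = {i}"
| "tapes (COut a) = {}"
| "tapes (c ;; d) = tapes c \<union> tapes d"
| "tapes (CIf i a c d) = insert i (tapes c \<union> tapes d)"
| "tapes (CUntil i a c) = insert i (tapes c)"

primrec code_size :: "'s com \<Rightarrow> nat" where
  "code_size CSkip = 0"
| "code_size (CRight i) = 1"
| "code_size (CLeft i) = 1"
| "code_size (COut a) = 1"
| "code_size (c ;; d) = code_size c + code_size d"
| "code_size (CIf i a c d) = code_size c + code_size d + 2"
| "code_size (CUntil i a c) = code_size c + 2"

text \<open>An unconditional jump is a branch with two equal targets.\<close>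

abbreviation Jump :: "nat \<Rightarrow> 's t2_stm" where
  "Jump l \<equiv> Branch 0 Blank l l"

text \<open>The code is placed at label \<open>k\<close> and exits at the label behind its last statement.\<close>

primrec code :: "nat \<Rightarrow> 's com \<Rightarrow> 's t2_prog" where
  "code k CSkip = []"
| "code k (CRight i) = [MoveRight i (k + 1)]"
| "code k (CLeft i) = [MoveLeft i (k + 1)]"
| "code k (COut a) = [Emit a (k + 1)]"
| "code k (c ;; d) = code k c @ code (k + code_size c) d"
| "code k (CIf i a c d) =
     Branch i a (k + 1) (k + code_size c + 2) # code (k + 1) c @
     Jump (k + code_size c + code_size d + 2) # code (k + code_size c + 2) d"
| "code k (CUntil i a c) =
     Branch i a (k + code_size c + 2) (k + 1) # code (k + 1) c @ [Jump k]"

lemma length_code [simp]: "length (code k c) = code_size c"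
  by (induction c arbitrary: k) auto

lemma code_wf:
  assumes "tapes c \<subseteq> {..<N}" "0 < N" "k + code_size c \<le> e"
  shows "\<forall>s \<in> set (code k c). t2_stm_wf n N e s"
  using assms
proof (induction c arbitrary: k)
  case (CSeq c d)
  show ?case
    using CSeq.IH(1)[of k] CSeq.IH(2)[of "k + code_size c"] CSeq.prems by auto
next
  case (CIf i a c d)
  show ?case
    using CIf.IH(1)[of "k + 1"] CIf.IH(2)[of "k + code_size c + 2"] CIf.prems by auto
next
  case (CUntil i a c)
  show ?case
    using CUntil.IH[of "k + 1"] CUntil.prems by auto
qed auto

definition reaches :: "'s t2_prog \<Rightarrow> 's t2_conf \<Rightarrow> 's t2_conf \<Rightarrow> bool" where
  "reaches M c d \<longleftrightarrow> (\<exists>t. (t2_step M ^^ t) c = d)"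

lemma reaches_eq: "c = d \<Longrightarrow> reaches M c d"
  unfolding reaches_def by (rule exI[of _ 0]) simp

lemma reaches_trans: "reaches M c d \<Longrightarrow> reaches M d e \<Longrightarrow> reaches M c e"
  unfolding reaches_def by (metis comp_apply funpow_add)

lemma reaches_step: "reaches M (t2_step M c) d \<Longrightarrow> reaches M c d"
  unfolding reaches_def by (metis comp_apply funpow_Suc_right)

lemma t2_step_at:
  assumes "M = A @ s # B" "l = length A"
  shows "t2_step M (l, \<alpha>, m, w) = t2_exec s (l, \<alpha>, m, w)"
  using assms by (simp add: t2_step_def)

text \<open>The code may be placed anywhere in \<open>M\<close>, because control leaves the code of a structured program
  only at its end. Induction on the execution unrolls a loop as often as it is run.\<close>

lemma exec_code:
  assumes "exec \<alpha> c \<sigma> \<sigma>'" "M = A @ code (length A) c @ B"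
  shows "reaches M (length A, \<alpha>, \<sigma>) (length A + code_size c, \<alpha>, \<sigma>')"
  using assms
proof (induction arbitrary: A B)
  case (skip \<sigma>)
  then show ?case by (simp add: reaches_eq)
next
  case (right i m w)
  then have "M = A @ MoveRight i (length A + 1) # B" by simp
  from t2_step_at[OF this refl] show ?case
    by (intro reaches_step[OF reaches_eq]) simp
next
  case (left i m w)
  then have "M = A @ MoveLeft i (length A + 1) # B" by simp
  from t2_step_at[OF this refl] show ?case
    by (intro reaches_step[OF reaches_eq]) simp
next
  case (out a m w)
  then have "M = A @ Emit a (length A + 1) # B" by simp
  from t2_step_at[OF this refl] show ?case
    by (intro reaches_step[OF reaches_eq]) simp
next
  case (seq c \<sigma> \<sigma>' d \<sigma>'')
  have "reaches M (length A, \<alpha>, \<sigma>) (length A + code_size c, \<alpha>, \<sigma>')"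
    using seq.prems by (intro seq.IH(1)[where B = "code (length A + code_size c) d @ B"]) simp
  moreover have "reaches M (length (A @ code (length A) c), \<alpha>, \<sigma>')
      (length (A @ code (length A) c) + code_size d, \<alpha>, \<sigma>'')"
    using seq.prems by (intro seq.IH(2)[where B = B]) simp
  ultimately show ?case
    by (auto intro: reaches_trans simp: add.assoc)
next
  case (if_eq i m a c w \<sigma> d)
  let ?k = "length A"
  let ?J = "Jump (?k + code_size c + code_size d + 2) :: 'a t2_stm"
  let ?D = "code (?k + code_size c + 2) d"
  obtain m' w' where \<sigma>: "\<sigma> = (m', w')" by fastforce
  have M: "M = A @ Branch i a (?k + 1) (?k + code_size c + 2) # code (?k + 1) c @ ?J # ?D @ B"
    using if_eq.prems by simp
  have 1: "t2_step M (?k, \<alpha>, m, w) = (?k + 1, \<alpha>, m, w)"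
    using if_eq.hyps by (subst t2_step_at[OF M]) auto
  have 2: "reaches M (?k + 1, \<alpha>, m, w) (?k + 1 + code_size c, \<alpha>, \<sigma>)"
    using if_eq.IH[where A = "A @ [Branch i a (?k + 1) (?k + code_size c + 2)]" and B = "?J # ?D @ B"] M
    by simp
  have 3: "t2_step M (?k + 1 + code_size c, \<alpha>, m', w') =
      (?k + code_size c + code_size d + 2, \<alpha>, m', w')"
    using M by (subst t2_step_at[where A = "A @ [Branch i a (?k + 1) (?k + code_size c + 2)] @ code (?k + 1) c"
          and B = "?D @ B" and s = ?J]) auto
  have "reaches M (?k, \<alpha>, m, w) (?k + code_size c + code_size d + 2, \<alpha>, m', w')"
    using 1 2 3 unfolding \<sigma> by (metis reaches_eq reaches_step reaches_trans)
  then show ?case by (simp add: \<sigma> add.assoc)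
next
  case (if_neq i m a d w \<sigma> c)
  let ?k = "length A"
  let ?J = "Jump (?k + code_size c + code_size d + 2) :: 'a t2_stm"
  let ?D = "code (?k + code_size c + 2) d"
  let ?B = "Branch i a (?k + 1) (?k + code_size c + 2)"
  have M: "M = A @ ?B # code (?k + 1) c @ ?J # ?D @ B"
    using if_neq.prems by simp
  have 1: "t2_step M (?k, \<alpha>, m, w) = (?k + code_size c + 2, \<alpha>, m, w)"
    using if_neq.hyps by (subst t2_step_at[OF M]) auto
  have 2: "reaches M (?k + code_size c + 2, \<alpha>, m, w) (?k + code_size c + 2 + code_size d, \<alpha>, \<sigma>)"
    using if_neq.IH[where A = "A @ [?B] @ code (?k + 1) c @ [?J]" and B = B] M
    by (simp add: add.assoc)
  then show ?case
    using 1 reaches_step[of M "(?k, \<alpha>, m, w)"] by (simp add: add.assoc add.left_commute add.commute)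
next
  case (until_end i m a c w)
  then have "M = A @ Branch i a (length A + code_size c + 2) (length A + 1) #
      (code (length A + 1) c @ [Jump (length A)]) @ B" by simp
  from t2_step_at[OF this refl] show ?case
    using until_end.hyps by (intro reaches_step[OF reaches_eq]) simp
next
  case (until_loop i m a c w \<sigma> \<sigma>')
  let ?k = "length A"
  let ?B = "Branch i a (?k + code_size c + 2) (?k + 1)"
  obtain m' w' where \<sigma>: "\<sigma> = (m', w')" by fastforce
  have M: "M = A @ ?B # code (?k + 1) c @ Jump ?k # B"
    using until_loop.prems by simp
  have 1: "t2_step M (?k, \<alpha>, m, w) = (?k + 1, \<alpha>, m, w)"
    using until_loop.hyps by (subst t2_step_at[OF M]) auto
  have 2: "reaches M (?k + 1, \<alpha>, m, w) (?k + 1 + code_size c, \<alpha>, m', w')"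
    using until_loop.IH(1)[where A = "A @ [?B]" and B = "Jump ?k # B"] M
    by (simp add: \<sigma>)
  have 3: "t2_step M (?k + 1 + code_size c, \<alpha>, m', w') = (?k, \<alpha>, m', w')"
    using M by (subst t2_step_at[where A = "A @ [?B] @ code (?k + 1) c" and B = B and s = "Jump ?k"]) auto
  have "reaches M (?k, \<alpha>, m', w') (?k + code_size (CUntil i a c), \<alpha>, \<sigma>')"
    using until_loop.IH(2)[OF until_loop.prems] by (simp add: \<sigma>)
  then have "reaches M (?k + 1 + code_size c, \<alpha>, m', w') (?k + code_size (CUntil i a c), \<alpha>, \<sigma>')"
    by (intro reaches_step[of M "(?k + 1 + code_size c, \<alpha>, m', w')"]) (simp only: 3)
  with 2 have "reaches M (?k + 1, \<alpha>, m, w) (?k + code_size (CUntil i a c), \<alpha>, \<sigma>')"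
    by (rule reaches_trans)
  then show ?case
    by (intro reaches_step[of M "(?k, \<alpha>, m, w)"]) (simp only: 1)
qed

text \<open>On each work tape a marker in cell \<open>0\<close> is the only symbol, so that the head position is
  a counter with a test for \<open>0\<close>.\<close>

definition marked :: "int \<Rightarrow> 's sym" where
  "marked = (\<lambda>_. Blank)(0 := Aux 0)"

lemma marked_eq_Aux [simp]: "marked z = Aux 0 \<longleftrightarrow> z = 0"
  by (simp add: marked_def)

definition loop_tapes :: "nat \<Rightarrow> nat \<Rightarrow> (nat \<Rightarrow> 's str) \<Rightarrow> nat \<Rightarrow> int \<Rightarrow> 's sym" where
  "loop_tapes n N x = (\<lambda>i. if i < n then str_tape (x i) else if i < N then marked else (\<lambda>_. Blank))"

text \<open>The first \<open>N - n\<close> statements write the markers; the rest runs \<open>c\<close> again and again.\<close>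

definition loop_prog :: "nat \<Rightarrow> nat \<Rightarrow> 's com \<Rightarrow> 's t2_prog" where
  "loop_prog n N c = map (\<lambda>j. Put (n + j) (Aux 0) (j + 1)) [0..<N - n] @ code (N - n) c @ [Jump (N - n)]"

lemma loop_prog_wf:
  assumes "tapes c \<subseteq> {..<N}" "n \<le> N" "0 < N"
  shows "t2_wf n N (loop_prog n N c)"
  using assms code_wf[OF assms(1,3), of "N - n" "length (loop_prog n N c)"]
  by (auto simp: t2_wf_def loop_prog_def)

lemma loop_prog_init:
  assumes "n \<le> N"
  shows "t2_run n (loop_prog n N c) x (N - n) = (N - n, loop_tapes n N x, (\<lambda>_. 0), [])"
proof -
  let ?M = "loop_prog n N c"
  have "t2_run n ?M x j = (j, loop_tapes n (n + j) x, (\<lambda>_. 0), [])" if "j \<le> N - n" for j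
    using that
  proof (induction j)
    case (Suc j)
    have nth: "?M ! j = Put (n + j) (Aux 0) (j + 1)" "j < length ?M"
      using Suc.prems by (auto simp: loop_prog_def nth_append)
    have "t2_run n ?M x (Suc j) = t2_step ?M (j, loop_tapes n (n + j) x, (\<lambda>_. 0), [])"
      using Suc by (simp add: t2_run_def)
    also have "\<dots> = (Suc j, loop_tapes n (n + Suc j) x, (\<lambda>_. 0), [])"
      using nth by (auto simp: t2_step_def loop_tapes_def marked_def fun_eq_iff)
    finally show ?case .
  next
    case 0
    have "loop_tapes n (n + 0) x = (\<lambda>i. if i < n then str_tape (x i) else (\<lambda>_. Blank))"
      by (rule ext) (simp add: loop_tapes_def)
    then show ?case
      by (simp add: t2_run_def t2_initial_def)
  qed
  from this[of "N - n"] assms show ?thesis by simp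
qed

lemma t2_output_mono:
  "\<exists>u. t2_output (t2_run n M x (t + k)) = t2_output (t2_run n M x t) @ u"
proof (induction k)
  case (Suc k)
  have "\<exists>u. t2_output (t2_step M c) = t2_output c @ u" for c :: "'a t2_conf"
  proof -
    obtain l \<alpha> m w where c: "c = (l, \<alpha>, m, w)" by (cases c)
    show ?thesis unfolding c by (cases "M ! l") (auto simp: t2_step_def)
  qed
  then show ?case
    using Suc by (metis append.assoc add_Suc_right funpow.simps(2) comp_apply t2_run_def)
qed simp

lemma t2_halted_stays:
  assumes "t2_label (t2_run n M x t) = length M"
  shows "t2_run n M x (t + k) = t2_run n M x t"
  using assms by (induction k) (auto simp: t2_run_def t2_step_def)

text \<open>The jump back takes a step in every round, so the beginning of the loop is visited at arbitrarily
  late times. A machine that halts stays at its final label; hence this one never halts, and its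
  output at any time is a prefix of its output at a later visit.\<close>

lemma loop_prog_yields:
  assumes "n \<le> N" and \<sigma>0: "\<sigma> 0 = (\<lambda>_. 0, [])"
    and body: "\<And>r. exec (loop_tapes n N x) c (\<sigma> r) (\<sigma> (Suc r))"
    and pre: "\<And>r i. i < length (snd (\<sigma> r)) \<Longrightarrow> snd (\<sigma> r) ! i = q i"
    and unbounded: "\<And>k. \<exists>r. k \<le> length (snd (\<sigma> r))"
  shows "t2_yields n (loop_prog n N c) x (Seq q)"
proof -
  let ?M = "loop_prog n N c" and ?\<alpha> = "loop_tapes n N x" and ?K = "N - n"
  let ?A = "map (\<lambda>j. Put (n + j) (Aux 0) (j + 1)) [0..<N - n] :: 'a t2_prog"
  have M: "?M = ?A @ code (length ?A) c @ [Jump ?K]"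
    by (simp add: loop_prog_def)
  have visits: "\<exists>t\<ge>r. t2_run n ?M x t = (?K, ?\<alpha>, \<sigma> r)" for r
  proof (induction r)
    case 0
    show ?case using loop_prog_init[OF assms(1), of c x] by (auto simp: \<sigma>0)
  next
    case (Suc r)
    then obtain t where t: "r \<le> t" "t2_run n ?M x t = (?K, ?\<alpha>, \<sigma> r)" by blast
    obtain t' where t': "(t2_step ?M ^^ t') (?K, ?\<alpha>, \<sigma> r) = (?K + code_size c, ?\<alpha>, \<sigma> (Suc r))"
      using exec_code[OF body M] by (auto simp: reaches_def)
    obtain m' w' where \<sigma>': "\<sigma> (Suc r) = (m', w')" by fastforce
    have "t2_step ?M (?K + code_size c, ?\<alpha>, \<sigma> (Suc r)) = (?K, ?\<alpha>, \<sigma> (Suc r))"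
      unfolding \<sigma>' by (subst t2_step_at[where A = "?A @ code (length ?A) c"]) (auto simp: loop_prog_def)
    then have "t2_run n ?M x (Suc (t' + t)) = (?K, ?\<alpha>, \<sigma> (Suc r))"
      using t(2) t' by (simp add: t2_run_def funpow_add)
    then show ?case using t(1) by (intro exI[of _ "Suc (t' + t)"]) auto
  qed
  have nohalt: "t2_label (t2_run n ?M x t) \<noteq> length ?M" for t
  proof
    assume halt: "t2_label (t2_run n ?M x t) = length ?M"
    obtain t' where t': "t \<le> t'" "t2_run n ?M x t' = (?K, ?\<alpha>, \<sigma> t)" using visits by blast
    have "t2_label (t2_run n ?M x t') = length ?M"
      using t2_halted_stays[OF halt, of "t' - t"] halt t'(1) by simp
    then have "?K = length ?M"
      unfolding t'(2) by (cases "\<sigma> t") simp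
    then show False by (simp add: loop_prog_def)
  qed
  have out: "t2_output (t2_run n ?M x t) ! i = q i" if "i < length (t2_output (t2_run n ?M x t))" for t i
  proof -
    obtain t' where t': "t \<le> t'" "t2_run n ?M x t' = (?K, ?\<alpha>, \<sigma> t)" using visits by blast
    obtain u where "t2_output (t2_run n ?M x (t + (t' - t))) = t2_output (t2_run n ?M x t) @ u"
      using t2_output_mono by blast
    then have "snd (\<sigma> t) = t2_output (t2_run n ?M x t) @ u"
      using t' by (cases "\<sigma> t") simp
    then show ?thesis using that pre[of i t] by (auto simp: nth_append)
  qed
  have "\<exists>t. k \<le> length (t2_output (t2_run n ?M x t))" for k
  proof -
    obtain r where r: "k \<le> length (snd (\<sigma> r))" using unbounded by blast
    obtain t where "t2_run n ?M x t = (?K, ?\<alpha>, \<sigma> r)" using visits by blast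
    then show ?thesis using r by (cases "\<sigma> r") (auto intro: exI[of _ t])
  qed
  with nohalt out show ?thesis by simp
qed

section \<open>Primitive recursive functions on counters\<close>

text \<open>Here \<open>m k\<close> are the head positions when counter \<open>r\<close> has come down to \<open>k\<close>.\<close>

lemma exec_countdown:
  assumes "\<alpha> r = marked" "\<And>k. k \<le> n \<Longrightarrow> m k r = int k"
    and "\<And>k. k < n \<Longrightarrow> exec \<alpha> c (m (Suc k), w) (m k, w)"
  shows "exec \<alpha> (CUntil r (Aux 0) c) (m n, w) (m 0, w)"
  using assms(2,3)
proof (induction n)
  case 0
  then show ?case by (intro until_end) (simp add: assms(1))
next
  case (Suc n)
  show ?case
  proof (rule until_loop)
    show "\<alpha> r (m (Suc n) r) \<noteq> Aux 0"
      using Suc.prems(1)[of "Suc n"] by (simp add: assms(1))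
    show "exec \<alpha> c (m (Suc n), w) (m n, w)"
      by (rule Suc.prems(2)) simp
    show "exec \<alpha> (CUntil r (Aux 0) c) (m n, w) (m 0, w)"
      by (rule Suc.IH) (simp_all add: Suc.prems)
  qed
qed

primrec increments :: "nat list \<Rightarrow> 's com" where
  "increments [] = CSkip"
| "increments (r # rs) = CRight r ;; increments rs"

lemma exec_increments:
  "distinct rs \<Longrightarrow> exec \<alpha> (increments rs) (m, w) (\<lambda>i. if i \<in> set rs then m i + 1 else m i, w)"
proof (induction rs arbitrary: m)
  case (Cons r rs)
  have "(\<lambda>i. if i \<in> set (r # rs) then m i + 1 else m i) =
      (\<lambda>i. if i \<in> set rs then (m(r := m r + 1)) i + 1 else (m(r := m r + 1)) i)"
    using Cons.prems by (auto simp: fun_eq_iff)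
  then show ?case
    using Cons by (auto intro!: exec.seq exec.right)
qed (simp add: exec.skip)

text \<open>The value of a counter can be used only by counting down, which destroys it. Adding it to two
  counters meanwhile serves to make a copy.\<close>

definition drain :: "nat \<Rightarrow> nat list \<Rightarrow> 's com" where
  "drain r rs = CUntil r (Aux 0) (CLeft r ;; increments rs)"

lemma exec_drain:
  assumes "\<alpha> r = marked" "m r = int n" "distinct (r # rs)"
    and m': "m' = (\<lambda>i. if i = r then 0 else if i \<in> set rs then m i + int n else m i)"
  shows "exec \<alpha> (drain r rs) (m, w) (m', w)"
proof -
  let ?m = "\<lambda>k i. if i = r then int k else if i \<in> set rs then m i + int (n - k) else m i"
  have "exec \<alpha> (CUntil r (Aux 0) (CLeft r ;; increments rs)) (?m n, w) (?m 0, w)"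
  proof (rule exec_countdown)
    fix k assume k: "k < n"
    have "exec \<alpha> (increments rs) ((?m (Suc k))(r := ?m (Suc k) r - 1), w)
      (\<lambda>i. if i \<in> set rs then ((?m (Suc k))(r := ?m (Suc k) r - 1)) i + 1
        else ((?m (Suc k))(r := ?m (Suc k) r - 1)) i, w)"
      using assms(3) by (intro exec_increments) simp
    moreover have "(\<lambda>i. if i \<in> set rs then ((?m (Suc k))(r := ?m (Suc k) r - 1)) i + 1
        else ((?m (Suc k))(r := ?m (Suc k) r - 1)) i) = ?m k"
      using assms(3) k by (auto simp: fun_eq_iff)
    ultimately have "exec \<alpha> (increments rs) ((?m (Suc k))(r := ?m (Suc k) r - 1), w) (?m k, w)"
      by (simp only:)
    then show "exec \<alpha> (CLeft r ;; increments rs) (?m (Suc k), w) (?m k, w)"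
      by (rule exec.seq[OF exec.left])
  qed (use assms in auto)
  moreover have "?m n = m" using assms(2) by (auto simp: fun_eq_iff)
  moreover have "?m 0 = m'" unfolding m' by (auto simp: fun_eq_iff)
  ultimately show ?thesis unfolding drain_def by simp
qed

lemma tapes_increments [simp]: "tapes (increments rs) = set rs"
  by (induction rs) auto

lemma tapes_drain [simp]: "tapes (drain r rs) = insert r (set rs)"
  by (simp add: drain_def)

text \<open>The order in which \<^const>\<open>prod_encode\<close> enumerates the pairs: along a diagonal, and from its end to the
  beginning of the next one.\<close>

lemma prod_encode_next:
  "Suc (prod_encode (a, c)) = prod_encode (if c = 0 then (0, Suc a) else (Suc a, c - 1))"
  by (cases c) (simp_all add: prod_encode_def)

lemma prod_decode_Suc:
  "prod_decode (Suc n) = (let (a, c) = prod_decode n in if c = 0 then (0, Suc a) else (Suc a, c - 1))"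
proof (cases "prod_decode n")
  case (Pair a c)
  then have n: "n = prod_encode (a, c)" by (metis prod_decode_inverse)
  have "Suc n = prod_encode (if c = 0 then (0, Suc a) else (Suc a, c - 1))"
    unfolding n by (rule prod_encode_next)
  then show ?thesis using Pair by (simp del: prod_encode_eq)
qed

text \<open>While counter \<open>b\<close> goes down to \<open>0\<close>, the pair \<open>(r1, r2)\<close> moves along the diagonal enumeration.\<close>

definition unpair :: "nat \<Rightarrow> nat \<Rightarrow> nat \<Rightarrow> 's com" where
  "unpair b r1 r2 = CUntil b (Aux 0) (CLeft b ;;
     CIf r2 (Aux 0) (drain r1 [r2] ;; CRight r2) (CRight r1 ;; CLeft r2))"

lemma exec_unpair:
  assumes "\<alpha> b = marked" "\<alpha> r1 = marked" "\<alpha> r2 = marked" "distinct [b, r1, r2]"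
    and "m b = int n" "m r1 = 0" "m r2 = 0"
    and m': "m' = m(b := 0, r1 := int (pfst n), r2 := int (psnd n))"
  shows "exec \<alpha> (unpair b r1 r2) (m, w) (m', w)"
proof -
  let ?m = "\<lambda>k. m(b := int k, r1 := int (pfst (n - k)), r2 := int (psnd (n - k)))"
  have "exec \<alpha> (unpair b r1 r2) (?m n, w) (?m 0, w)"
    unfolding unpair_def
  proof (rule exec_countdown)
    fix k assume k: "k < n"
    then have Suc: "n - k = Suc (n - Suc k)" by simp
    obtain a c where ac: "prod_decode (n - Suc k) = (a, c)" by fastforce
    have left: "exec \<alpha> (CLeft b) (?m (Suc k), w) ((?m (Suc k))(b := ?m (Suc k) b - 1), w)"
      by (rule exec.left)
    let ?if = "CIf r2 (Aux 0) (drain r1 [r2] ;; CRight r2) (CRight r1 ;; CLeft r2) :: 'a com"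
    have "exec \<alpha> ?if ((?m (Suc k))(b := ?m (Suc k) b - 1), w) (?m k, w)"
    proof (cases "c = 0")
      case True
      let ?m1 = "m(b := int k, r1 := 0, r2 := int a)"
      have "exec \<alpha> (drain r1 [r2]) ((?m (Suc k))(b := ?m (Suc k) b - 1), w) (?m1, w)"
        by (rule exec_drain[where n = a]) (use assms ac True in \<open>auto simp: fun_eq_iff\<close>)
      moreover have "exec \<alpha> (CRight r2) (?m1, w) (?m k, w)"
      proof -
        have "?m k = ?m1(r2 := ?m1 r2 + 1)"
          using True assms(4) unfolding Suc prod_decode_Suc ac by (auto simp: fun_eq_iff)
        then show ?thesis using exec.right[of \<alpha> r2 ?m1 w] by (simp only:)
      qed
      ultimately have "exec \<alpha> (drain r1 [r2] ;; CRight r2) ((?m (Suc k))(b := ?m (Suc k) b - 1), w) (?m k, w)"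
        by (rule exec.seq)
      then show ?thesis
        using True ac assms(3,4) by (intro exec.if_eq) simp_all
    next
      case False
      let ?mb = "(?m (Suc k))(b := ?m (Suc k) b - 1)"
      let ?m1 = "?mb(r1 := ?mb r1 + 1)"
      have "prod_decode (n - k) = (Suc a, c - 1)"
        using False unfolding Suc prod_decode_Suc ac by simp
      then have "?m k = ?m1(r2 := ?m1 r2 - 1)"
        using False assms(4) ac by (simp add: fun_eq_iff of_nat_diff)
      then have "exec \<alpha> (CLeft r2) (?m1, w) (?m k, w)"
        using exec.left[of \<alpha> r2 ?m1 w] by (simp only:)
      then have "exec \<alpha> (CRight r1 ;; CLeft r2) (?mb, w) (?m k, w)"
        by (rule exec.seq[OF exec.right])
      then show ?thesis
        using False ac assms(3,4) by (intro exec.if_neq) simp_all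
    qed
    then show "exec \<alpha> (CLeft b ;; ?if) (?m (Suc k), w) (?m k, w)"
      by (rule exec.seq[OF left])
  qed (use assms in auto)
  moreover have "?m n = m" using assms by (auto simp: fun_eq_iff)
  ultimately show ?thesis unfolding m' by simp
qed

text \<open>Computes \<open>triangle (a + c) + a\<close> from the values \<open>a\<close>, \<open>c\<close> of \<open>b\<close>, \<open>r\<close>, using that
  the triangle number is the sum of the numbers up to \<open>a + c\<close>.\<close>

definition pair_up :: "nat \<Rightarrow> nat \<Rightarrow> nat \<Rightarrow> 's com" where
  "pair_up b r r' = drain b [r', r] ;;
     CUntil r (Aux 0) (drain r [b, r'] ;; drain b [r] ;; CLeft r) ;; drain r' [b]"

lemma exec_pair_up:
  assumes "\<alpha> b = marked" "\<alpha> r = marked" "\<alpha> r' = marked" "distinct [b, r, r']"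
    and "m b = int a" "m r = int c" "m r' = 0"
    and m': "m' = m(b := int (pair a c), r := 0)"
  shows "exec \<alpha> (pair_up b r r') (m, w) (m', w)"
proof -
  let ?m = "\<lambda>k. m(b := 0, r := int k, r' := int a + int (triangle (a + c)) - int (triangle k))"
  have 1: "exec \<alpha> (drain b [r', r]) (m, w) (?m (a + c), w)"
    by (rule exec_drain[where n = a]) (use assms in \<open>auto simp: fun_eq_iff\<close>)
  have 2: "exec \<alpha> (CUntil r (Aux 0) (drain r [b, r'] ;; drain b [r] ;; CLeft r)) (?m (a + c), w) (?m 0, w)"
  proof (rule exec_countdown)
    fix k
    let ?m1 = "(?m (Suc k))(r := 0, b := int (Suc k), r' := ?m (Suc k) r' + int (Suc k))"
    let ?m2 = "?m1(r := int (Suc k), b := 0)"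
    have "exec \<alpha> (drain r [b, r']) (?m (Suc k), w) (?m1, w)"
      by (rule exec_drain[where n = "Suc k"]) (use assms in \<open>auto simp: fun_eq_iff\<close>)
    moreover have "exec \<alpha> (drain b [r]) (?m1, w) (?m2, w)"
      by (rule exec_drain[where n = "Suc k"]) (use assms in \<open>auto simp: fun_eq_iff\<close>)
    moreover have "exec \<alpha> (CLeft r) (?m2, w) (?m k, w)"
    proof -
      have "?m2(r := ?m2 r - 1) = ?m k"
        using assms(4) by (auto simp: fun_eq_iff)
      then show ?thesis using exec.left[of \<alpha> r ?m2 w] by (simp only:)
    qed
    ultimately show "exec \<alpha> (drain r [b, r'] ;; drain b [r] ;; CLeft r) (?m (Suc k), w) (?m k, w)"
      by (intro exec.seq)
  qed (use assms in auto)
  have 3: "exec \<alpha> (drain r' [b]) (?m 0, w) (m', w)"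
    by (rule exec_drain[where n = "pair a c"])
      (use assms in \<open>auto simp: fun_eq_iff prod_encode_def m'\<close>)
  show ?thesis
    unfolding pair_up_def by (intro exec.seq[OF 1] exec.seq[OF 2] 3)
qed

text \<open>Program \<open>c b\<close> replaces the value of counter \<open>b\<close> by its image under \<open>f\<close> and leaves the \<open>w - 1\<close>
  counters behind \<open>b\<close> at \<open>0\<close>.\<close>

definition implements :: "nat \<Rightarrow> (nat \<Rightarrow> 's com) \<Rightarrow> (nat \<Rightarrow> nat) \<Rightarrow> bool" where
  "implements w c f \<longleftrightarrow> 0 < w \<and> (\<forall>b. tapes (c b) \<subseteq> {b..<b + w} \<and>
     (\<forall>\<alpha> m out x. (\<forall>r \<in> {b..<b + w}. \<alpha> r = marked) \<longrightarrow> m b = int x \<longrightarrow>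
        (\<forall>r \<in> {b<..<b + w}. m r = 0) \<longrightarrow> exec \<alpha> (c b) (m, out) (m(b := int (f x)), out)))"

lemma implementsI:
  assumes "0 < w" "\<And>b. tapes (c b) \<subseteq> {b..<b + w}"
    and "\<And>b \<alpha> m out x. (\<And>r. b \<le> r \<Longrightarrow> r < b + w \<Longrightarrow> \<alpha> r = marked) \<Longrightarrow> m b = int x \<Longrightarrow>
      (\<And>r. b < r \<Longrightarrow> r < b + w \<Longrightarrow> m r = 0) \<Longrightarrow> exec \<alpha> (c b) (m, out) (m(b := int (f x)), out)"
  shows "implements w c f"
  using assms unfolding implements_def by simp

lemma implements_exec:
  assumes "implements w c f" "\<And>r. b \<le> r \<Longrightarrow> r < b + w \<Longrightarrow> \<alpha> r = marked" "m b = int x"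
    and "\<And>r. b < r \<Longrightarrow> r < b + w \<Longrightarrow> m r = 0" "m' = m(b := int (f x))"
  shows "exec \<alpha> (c b) (m, out) (m', out)"
  using assms unfolding implements_def by simp

lemma implements_tapes: "implements w c f \<Longrightarrow> tapes (c b) \<subseteq> {b..<b + w}"
  unfolding implements_def by blast

text \<open>The programs work in place, so a composition is a sequence of two programs. For a pairing the
  argument is first copied to a second block of counters; an iteration keeps its counter outside the
  block of the iterated program.\<close>

lemma prim_rec_implements:
  assumes "prim_rec f"
  shows "\<exists>w c. implements w (c :: nat \<Rightarrow> 's com) f"
  using assms
proof induction
  case zero
  have "implements 1 (\<lambda>b. drain b [] :: 's com) (\<lambda>_. 0)"
    by (rule implementsI) (auto intro!: exec_drain simp: fun_eq_iff)
  then show ?case by blast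
next
  case ident
  have "implements 1 (\<lambda>b. CSkip :: 's com) (\<lambda>x. x)"
    by (rule implementsI) (auto simp: exec.skip fun_upd_idem)
  then show ?case by blast
next
  case succ
  have "implements 1 (\<lambda>b. CRight b :: 's com) Suc"
  proof (rule implementsI)
    fix b x \<alpha> out and m :: "nat \<Rightarrow> int" assume "m b = int x"
    then show "exec \<alpha> (CRight b :: 's com) (m, out) (m(b := int (Suc x)), out)"
      using exec.right[of \<alpha> b m out] by (simp add: add.commute)
  qed auto
  then show ?case by blast
next
  case first
  have "implements 3 (\<lambda>b. unpair b (b + 1) (b + 2) ;; drain (b + 2) [] ;; drain (b + 1) [b] :: 's com)
     (\<lambda>x. pfst x)"
  proof (rule implementsI)
    fix b x and out :: "'s list" and \<alpha> :: "nat \<Rightarrow> int \<Rightarrow> 's sym" and m :: "nat \<Rightarrow> int"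
    assume a: "\<And>r. b \<le> r \<Longrightarrow> r < b + 3 \<Longrightarrow> \<alpha> r = marked" "m b = int x"
      "\<And>r. b < r \<Longrightarrow> r < b + 3 \<Longrightarrow> m r = 0"
    show "exec \<alpha> (unpair b (b + 1) (b + 2) ;; drain (b + 2) [] ;; drain (b + 1) [b]) (m, out)
      (m(b := int (pfst x)), out)"
      by (rule exec.seq[OF exec_unpair[where n = x]], (use a in \<open>simp; fail\<close>)+)
        (auto intro!: exec.seq exec_drain simp: a fun_eq_iff)
  qed (auto simp: unpair_def)
  then show ?case by blast
next
  case second
  have "implements 3 (\<lambda>b. unpair b (b + 1) (b + 2) ;; drain (b + 1) [] ;; drain (b + 2) [b] :: 's com)
     (\<lambda>x. psnd x)"
  proof (rule implementsI)
    fix b x and out :: "'s list" and \<alpha> :: "nat \<Rightarrow> int \<Rightarrow> 's sym" and m :: "nat \<Rightarrow> int"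
    assume a: "\<And>r. b \<le> r \<Longrightarrow> r < b + 3 \<Longrightarrow> \<alpha> r = marked" "m b = int x"
      "\<And>r. b < r \<Longrightarrow> r < b + 3 \<Longrightarrow> m r = 0"
    show "exec \<alpha> (unpair b (b + 1) (b + 2) ;; drain (b + 1) [] ;; drain (b + 2) [b]) (m, out)
      (m(b := int (psnd x)), out)"
      by (rule exec.seq[OF exec_unpair[where n = x]], (use a in \<open>simp; fail\<close>)+)
        (auto intro!: exec.seq exec_drain simp: a fun_eq_iff)
  qed (auto simp: unpair_def)
  then show ?case by blast
next
  case (pairing f g)
  then obtain v c w d where c: "implements v (c :: nat \<Rightarrow> 's com) f" and d: "implements w (d :: nat \<Rightarrow> 's com) g"
    by blast
  have pos: "0 < v" "0 < w" using c d by (auto simp: implements_def)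
  let ?p = "\<lambda>b. drain b [b + v, b + v + w] ;; drain (b + v + w) [b] ;; c b ;; d (b + v) ;;
    pair_up b (b + v) (b + v + w)"
  have "implements (v + w + 1) ?p (\<lambda>x. pair (f x) (g x))"
  proof (rule implementsI)
    fix b show "tapes (?p b) \<subseteq> {b..<b + (v + w + 1)}"
      using implements_tapes[OF c, of b] implements_tapes[OF d, of "b + v"] pos
      by (auto simp: pair_up_def)
  next
    fix b x and out :: "'s list" and \<alpha> :: "nat \<Rightarrow> int \<Rightarrow> 's sym" and m :: "nat \<Rightarrow> int"
    assume a: "\<And>r. b \<le> r \<Longrightarrow> r < b + (v + w + 1) \<Longrightarrow> \<alpha> r = marked" "m b = int x"
      "\<And>r. b < r \<Longrightarrow> r < b + (v + w + 1) \<Longrightarrow> m r = 0"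
    have 1: "exec \<alpha> (drain b [b + v, b + v + w]) (m, out) (m(b := 0, b + v := int x, b + v + w := int x), out)"
      by (rule exec_drain) (use a pos in \<open>auto simp: fun_eq_iff\<close>)
    have 2: "exec \<alpha> (drain (b + v + w) [b]) (m(b := 0, b + v := int x, b + v + w := int x), out)
        (m(b + v := int x), out)"
      by (rule exec_drain) (use a pos in \<open>auto simp: fun_eq_iff\<close>)
    have 3: "exec \<alpha> (c b) (m(b + v := int x), out) (m(b + v := int x, b := int (f x)), out)"
      by (rule implements_exec[OF c]) (use a pos in auto)
    have 4: "exec \<alpha> (d (b + v)) (m(b + v := int x, b := int (f x)), out)
       (m(b := int (f x), b + v := int (g x)), out)"
      by (rule implements_exec[OF d]) (use a pos in \<open>auto simp: fun_eq_iff\<close>)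
    have 5: "exec \<alpha> (pair_up b (b + v) (b + v + w)) (m(b := int (f x), b + v := int (g x)), out)
       (m(b := int (pair (f x) (g x))), out)"
      by (rule exec_pair_up) (use a pos in \<open>auto simp: fun_eq_iff\<close>)
    show "exec \<alpha> (?p b) (m, out) (m(b := int (pair (f x) (g x))), out)"
      by (intro exec.seq[OF 1] exec.seq[OF 2] exec.seq[OF 3] exec.seq[OF 4] 5)
  qed simp
  then show ?case by blast
next
  case (compose f g)
  then obtain v c w d where c: "implements v (c :: nat \<Rightarrow> 's com) f" and d: "implements w (d :: nat \<Rightarrow> 's com) g"
    by blast
  have "implements (v + w) (\<lambda>b. d b ;; c b) (\<lambda>x. f (g x))"
  proof (rule implementsI)
    fix b show "tapes (d b ;; c b) \<subseteq> {b..<b + (v + w)}"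
      using implements_tapes[OF c, of b] implements_tapes[OF d, of b] by auto
  next
    fix b x and out :: "'s list" and \<alpha> :: "nat \<Rightarrow> int \<Rightarrow> 's sym" and m :: "nat \<Rightarrow> int"
    assume a: "\<And>r. b \<le> r \<Longrightarrow> r < b + (v + w) \<Longrightarrow> \<alpha> r = marked" "m b = int x"
      "\<And>r. b < r \<Longrightarrow> r < b + (v + w) \<Longrightarrow> m r = 0"
    show "exec \<alpha> (d b ;; c b) (m, out) (m(b := int (f (g x))), out)"
      by (rule exec.seq[OF implements_exec[OF d _ _ _ refl] implements_exec[OF c]]) (use a in auto)
  qed (use c in \<open>auto simp: implements_def\<close>)
  then show ?case by blast
next
  case (iterate f)
  then obtain v c where c: "implements v (c :: nat \<Rightarrow> 's com) f" by blast
  let ?w = "v + 3"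
  let ?p = "\<lambda>b. unpair b (b + 1) (b + 2) ;; drain (b + 1) [b + ?w] ;; drain (b + 2) [b] ;;
    CUntil (b + ?w) (Aux 0) (CLeft (b + ?w) ;; c b)"
  have "implements (?w + 1) ?p (\<lambda>x. (f ^^ pfst x) (psnd x))"
  proof (rule implementsI)
    fix b show "tapes (?p b) \<subseteq> {b..<b + (?w + 1)}"
      using implements_tapes[OF c, of b] by (auto simp: unpair_def)
  next
    fix b x and out :: "'s list" and \<alpha> :: "nat \<Rightarrow> int \<Rightarrow> 's sym" and m :: "nat \<Rightarrow> int"
    assume a: "\<And>r. b \<le> r \<Longrightarrow> r < b + (?w + 1) \<Longrightarrow> \<alpha> r = marked" "m b = int x"
      "\<And>r. b < r \<Longrightarrow> r < b + (?w + 1) \<Longrightarrow> m r = 0"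
    let ?n = "pfst x" and ?y = "psnd x"
    \<comment> \<open>The counter \<open>b + ?w\<close> of the remaining iterations lies outside the block that \<open>c b\<close> uses.\<close>
    let ?m = "\<lambda>k. m(b := int ((f ^^ (?n - k)) ?y), b + ?w := int k)"
    have 1: "exec \<alpha> (unpair b (b + 1) (b + 2)) (m, out) (m(b := 0, b + 1 := int ?n, b + 2 := int ?y), out)"
      by (rule exec_unpair) (use a in auto)
    have 2: "exec \<alpha> (drain (b + 1) [b + ?w]) (m(b := 0, b + 1 := int ?n, b + 2 := int ?y), out)
        (m(b := 0, b + ?w := int ?n, b + 2 := int ?y), out)"
      by (rule exec_drain) (use a in \<open>auto simp: fun_eq_iff\<close>)
    have 3: "exec \<alpha> (drain (b + 2) [b]) (m(b := 0, b + ?w := int ?n, b + 2 := int ?y), out) (?m ?n, out)"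
      by (rule exec_drain) (use a in \<open>auto simp: fun_eq_iff\<close>)
    have 4: "exec \<alpha> (CUntil (b + ?w) (Aux 0) (CLeft (b + ?w) ;; c b)) (?m ?n, out) (?m 0, out)"
    proof (rule exec_countdown)
      fix k assume "k < ?n"
      then have Suc: "?n - k = Suc (?n - Suc k)" by simp
      have "exec \<alpha> (c b) ((?m (Suc k))(b + ?w := ?m (Suc k) (b + ?w) - 1), out) (?m k, out)"
        by (rule implements_exec[OF c]) (use a in \<open>auto simp: fun_eq_iff Suc\<close>)
      then show "exec \<alpha> (CLeft (b + ?w) ;; c b) (?m (Suc k), out) (?m k, out)"
        by (rule exec.seq[OF exec.left])
    qed (use a in auto)
    have 5: "?m 0 = m(b := int ((f ^^ ?n) ?y))"
      using a(3)[of "b + ?w"] by (auto simp: fun_eq_iff)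
    show "exec \<alpha> (?p b) (m, out) (m(b := int ((f ^^ ?n) ?y)), out)"
      by (intro exec.seq[OF 1] exec.seq[OF 2] exec.seq[OF 3]) (use 4 5 in metis)
  qed simp
  then show ?case by blast
qed

section \<open>Machines that iterate a primitive recursive function\<close>

lemma implements_mono: "implements v c f \<Longrightarrow> v \<le> w \<Longrightarrow> implements w c f"
proof (rule implementsI)
  assume c: "implements v c f" and vw: "v \<le> w"
  show "0 < w" using c vw by (auto simp: implements_def)
  show "tapes (c b) \<subseteq> {b..<b + w}" for b
    using implements_tapes[OF c, of b] vw by auto
  show "exec \<alpha> (c b) (m, out) (m(b := int (f x)), out)"
    if "\<And>r. b \<le> r \<Longrightarrow> r < b + w \<Longrightarrow> \<alpha> r = marked" "m b = int x"
      "\<And>r. b < r \<Longrightarrow> r < b + w \<Longrightarrow> m r = 0" for b \<alpha> m out x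
    by (rule implements_exec[OF c]) (use that vw in auto)
qed

text \<open>A common width for finitely many functions, so that one layout of the counters serves them all.\<close>

lemma prim_rec_implements_finite:
  assumes "finite F" "\<And>f. f \<in> F \<Longrightarrow> prim_rec f"
  shows "\<exists>w. 0 < w \<and> (\<forall>f \<in> F. \<exists>c. implements w (c :: nat \<Rightarrow> 's com) f)"
  using assms
proof (induction F rule: finite_induct)
  case (insert f F)
  then obtain w where w: "0 < w" "\<forall>f \<in> F. \<exists>c. implements w (c :: nat \<Rightarrow> 's com) f" by auto
  obtain v c where v: "implements v (c :: nat \<Rightarrow> 's com) f"
    using prim_rec_implements insert.prems by blast
  have "\<forall>g \<in> insert f F. \<exists>c. implements (v + w) (c :: nat \<Rightarrow> 's com) g"
    using w(2) v implements_mono le_add1 le_add2 by blast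
  then show ?case using w(1) by (intro exI[of _ "v + w"]) auto
qed auto

primrec com_seq :: "'s com list \<Rightarrow> 's com" where
  "com_seq [] = CSkip"
| "com_seq (c # cs) = c ;; com_seq cs"

lemma tapes_com_seq [simp]: "tapes (com_seq cs) = (\<Union>c\<in>set cs. tapes c)"
  by (induction cs) auto

lemma exec_com_seq_append:
  "exec \<alpha> (com_seq cs) \<sigma> \<sigma>' \<Longrightarrow> exec \<alpha> (com_seq ds) \<sigma>' \<sigma>'' \<Longrightarrow> exec \<alpha> (com_seq (cs @ ds)) \<sigma> \<sigma>''"
proof (induction cs arbitrary: \<sigma>)
  case Nil
  from Nil(1) have "\<sigma> = \<sigma>'" by (cases rule: exec.cases) auto
  then show ?case using Nil by simp
next
  case (Cons c cs)
  from Cons.prems(1) obtain \<tau> where "exec \<alpha> c \<sigma> \<tau>" "exec \<alpha> (com_seq cs) \<tau> \<sigma>'"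
    by (cases rule: exec.cases) auto
  then show ?case
    using exec.seq[of \<alpha> c \<sigma> \<tau>] Cons.IH[of \<tau>] Cons.prems(2) by simp
qed

primrec switch :: "nat \<Rightarrow> ('s \<Rightarrow> 's com) \<Rightarrow> 's list \<Rightarrow> 's com" where
  "switch j c [] = CSkip"
| "switch j c (a # as) = CIf j (Letter a) (c a) (switch j c as)"

lemma exec_switch:
  assumes "\<alpha> j (m j) = Letter a" "a \<in> set as" "exec \<alpha> (c a) (m, w) \<sigma>"
  shows "exec \<alpha> (switch j c as) (m, w) \<sigma>"
  using assms
proof (induction as)
  case (Cons b as)
  show ?case
  proof (cases "b = a")
    case True
    then show ?thesis using Cons.prems by (auto intro: exec.if_eq)
  next
    case False
    have "exec \<alpha> (switch j c as) (m, w) \<sigma>"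
      using Cons False by simp
    then have "exec \<alpha> (CIf j (Letter b) (c b) (switch j c as)) (m, w) \<sigma>"
      by (rule exec.if_neq[rotated]) (use Cons.prems False in simp)
    then show ?thesis by simp
  qed
qed simp

lemma tapes_switch: "tapes (switch j c as) \<subseteq> insert j (\<Union>a\<in>set as. tapes (c a))"
  by (induction as) auto

text \<open>In round \<open>r\<close> the machine reads the \<open>r\<close>-th letter of every input, and the functions \<open>push j a\<close>
  put these letters into the state; then \<open>g\<close> does the actual work and the letters that \<open>e\<close> tells
  are emitted.\<close>

lemma prim_rec_loop_machine:
  fixes push :: "nat \<Rightarrow> 's :: finite \<Rightarrow> nat \<Rightarrow> nat" and g :: "nat \<Rightarrow> nat"
    and e :: "'s \<Rightarrow> nat \<Rightarrow> nat" and letters :: "'s list"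
  assumes push: "\<And>j a. prim_rec (push j a)" and g: "prim_rec g" and e: "\<And>a. prim_rec (e a)"
    and letters: "set letters = UNIV"
  shows "\<exists>N M. t2_wf n N M \<and> (\<forall>x y s w q.
    (\<forall>i<n. x i = Seq (y i)) \<and> s 0 = 0 \<and> w 0 = [] \<and>
    (\<forall>r. s (Suc r) = g (fold (\<lambda>j. push j (y j r)) [0..<n] (s r))) \<and>
    (\<forall>r. w (Suc r) = w r @ filter (\<lambda>a. e a (s (Suc r)) \<noteq> 0) letters) \<and>
    (\<forall>r. \<forall>i<length (w r). w r ! i = q i) \<and> (\<forall>k. \<exists>r. k \<le> length (w r)) \<longrightarrow>
    t2_yields n M x (Seq q))"
proof -
  let ?F = "insert g ((\<lambda>(j, a). push j a) ` ({..<n} \<times> UNIV) \<union> range e)"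
  have "finite ?F" by simp
  moreover have "prim_rec f" if "f \<in> ?F" for f
    using that push g e by auto
  ultimately have "\<exists>v>0. \<forall>f \<in> ?F. \<exists>c. implements v (c :: nat \<Rightarrow> 's com) f"
    by (rule prim_rec_implements_finite)
  then obtain v where v: "0 < v" "\<forall>f \<in> ?F. \<exists>c. implements v (c :: nat \<Rightarrow> 's com) f"
    by (elim exE conjE)
  then obtain C where C: "\<And>f. f \<in> ?F \<Longrightarrow> implements v (C f :: nat \<Rightarrow> 's com) f"
    using bchoice[OF v(2)] by blast
  have C_push: "implements v (C (push j a)) (push j a)" if "j < n" for j a
    by (rule C) (use that in auto)
  define N where "N = n + 2 * v + 1"
  define rd where "rd = (\<lambda>j. switch j (\<lambda>a. C (push j a) n) letters ;; CRight j)"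
  \<comment> \<open>Counter \<open>n\<close> holds the state; it is copied by way of counter \<open>n + 2 * v\<close>, as draining destroys it.\<close>
  define copy where "copy = (drain n [n + v, n + 2 * v] ;; drain (n + 2 * v) [n] :: 's com)"
  define wr where "wr = (\<lambda>a. copy ;; C (e a) (n + v) ;;
    CIf (n + v) (Aux 0) CSkip (drain (n + v) [] ;; COut a))"
  define c where "c = com_seq (map rd [0..<n]) ;; C g n ;; com_seq (map wr letters)"
  have "tapes (rd j) \<subseteq> {..<N}" if "j < n" for j
  proof -
    have "tapes (C (push j a) n) \<subseteq> {..<N}" for a
      using implements_tapes[OF C_push[OF that], of a n] by (auto simp: N_def)
    then show ?thesis
      using tapes_switch[of j "\<lambda>a. C (push j a) n" letters] that
      by (fastforce simp: rd_def N_def)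
  qed
  moreover have "tapes (C g n) \<subseteq> {..<N}"
    using implements_tapes[OF C[of g], of n] by (auto simp: N_def)
  moreover have "tapes (wr a) \<subseteq> {..<N}" for a
    using implements_tapes[OF C[of "e a"], of "n + v"] v(1)
    by (fastforce simp: wr_def copy_def N_def)
  ultimately have "tapes c \<subseteq> {..<N}"
    by (simp add: c_def UN_subset_iff)
  then have wf: "t2_wf n N (loop_prog n N c)"
    by (intro loop_prog_wf) (auto simp: N_def)
  moreover have "t2_yields n (loop_prog n N c) x (Seq q)"
    if x: "\<And>i. i < n \<Longrightarrow> x i = Seq (y i)" and s0: "s 0 = 0" and w0: "w 0 = []"
      and s: "\<And>r. s (Suc r) = g (fold (\<lambda>j. push j (y j r)) [0..<n] (s r))"
      and w: "\<And>r. w (Suc r) = w r @ filter (\<lambda>a. e a (s (Suc r)) \<noteq> 0) letters"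
      and q: "\<And>r i. i < length (w r) \<Longrightarrow> w r ! i = q i" and unb: "\<And>k. \<exists>r. k \<le> length (w r)"
    for x y s w q
  proof -
    let ?\<alpha> = "loop_tapes n N x"
    \<comment> \<open>The head positions in round \<open>r\<close> when \<open>k\<close> inputs have been read and the state is \<open>s\<close>.\<close>
    define m where "m = (\<lambda>k r s i. if i < n then if i < k then int (Suc r) else int r
      else if i = n then int s else 0)" for k r s :: nat and i :: nat
    have N_gt: "n + 2 * v < N" by (simp add: N_def)
    have mark: "?\<alpha> i = marked" if "n \<le> i" "i < N" for i
      using that by (simp add: loop_tapes_def)
    have rd: "exec ?\<alpha> (com_seq (map rd [0..<k])) (m 0 r (s r), w r)
        (m k r (fold (\<lambda>j. push j (y j r)) [0..<k] (s r)), w r)" if "k \<le> n" for k r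
      using that
    proof (induction k)
      case (Suc k)
      define z where "z = fold (\<lambda>j. push j (y j r)) [0..<k] (s r)"
      have "exec ?\<alpha> (C (push k (y k r)) n) (m k r z, w r) ((m k r z)(n := int (push k (y k r) z)), w r)"
        by (rule implements_exec[OF C_push]) (use Suc.prems N_gt in \<open>auto simp: m_def mark\<close>)
      then have "exec ?\<alpha> (switch k (\<lambda>a. C (push k a) n) letters) (m k r z, w r)
         ((m k r z)(n := int (push k (y k r) z)), w r)"
        by (intro exec_switch[where a = "y k r"])
          (use Suc.prems x letters in \<open>auto simp: loop_tapes_def m_def\<close>)
      moreover have "exec ?\<alpha> (CRight k) ((m k r z)(n := int (push k (y k r) z)), w r)
         (m (Suc k) r (push k (y k r) z), w r)"
      proof -
        let ?m = "(m k r z)(n := int (push k (y k r) z))"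
        have "?m(k := ?m k + 1) = m (Suc k) r (push k (y k r) z)"
          using Suc.prems by (auto simp: m_def fun_eq_iff)
        then show ?thesis using exec.right[of ?\<alpha> k ?m "w r"] by (simp only:)
      qed
      ultimately have "exec ?\<alpha> (rd k) (m k r z, w r) (m (Suc k) r (push k (y k r) z), w r)"
        unfolding rd_def by (rule exec.seq)
      then have "exec ?\<alpha> (com_seq [rd k]) (m k r z, w r) (m (Suc k) r (push k (y k r) z), w r)"
        by (auto intro: exec.seq exec.skip)
      then show ?case
        using Suc exec_com_seq_append[of ?\<alpha> "map rd [0..<k]"] by (auto simp: z_def)
    qed (auto intro: exec.skip)
    have wr: "exec ?\<alpha> (wr a) (m 0 r z, u) (m 0 r z, u @ (if e a z \<noteq> 0 then [a] else []))" for a r z u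
    proof -
      have "exec ?\<alpha> copy (m 0 r z, u) ((m 0 r z)(n + v := int z), u)"
        unfolding copy_def
      proof (rule exec.seq)
        show "exec ?\<alpha> (drain n [n + v, n + 2 * v]) (m 0 r z, u)
           ((m 0 r z)(n := 0, n + v := int z, n + 2 * v := int z), u)"
          by (rule exec_drain[where n = z]) (use v(1) N_gt in \<open>auto simp: mark m_def fun_eq_iff\<close>)
        show "exec ?\<alpha> (drain (n + 2 * v) [n])
           ((m 0 r z)(n := 0, n + v := int z, n + 2 * v := int z), u) ((m 0 r z)(n + v := int z), u)"
          by (rule exec_drain[where n = z]) (use v(1) N_gt in \<open>auto simp: mark m_def fun_eq_iff\<close>)
      qed
      moreover have "exec ?\<alpha> (C (e a) (n + v)) ((m 0 r z)(n + v := int z), u)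
         ((m 0 r z)(n + v := int (e a z)), u)"
        by (rule implements_exec[OF C]) (use v(1) N_gt in \<open>auto simp: mark m_def fun_eq_iff\<close>)
      moreover have "exec ?\<alpha> (CIf (n + v) (Aux 0) CSkip (drain (n + v) [] ;; COut a))
         ((m 0 r z)(n + v := int (e a z)), u) (m 0 r z, u @ (if e a z \<noteq> 0 then [a] else []))"
      proof (cases "e a z = 0")
        case True
        have "(m 0 r z)(n + v := int (e a z)) = m 0 r z"
          using True v(1) by (auto simp: m_def fun_eq_iff)
        then show ?thesis
          using True v(1) N_gt by (auto intro!: exec.if_eq exec.skip simp: mark m_def)
      next
        case False
        have "exec ?\<alpha> (drain (n + v) []) ((m 0 r z)(n + v := int (e a z)), u) (m 0 r z, u)"
          by (rule exec_drain[where n = "e a z"]) (use v(1) N_gt in \<open>auto simp: mark m_def fun_eq_iff\<close>)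
        then have "exec ?\<alpha> (drain (n + v) [] ;; COut a) ((m 0 r z)(n + v := int (e a z)), u) (m 0 r z, u @ [a])"
          by (rule exec.seq[OF _ exec.out])
        then show ?thesis
          using False v(1) N_gt by (auto intro!: exec.if_neq simp: mark)
      qed
      ultimately show ?thesis
        unfolding wr_def by (intro exec.seq)
    qed
    have wrs: "exec ?\<alpha> (com_seq (map wr as)) (m 0 r z, u) (m 0 r z, u @ filter (\<lambda>a. e a z \<noteq> 0) as)"
      for as r z u
    proof (induction as arbitrary: u)
      case (Cons a as)
      show ?case
        using exec.seq[OF wr[of a r z u] Cons.IH] by (simp split: if_splits)
    qed (auto intro: exec.skip)
    have "exec ?\<alpha> c (m 0 r (s r), w r) (m 0 (Suc r) (s (Suc r)), w (Suc r))" for r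
    proof -
      let ?z = "fold (\<lambda>j. push j (y j r)) [0..<n] (s r)"
      have m: "m n r z = m 0 (Suc r) z" for z by (auto simp: m_def)
      have "exec ?\<alpha> (C g n) (m n r ?z, w r) (m n r (g ?z), w r)"
        by (rule implements_exec[OF C]) (use N_gt in \<open>auto simp: mark m_def fun_eq_iff\<close>)
      then have "exec ?\<alpha> c (m 0 r (s r), w r) (m n r (g ?z), w r @ filter (\<lambda>a. e a (g ?z) \<noteq> 0) letters)"
        unfolding c_def
        by (intro exec.seq[OF rd[OF order_refl]] exec.seq[where \<sigma>' = "(m n r (g ?z), w r)"])
          (simp_all only: m wrs)
      then show ?thesis by (simp only: m s w)
    qed
    moreover have "m 0 0 (s 0) = (\<lambda>_. 0)"
      by (auto simp: m_def s0)
    ultimately show ?thesis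
      by (intro loop_prog_yields[where \<sigma> = "\<lambda>r. (m 0 r (s r), w r)"]) (use w0 q unb N_gt in auto)
  qed
  ultimately show ?thesis by blast
qed

section \<open>Approximation by functions on finite words\<close>

abbreviation seq_tuples :: "nat \<Rightarrow> (nat \<Rightarrow> 's str) set" where
  "seq_tuples n \<equiv> PiE {..<n} (\<lambda>_. seqs)"

definition enc_word :: "'s :: countable list \<Rightarrow> nat" where
  "enc_word w = list_encode (map to_nat w)"

lemma enc_word_eq [simp]: "enc_word u = enc_word v \<longleftrightarrow> u = v"
  by (simp add: enc_word_def list_encode_eq inj_map_eq_map)

lemma enc_word_Nil [simp]: "enc_word [] = 0"
  by (simp add: enc_word_def)

lemma enc_word_eq_0 [simp]: "enc_word w = 0 \<longleftrightarrow> w = []"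
  by (simp add: enc_word_def)

fun str_prefix :: "'s list \<Rightarrow> 's str \<Rightarrow> bool" where
  "str_prefix u (Word w) \<longleftrightarrow> prefix u w"
| "str_prefix u (Seq q) \<longleftrightarrow> (\<forall>i<length u. u ! i = q i)"

text \<open>An approximation gets a number \<open>t\<close> beside the words. It bounds the running time, and it is needed
  to let the approximation improve even if there are no inputs.\<close>

definition input_code :: "nat \<Rightarrow> 's :: countable list list \<Rightarrow> nat" where
  "input_code t ws = pair t (list_encode (map enc_word ws))"

definition approx_inputs :: "nat \<Rightarrow> (nat \<Rightarrow> 's str) \<Rightarrow> nat \<Rightarrow> (nat \<times> 's list list) set" where
  "approx_inputs n x T = {(t, ws). T \<le> t \<and> length ws = n \<and>
     (\<forall>i<n. str_prefix (ws ! i) (x i) \<and> T \<le> length (ws ! i))}"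

text \<open>The filter of larger and larger \<open>t\<close> and longer and longer prefixes of the inputs. Prefixes of different
  inputs may have different lengths, since the words in the cells of a simulated machine do.\<close>

definition approx_filter :: "nat \<Rightarrow> (nat \<Rightarrow> 's str) \<Rightarrow> (nat \<times> 's list list) filter" where
  "approx_filter n x = (INF T. principal (approx_inputs n x T))"

lemma eventually_approx_filter:
  "eventually P (approx_filter n x) \<longleftrightarrow> (\<exists>T. \<forall>p \<in> approx_inputs n x T. P p)"
proof -
  have anti: "approx_inputs n x T' \<subseteq> approx_inputs n x T" if "T \<le> T'" for T T'
    using that by (auto simp: approx_inputs_def intro: order_trans)
  have "eventually P (INF T\<in>UNIV. principal (approx_inputs n x T)) \<longleftrightarrow>
      (\<exists>T\<in>UNIV. eventually P (principal (approx_inputs n x T)))"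
  proof (rule eventually_INF_base)
    show "\<exists>T\<in>UNIV. principal (approx_inputs n x T) \<le>
        inf (principal (approx_inputs n x a)) (principal (approx_inputs n x b))" for a b
      using anti[of a "max a b"] anti[of b "max a b"] by (intro bexI[of _ "max a b"]) auto
  qed simp
  then show ?thesis by (simp add: approx_filter_def eventually_principal)
qed

text \<open>The approximation is always right, and it eventually reaches every prefix of \<open>y\<close>. No value is said
  to be final: for a finite word \<open>y\<close> the whole of \<open>y\<close> is one of its prefixes.\<close>

definition approximates :: "(nat \<Rightarrow> nat) \<Rightarrow> nat \<Rightarrow> (nat \<Rightarrow> 's :: countable str) \<Rightarrow> 's str \<Rightarrow> bool" where
  "approximates a n x y \<longleftrightarrow>
     (\<forall>(t, ws) \<in> approx_inputs n x 0. \<exists>u. a (input_code t ws) = enc_word u \<and> str_prefix u y) \<and>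
     (\<forall>v. str_prefix v y \<longrightarrow>
        (\<forall>\<^sub>F (t, ws) in approx_filter n x. \<exists>u. a (input_code t ws) = enc_word u \<and> prefix v u))"

lemma filter_eq_distinct:
  assumes "distinct xs" "x \<in> set xs"
  shows "filter (\<lambda>y. y = x) xs = [x]"
  using assms by (induction xs) (auto simp: filter_empty_conv)

lemma prim_rec_list:
  assumes "\<And>j. j \<in> set js \<Longrightarrow> prim_rec (f j)"
  shows "prim_rec (\<lambda>x. list_encode (map (\<lambda>j. f j x) js))"
  using assms
proof (induction js)
  case (Cons j js)
  then have "prim_rec (\<lambda>x. lcons (f j x) (list_encode (map (\<lambda>j. f j x) js)))"
    by (intro prim_rec_lcons) auto
  then show ?case by simp
qed (simp add: prim_rec_const)

text \<open>In each round the machine reads one more letter of every input, evaluates the approximation at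
  the prefixes read so far, and emits one new letter if one is known. As all values of the
  approximation are prefixes of the same sequence, the letters emitted earlier need not be revised.\<close>

theorem prim_rec_approximation_machine:
  fixes a :: "nat \<Rightarrow> nat"
  assumes a: "prim_rec a"
  shows "\<exists>N M. t2_wf n N M \<and> (\<forall>(x :: nat \<Rightarrow> 's :: finite str) q. x \<in> seq_tuples n \<and>
    approximates a n x (Seq q) \<longrightarrow> t2_yields n M x (Seq q))"
proof -
  obtain letters where letters: "set letters = (UNIV :: 's set)" "distinct letters"
    using finite_distinct_list[OF finite] by blast
  \<comment> \<open>Address \<open>j < n\<close> of the memory holds the part of input \<open>j\<close> read so far, \<open>n\<close> the number of the round, \<open>n + 1\<close> the length of the output, and \<open>n + 2\<close> the code of the letter to emit plus \<open>1\<close>, or \<open>0\<close>.\<close>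
  define push where "push = (\<lambda>j (b :: 's) s. mem_put s j (lsnoc (mem_get s j) (to_nat b)))"
  define L where "L = (\<lambda>s. ldrop (mem_get s (n + 1))
    (a (pair (mem_get s n) (list_encode (map (\<lambda>j. mem_get s j) [0..<n])))))"
  define g where "g = (\<lambda>s. mem_put (if L s = 0 then mem_put s (n + 2) 0
    else mem_put (mem_put s (n + 2) (Suc (lhd (L s)))) (n + 1) (Suc (mem_get s (n + 1))))
    n (Suc (mem_get s n)))"
  define e where "e = (\<lambda>(b :: 's) s. if mem_get s (n + 2) = Suc (to_nat b) then 1 else 0 :: nat)"
  have push_pr: "prim_rec (push j b)" for j b
    unfolding push_def by (intro prim_rec_mem_intros)
  have L_pr: "prim_rec L"
    unfolding L_def by (intro prim_rec_mem_intros compose[OF a] prim_rec_list)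
  then have g_pr: "prim_rec g"
    unfolding g_def by (intro prim_rec_mem_intros)
  have e_pr: "prim_rec (e b)" for b
    unfolding e_def by (intro prim_rec_mem_intros)
  obtain N M where wf: "t2_wf n N M" and M: "\<And>x y s w q.
    (\<forall>i<n. x i = Seq (y i)) \<and> s 0 = 0 \<and> w 0 = [] \<and>
    (\<forall>r. s (Suc r) = g (fold (\<lambda>j. push j (y j r)) [0..<n] (s r))) \<and>
    (\<forall>r. w (Suc r) = w r @ filter (\<lambda>b. e b (s (Suc r)) \<noteq> 0) letters) \<and>
    (\<forall>r. \<forall>i<length (w r). w r ! i = q i) \<and> (\<forall>k. \<exists>r. k \<le> length (w r)) \<Longrightarrow>
    t2_yields n M x (Seq q)"
    using prim_rec_loop_machine[where push = push and g = g and e = e and letters = letters and n = n,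
        OF push_pr g_pr e_pr letters(1)]
    by blast
  have "t2_yields n M x (Seq q)"
    if x: "x \<in> seq_tuples n" and appr: "approximates a n x (Seq q)" for x q
  proof -
    have "\<exists>p. x i = Seq p" if "i < n" for i
      using PiE_mem[OF x, of i] that by (auto simp: seqs_def)
    then obtain y where y: "\<And>i. i < n \<Longrightarrow> x i = Seq (y i)" by metis
    define s where "s = rec_nat 0 (\<lambda>r s. g (fold (\<lambda>j. push j (y j r)) [0..<n] s))"
    define w where "w = rec_nat [] (\<lambda>r u. u @ filter (\<lambda>b. e b (s (Suc r)) \<noteq> 0) letters)"
    define ws where "ws = (\<lambda>r. map (\<lambda>j. map (y j) [0..<r]) [0..<n])"
    define I where "I = (\<lambda>r. (\<forall>j<n. mem_get (s r) j = enc_word (map (y j) [0..<r])) \<and>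
      mem_get (s r) n = r \<and> mem_get (s r) (n + 1) = length (w r) \<and> str_prefix (w r) (Seq q))"
    have inputs: "(r, ws (Suc r)) \<in> approx_inputs n x r" for r
      using y by (auto simp: approx_inputs_def ws_def simp del: upt_Suc)
    define u where "u = (\<lambda>r. SOME u. a (input_code r (ws (Suc r))) = enc_word u \<and> str_prefix u (Seq q))"
    have u: "a (input_code r (ws (Suc r))) = enc_word (u r)" "str_prefix (u r) (Seq q)" for r
    proof -
      have "(r, ws (Suc r)) \<in> approx_inputs n x 0"
        using inputs[of r] by (auto simp: approx_inputs_def)
      then have "\<exists>u. a (input_code r (ws (Suc r))) = enc_word u \<and> str_prefix u (Seq q)"
        using appr unfolding approximates_def by blast
      from someI_ex[OF this] show "a (input_code r (ws (Suc r))) = enc_word (u r)"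
        "str_prefix (u r) (Seq q)" unfolding u_def by auto
    qed
    have step: "I (Suc r) \<and> w (Suc r) = w r @ (if length (w r) < length (u r) then [u r ! length (w r)] else [])"
      if I: "I r" for r
    proof -
      define z where "z = fold (\<lambda>j. push j (y j r)) [0..<n] (s r)"
      have fold: "mem_get (fold (\<lambda>j. push j (y j r)) [0..<k] (s r)) i =
        (if i < k then enc_word (map (y i) [0..<Suc r]) else mem_get (s r) i)" if "k \<le> n" for k i
        using that I by (induction k) (auto simp: push_def I_def enc_word_def less_Suc_eq)
      have z: "mem_get z i = (if i < n then enc_word (map (y i) [0..<Suc r]) else mem_get (s r) i)" for i
        using fold[of n] by (simp add: z_def)
      have s_Suc: "s (Suc r) = g z" by (simp add: s_def z_def)
      have "map (\<lambda>j. mem_get z j) [0..<n] = map enc_word (ws (Suc r))"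
        by (auto simp: z ws_def)
      then have "pair (mem_get z n) (list_encode (map (\<lambda>j. mem_get z j) [0..<n])) = input_code r (ws (Suc r))"
        using I by (simp add: z input_code_def I_def)
      then have "L z = ldrop (mem_get z (n + 1)) (enc_word (u r))"
        unfolding L_def u(1)[symmetric] by (simp only:)
      then have L: "L z = list_encode (map to_nat (drop (length (w r)) (u r)))"
        using I by (simp add: z I_def enc_word_def drop_map)
      show ?thesis
      proof (cases "length (w r) < length (u r)")
        case True
        then have Lz: "L z = list_encode (to_nat (u r ! length (w r)) # map to_nat (drop (Suc (length (w r))) (u r)))"
          unfolding L by (metis Cons_nth_drop_Suc list.simps(9))
        then have "L z \<noteq> 0" "lhd (L z) = to_nat (u r ! length (w r))" by simp_all
        then have get: "mem_get (s (Suc r)) i = (if i = n then Suc (mem_get z n) else if i = n + 1 then Suc (mem_get z i)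
            else if i = n + 2 then Suc (to_nat (u r ! length (w r))) else mem_get z i)" for i
          unfolding s_Suc g_def by auto
        have "filter (\<lambda>b. e b (s (Suc r)) \<noteq> 0) letters = filter (\<lambda>b. b = u r ! length (w r)) letters"
          by (rule filter_cong) (auto simp: e_def get)
        also have "\<dots> = [u r ! length (w r)]"
          by (rule filter_eq_distinct) (use letters in auto)
        finally have w_Suc: "w (Suc r) = w r @ [u r ! length (w r)]"
          by (simp add: w_def)
        have "str_prefix (w (Suc r)) (Seq q)"
          using I u(2)[of r] True by (auto simp: w_Suc I_def nth_append less_Suc_eq)
        then show ?thesis
          using I True w_Suc by (auto simp: I_def get z simp del: upt_Suc)
      next
        case False
        then have "L z = 0" unfolding L by simp
        then have get: "mem_get (s (Suc r)) i = (if i = n then Suc (mem_get z n)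
            else if i = n + 2 then 0 else mem_get z i)" for i
          unfolding s_Suc g_def by auto
        have w_Suc: "w (Suc r) = w r"
          by (simp add: w_def e_def get)
        then show ?thesis
          using I False by (auto simp: I_def get z simp del: upt_Suc)
      qed
    qed
    have "I 0" by (auto simp: I_def s_def w_def)
    then have I: "I r" for r using step by (induction r) auto
    have unbounded: "\<exists>r. k \<le> length (w r)" for k
    proof (induction k)
      case (Suc k)
      then obtain r0 where r0: "k \<le> length (w r0)" by blast
      let ?v = "map q [0..<Suc k]"
      have "str_prefix ?v (Seq q)" by (simp del: upt_Suc)
      then obtain T where T: "\<And>t vs. (t, vs) \<in> approx_inputs n x T \<Longrightarrow>
          \<exists>u. a (input_code t vs) = enc_word u \<and> prefix ?v u"
        using appr unfolding approximates_def eventually_approx_filter by blast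
      define r where "r = max r0 T"
      have "length (w r0) \<le> length (w (r0 + d))" for d
        using step[OF I] by (induction d) auto
      from this[of "r - r0"] have k: "k \<le> length (w r)" using r0 by (simp add: r_def)
      have "(r, ws (Suc r)) \<in> approx_inputs n x T"
        using inputs[of r] by (auto simp: approx_inputs_def r_def)
      then have "prefix ?v (u r)" using T u(1) by fastforce
      then have "Suc k \<le> length (u r)" using prefix_length_le by fastforce
      then have "Suc k \<le> length (w (Suc r))"
        using step[OF I, of r] k by auto
      then show ?case by blast
    qed simp
    show ?thesis
      by (rule M[where y = y and s = s and w = w])
        (use y unbounded I in \<open>auto simp: s_def w_def I_def\<close>)
  qed
  with wf show ?thesis by blast
qed

section \<open>Type-2 machines are approximated by primitive recursive functions\<close>

text \<open>The blank gets the code \<open>0\<close>, the content of an address that has not been written.\<close>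

fun sym_code :: "'s :: countable sym \<Rightarrow> nat" where
  "sym_code Blank = 0"
| "sym_code (Letter a) = Suc (2 * to_nat a)"
| "sym_code (Aux k) = Suc (Suc (2 * k))"

lemma sym_code_eq [simp]: "sym_code a = sym_code b \<longleftrightarrow> a = b"
  by (cases a; cases b) (auto, presburger+)

definition label_key :: nat where "label_key = pair 0 0"
definition out_key :: nat where "out_key = pair 0 1"
definition head_key :: "nat \<Rightarrow> nat" where "head_key i = pair 1 i"
definition cell_key :: "nat \<Rightarrow> nat \<Rightarrow> nat" where "cell_key i z = pair (i + 2) z"

lemma keys_eq [simp]:
  "head_key i = head_key j \<longleftrightarrow> i = j" "cell_key i z = cell_key j z' \<longleftrightarrow> i = j \<and> z = z'"
  "label_key \<noteq> out_key" "label_key \<noteq> head_key i" "label_key \<noteq> cell_key i z"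
  "out_key \<noteq> label_key" "out_key \<noteq> head_key i" "out_key \<noteq> cell_key i z"
  "head_key i \<noteq> label_key" "head_key i \<noteq> out_key" "head_key i \<noteq> cell_key j z"
  "cell_key i z \<noteq> label_key" "cell_key i z \<noteq> out_key" "cell_key i z \<noteq> head_key j"
  by (auto simp: label_key_def out_key_def head_key_def cell_key_def)

lemma prim_rec_cell_key: "prim_rec f \<Longrightarrow> prim_rec (\<lambda>x. cell_key i (f x))"
  unfolding cell_key_def by (intro prim_rec_intros)

text \<open>One step of a machine with \<open>n\<close> input tapes on the coded inputs \<open>ws\<close> and the memory \<open>s\<close>.
  Reading behind the end of a finite input word leaves the configuration unchanged: the
  letter is not known.\<close>

fun stm_num :: "nat \<Rightarrow> 's :: countable t2_stm \<Rightarrow> nat \<Rightarrow> nat \<Rightarrow> nat" where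
  "stm_num n (MoveRight i l) ws s =
     mem_put (mem_put s (head_key i) (zsucc (mem_get s (head_key i)))) label_key l"
| "stm_num n (MoveLeft i l) ws s =
     mem_put (mem_put s (head_key i) (zpred (mem_get s (head_key i)))) label_key l"
| "stm_num n (Put i a l) ws s =
     mem_put (mem_put s (cell_key i (mem_get s (head_key i))) (sym_code a)) label_key l"
| "stm_num n (Branch i a l l') ws s =
     (if i < n then
        if mem_get s (head_key i) mod 2 = 1 then mem_put s label_key (if a = Blank then l else l')
        else if ldrop (mem_get s (head_key i) div 2) (lhd (ldrop i ws)) = 0 then s
        else mem_put s label_key
          (if Suc (2 * lhd (ldrop (mem_get s (head_key i) div 2) (lhd (ldrop i ws)))) = sym_code a
           then l else l')
      else mem_put s label_key
        (if mem_get s (cell_key i (mem_get s (head_key i))) = sym_code a then l else l'))"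
| "stm_num n (Emit c l) ws s =
     mem_put (mem_put s out_key (lsnoc (mem_get s out_key) (to_nat c))) label_key l"

lemma prim_rec_stm_num:
  assumes "prim_rec ws" "prim_rec s"
  shows "prim_rec (\<lambda>x. stm_num n c (ws x) (s x))"
proof (cases c)
  case (Branch i a l l')
  then show ?thesis
    by (cases "i < n"; simp only: stm_num.simps if_True if_False)
      (intro prim_rec_mem_intros prim_rec_cell_key assms)+
qed (simp only: stm_num.simps; intro prim_rec_mem_intros prim_rec_cell_key assms)+

definition step_num :: "nat \<Rightarrow> 's :: countable t2_prog \<Rightarrow> nat \<Rightarrow> nat" where
  "step_num n M = dispatch (\<lambda>x. mem_get (psnd x) label_key) id
     (\<lambda>l x. pair (pfst x) (stm_num n (M ! l) (pfst x) (psnd x))) (\<lambda>x. x) [0..<length M]"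

lemma prim_rec_step_num: "prim_rec (step_num n M)"
  unfolding step_num_def
  by (intro prim_rec_dispatch prim_rec_mem_intros prim_rec_stm_num)

definition output_num :: "nat \<Rightarrow> 's :: countable t2_prog \<Rightarrow> nat \<Rightarrow> nat" where
  "output_num n M p = mem_get (psnd ((step_num n M ^^ pfst p) (pair (psnd p) 0))) out_key"

lemma prim_rec_output_num: "prim_rec (output_num n M)"
  unfolding output_num_def[abs_def]
  by (intro prim_rec_mem_intros prim_rec_step_num)

text \<open>The memory \<open>s\<close> represents a configuration with inputs \<open>x\<close>. The input tapes are not stored; only
  their heads are.\<close>

definition conf_code :: "nat \<Rightarrow> (nat \<Rightarrow> 's :: countable str) \<Rightarrow> nat \<Rightarrow> 's t2_conf \<Rightarrow> bool" where
  "conf_code n x s = (\<lambda>(l, \<alpha>, m, w). mem_get s label_key = l \<and> mem_get s out_key = enc_word w \<and>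
     (\<forall>i. mem_get s (head_key i) = int_encode (m i)) \<and>
     (\<forall>i z. n \<le> i \<longrightarrow> mem_get s (cell_key i (int_encode z)) = sym_code (\<alpha> i z)) \<and>
     (\<forall>i<n. \<alpha> i = str_tape (x i)))"

lemma int_encode_parity:
  "even (int_encode z) \<longleftrightarrow> 0 \<le> z" "0 \<le> z \<Longrightarrow> int_encode z div 2 = nat z"
  by (auto simp: int_encode_def sum_encode_def)

lemma int_encode_0 [simp]: "int_encode 0 = 0"
  by (simp add: int_encode_def sum_encode_def)

text \<open>A step of the machine is followed, or the letter needed for it lies behind the end of an input word.\<close>

lemma step_num_conf_code:
  assumes code: "conf_code n x s (l, \<alpha>, m, w)" and wf: "t2_wf n N M"
    and x: "x \<in> seq_tuples n"
    and ws: "length ws = n" "\<And>i. i < n \<Longrightarrow> str_prefix (ws ! i) (x i)"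
  shows "(\<exists>s'. step_num n M (pair (list_encode (map enc_word ws)) s) = pair (list_encode (map enc_word ws)) s' \<and>
      conf_code n x s' (t2_step M (l, \<alpha>, m, w))) \<or>
    (step_num n M (pair (list_encode (map enc_word ws)) s) = pair (list_encode (map enc_word ws)) s \<and>
      (\<exists>i<n. int (length (ws ! i)) \<le> m i))"
proof (cases "l < length M")
  case False
  have "step_num n M (pair (list_encode (map enc_word ws)) s) = pair (list_encode (map enc_word ws)) s"
    unfolding step_num_def using False code by (intro dispatch_default) (auto simp: conf_code_def)
  then show ?thesis using False code by (auto simp: t2_step_def)
next
  case True
  let ?ws = "list_encode (map enc_word ws)"
  have step: "step_num n M (pair ?ws s) = pair ?ws (stm_num n (M ! l) ?ws s)"
    unfolding step_num_def using True code by (subst dispatch_eq[of l]) (auto simp: conf_code_def)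
  have t2: "t2_step M (l, \<alpha>, m, w) = t2_exec (M ! l) (l, \<alpha>, m, w)"
    using True by (simp add: t2_step_def)
  have "M ! l \<in> set M" using True by simp
  then have wf_l: "t2_stm_wf n N (length M) (M ! l)" using wf by (auto simp: t2_wf_def)
  have "conf_code n x (stm_num n (M ! l) ?ws s) (t2_exec (M ! l) (l, \<alpha>, m, w)) \<or>
      stm_num n (M ! l) ?ws s = s \<and> (\<exists>i<n. int (length (ws ! i)) \<le> m i)"
  proof (cases "M ! l")
    case (Branch i a l' l'')
    show ?thesis
    proof (cases "i < n")
      case i: True
      have "x i \<in> seqs" using x i by blast
      then obtain p where p: "x i = Seq p" by (auto simp: seqs_def)
      have \<alpha>: "\<alpha> i = str_tape (Seq p)" and h: "mem_get s (head_key i) = int_encode (m i)"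
        using code i p by (auto simp: conf_code_def)
      have w_i: "lhd (list_encode (drop i (map enc_word ws))) = enc_word (ws ! i)"
        using i ws(1) by (simp add: drop_map Cons_nth_drop_Suc[symmetric])
      show ?thesis
      proof (cases "m i < 0")
        case True
        then have "int_encode (m i) mod 2 = 1" "str_tape (Seq p) (m i) = Blank"
          using int_encode_parity(1)[of "m i"] by (auto simp: odd_iff_mod_2_eq_one)
        then have "conf_code n x (stm_num n (M ! l) ?ws s) (t2_exec (M ! l) (l, \<alpha>, m, w))"
          using code i \<alpha> h by (simp del: str_tape.simps add: Branch conf_code_def eq_commute[of Blank])
        then show ?thesis ..
      next
        case False
        define k where "k = nat (m i)"
        have k: "even (int_encode (m i))" "int_encode (m i) div 2 = k"
          using False by (simp_all add: int_encode_parity k_def)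
        have r: "ldrop k (enc_word (ws ! i)) = list_encode (map to_nat (drop k (ws ! i)))"
          by (simp add: enc_word_def drop_map)
        show ?thesis
        proof (cases "length (ws ! i) \<le> k")
          case True
          then have "stm_num n (M ! l) ?ws s = s"
            using i by (simp add: Branch h k w_i r)
          moreover have "int (length (ws ! i)) \<le> m i"
            using True False by (simp add: k_def)
          ultimately show ?thesis using i by blast
        next
          case less: False
          then have "drop k (ws ! i) = ws ! i ! k # drop (Suc k) (ws ! i)"
            by (simp add: Cons_nth_drop_Suc)
          moreover have "ws ! i ! k = p k"
            using ws(2)[OF i] less p by simp
          ultimately have r': "ldrop k (enc_word (ws ! i)) =
              list_encode (to_nat (p k) # map to_nat (drop (Suc k) (ws ! i)))"
            by (simp add: r)
          have "\<alpha> i (m i) = Letter (p k)"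
            using False by (simp add: \<alpha> k_def)
          moreover have "Suc (2 * to_nat (p k)) = sym_code a \<longleftrightarrow> Letter (p k) = a"
            using sym_code_eq[of "Letter (p k)" a] by simp
          ultimately have "conf_code n x (stm_num n (M ! l) ?ws s) (t2_exec (M ! l) (l, \<alpha>, m, w))"
            using code i by (simp add: Branch h k w_i r' conf_code_def)
          then show ?thesis by blast
        qed
      qed
    next
      case False
      then have "conf_code n x (stm_num n (M ! l) ?ws s) (t2_exec (M ! l) (l, \<alpha>, m, w))"
        using code by (simp add: Branch conf_code_def)
      then show ?thesis ..
    qed
  next
    case (Put i a l')
    then have "n \<le> i" using wf_l by simp
    then have "conf_code n x (stm_num n (M ! l) ?ws s) (t2_exec (M ! l) (l, \<alpha>, m, w))"
      using code by (simp add: Put conf_code_def int_encode_eq)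
    then show ?thesis ..
  next
    case (MoveRight i l')
    have "conf_code n x (stm_num n (M ! l) ?ws s) (t2_exec (M ! l) (l, \<alpha>, m, w))"
      using code by (simp add: MoveRight conf_code_def)
    then show ?thesis ..
  next
    case (MoveLeft i l')
    have "conf_code n x (stm_num n (M ! l) ?ws s) (t2_exec (M ! l) (l, \<alpha>, m, w))"
      using code by (simp add: MoveLeft conf_code_def)
    then show ?thesis ..
  next
    case (Emit a l')
    have "conf_code n x (stm_num n (M ! l) ?ws s) (t2_exec (M ! l) (l, \<alpha>, m, w))"
      using code by (simp add: Emit conf_code_def enc_word_def)
    then show ?thesis ..
  qed
  then show ?thesis unfolding step t2 by (elim disjE) (auto intro: disjI1)
qed

lemma t2_head_le: "fst (snd (snd (t2_run n M x t))) i \<le> int t"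
proof (induction t)
  case (Suc t)
  obtain l \<alpha> m w where c: "t2_run n M x t = (l, \<alpha>, m, w)" by (cases "t2_run n M x t")
  have "t2_run n M x (Suc t) = t2_step M (l, \<alpha>, m, w)"
    using c by (simp add: t2_run_def)
  then show ?case
    using Suc.IH unfolding c by (cases "M ! l") (auto simp: t2_step_def)
qed (simp add: t2_run_def t2_initial_def)

text \<open>The simulation waits only after a head has passed a whole input word, that is, after at least as many
  steps as the word has letters. With words of length \<open>T\<close> and \<open>t \<ge> T\<close> it thus performs at least \<open>T\<close>
  steps of the machine.\<close>

lemma output_num_run:
  assumes wf: "t2_wf n N M" and x: "x \<in> seq_tuples n"
    and ws: "length ws = n" "\<And>i. i < n \<Longrightarrow> str_prefix (ws ! i) (x i)"
  shows "\<exists>t'. output_num n M (input_code t ws) = enc_word (t2_output (t2_run n M x t')) \<and>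
    (\<forall>T\<le>t. (\<forall>i<n. T \<le> length (ws ! i)) \<longrightarrow> T \<le> t')"
proof -
  let ?ws = "list_encode (map enc_word ws)"
  have "\<exists>t' s. t' \<le> t \<and> (step_num n M ^^ t) (pair ?ws 0) = pair ?ws s \<and> conf_code n x s (t2_run n M x t') \<and>
    (\<forall>T\<le>t. (\<forall>i<n. T \<le> length (ws ! i)) \<longrightarrow> T \<le> t')"
  proof (induction t)
    case 0
    have "conf_code n x 0 (t2_run n M x 0)"
      by (auto simp: conf_code_def t2_run_def t2_initial_def)
    then show ?case by simp
  next
    case (Suc t)
    then obtain t' s where t': "t' \<le> t" and s: "(step_num n M ^^ t) (pair ?ws 0) = pair ?ws s"
      and code: "conf_code n x s (t2_run n M x t')"
      and long: "\<forall>T\<le>t. (\<forall>i<n. T \<le> length (ws ! i)) \<longrightarrow> T \<le> t'" by blast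
    obtain l \<alpha> m w where c: "t2_run n M x t' = (l, \<alpha>, m, w)" by (cases "t2_run n M x t'")
    have next_run: "t2_run n M x (Suc t') = t2_step M (l, \<alpha>, m, w)"
      using c by (simp add: t2_run_def)
    have "(\<exists>s'. step_num n M (pair ?ws s) = pair ?ws s' \<and> conf_code n x s' (t2_step M (l, \<alpha>, m, w))) \<or>
        (step_num n M (pair ?ws s) = pair ?ws s \<and> (\<exists>i<n. int (length (ws ! i)) \<le> m i))"
      by (rule step_num_conf_code[OF code[unfolded c] wf x ws])
    then show ?case
    proof (elim disjE exE conjE)
      fix s' assume "step_num n M (pair ?ws s) = pair ?ws s'" "conf_code n x s' (t2_step M (l, \<alpha>, m, w))"
      moreover have "T \<le> Suc t'" if "T \<le> Suc t" "\<forall>i<n. T \<le> length (ws ! i)" for T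
      proof (cases T)
        case (Suc T')
        then have "\<forall>i<n. T' \<le> length (ws ! i)" using that(2) Suc_leD by blast
        then show ?thesis using long Suc that(1) by auto
      qed simp
      ultimately show ?thesis
        using s t' next_run by (intro exI[of _ "Suc t'"] exI[of _ s']) auto
    next
      fix i assume "step_num n M (pair ?ws s) = pair ?ws s" and i: "i < n" "int (length (ws ! i)) \<le> m i"
      have "m i \<le> int t'" using t2_head_le[of n M x t' i] by (simp add: c)
      then have "length (ws ! i) \<le> t'" using i(2) by simp
      then have "T \<le> t'" if "\<forall>i<n. T \<le> length (ws ! i)" for T
        using that i(1) le_trans by blast
      then show ?thesis
        using s t' code i(1) \<open>step_num n M (pair ?ws s) = pair ?ws s\<close>
        by (intro exI[of _ t'] exI[of _ s]) auto
    qed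
  qed
  then obtain t' s where s: "(step_num n M ^^ t) (pair ?ws 0) = pair ?ws s"
    "conf_code n x s (t2_run n M x t')" "\<forall>T\<le>t. (\<forall>i<n. T \<le> length (ws ! i)) \<longrightarrow> T \<le> t'" by blast
  have "output_num n M (input_code t ws) = enc_word (t2_output (t2_run n M x t'))"
    using s(1,2) by (cases "t2_run n M x t'") (simp add: output_num_def input_code_def conf_code_def)
  then show ?thesis using s(3) by blast
qed

lemma t2_yields_output:
  assumes "t2_yields n M x y"
  shows "str_prefix (t2_output (t2_run n M x t)) y"
    and "str_prefix v y \<Longrightarrow> \<exists>T. \<forall>t\<ge>T. prefix v (t2_output (t2_run n M x t))"
proof -
  have mono: "prefix (t2_output (t2_run n M x t)) (t2_output (t2_run n M x t'))" if "t \<le> t'" for t t'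
    using t2_output_mono[of n M x t "t' - t"] that by (auto simp: prefix_def)
  have "str_prefix (t2_output (t2_run n M x t)) y \<and>
    (str_prefix v y \<longrightarrow> (\<exists>T. \<forall>t\<ge>T. prefix v (t2_output (t2_run n M x t))))"
  proof (cases y)
    case (Word w)
    then obtain T where T: "t2_label (t2_run n M x T) = length M" "t2_output (t2_run n M x T) = w"
      using assms by auto
    have stay: "t2_output (t2_run n M x t) = w" if "T \<le> t" for t
      using t2_halted_stays[OF T(1), of "t - T"] T(2) that by simp
    have "prefix (t2_output (t2_run n M x t)) w"
      using mono[of t "max t T"] stay[of "max t T"] by simp
    then show ?thesis using stay by (auto simp: Word)
  next
    case (Seq q)
    have out: "\<forall>i<length (t2_output (t2_run n M x t)). t2_output (t2_run n M x t) ! i = q i" for t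
      using assms unfolding Seq t2_yields.simps by blast
    obtain T where T: "length v \<le> length (t2_output (t2_run n M x T))"
      using assms unfolding Seq t2_yields.simps by blast
    have "prefix v (t2_output (t2_run n M x t))" if "T \<le> t" "str_prefix v y" for t
    proof -
      have "length v \<le> length (t2_output (t2_run n M x t))"
        using T prefix_length_le[OF mono[OF that(1)]] by simp
      then have "v = take (length v) (t2_output (t2_run n M x t))"
        using out[of t] that(2) by (intro nth_equalityI) (auto simp: Seq)
      then show ?thesis using take_is_prefix by metis
    qed
    then show ?thesis using out by (auto simp: Seq)
  qed
  then show "str_prefix (t2_output (t2_run n M x t)) y"
    "str_prefix v y \<Longrightarrow> \<exists>T. \<forall>t\<ge>T. prefix v (t2_output (t2_run n M x t))" by blast+
qed

theorem machine_prim_rec_approximation: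
  fixes M :: "'s :: countable t2_prog"
  assumes wf: "t2_wf n N M"
  shows "\<exists>a. prim_rec a \<and> (\<forall>x y. x \<in> seq_tuples n \<and> t2_yields n M x y \<longrightarrow> approximates a n x y)"
proof (intro exI conjI allI impI)
  show "prim_rec (output_num n M)" by (rule prim_rec_output_num)
  fix x y assume "x \<in> seq_tuples n \<and> t2_yields n M x y"
  then have x: "x \<in> seq_tuples n" and y: "t2_yields n M x y" by auto
  have run: "\<exists>t'\<ge>T. output_num n M (input_code t ws) = enc_word (t2_output (t2_run n M x t'))"
    if "(t, ws) \<in> approx_inputs n x T" for t ws T
    using output_num_run[OF wf x, of ws t] that by (auto simp: approx_inputs_def)
  show "approximates (output_num n M) n x y"
    unfolding approximates_def eventually_approx_filter
  proof (intro conjI allI impI ballI; (elim exE)?)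
    fix p assume p: "p \<in> approx_inputs n x 0"
    obtain t ws where tw: "p = (t, ws)" by fastforce
    obtain t' where t': "output_num n M (input_code t ws) = enc_word (t2_output (t2_run n M x t'))"
      using run[OF p[unfolded tw]] by (elim exE conjE)
    show "case p of (t, ws) \<Rightarrow> \<exists>u. output_num n M (input_code t ws) = enc_word u \<and> str_prefix u y"
      unfolding tw prod.case using t2_yields_output(1)[OF y] t' by (intro exI conjI)
  next
    fix v assume v: "str_prefix v y"
    obtain T where T: "\<And>t. T \<le> t \<Longrightarrow> prefix v (t2_output (t2_run n M x t))"
      using t2_yields_output(2)[OF y v] by blast
    have "\<exists>u. output_num n M (input_code t ws) = enc_word u \<and> prefix v u"
      if tws: "(t, ws) \<in> approx_inputs n x T" for t ws
    proof -
      obtain t' where "T \<le> t'" "output_num n M (input_code t ws) = enc_word (t2_output (t2_run n M x t'))"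
        using run[OF tws] by (elim exE conjE)
      then show ?thesis using T by (intro exI conjI)
    qed
    then show "\<exists>T. \<forall>p\<in>approx_inputs n x T. case p of (t, ws) \<Rightarrow>
        \<exists>u. output_num n M (input_code t ws) = enc_word u \<and> prefix v u"
      by (intro exI[of _ T]) (simp add: case_prod_unfold)
  qed
qed

section \<open>Continuity is approximability\<close>

lemma input_code_inj:
  fixes ws ws' :: "'s :: countable list list"
  shows "input_code t ws = input_code t' ws' \<longleftrightarrow> t = t' \<and> ws = ws'"
proof -
  have "inj (enc_word :: 's list \<Rightarrow> nat)" by (rule injI) simp
  from inj_map_eq_map[OF this] show ?thesis by (simp add: input_code_def list_encode_eq)
qed

lemma topspace_str_topology [simp]: "topspace (str_topology :: 's str topology) = UNIV"
proof -
  have "y \<in> \<Union> (range (\<lambda>w. {Word w}) \<union> range cylinder)" for y :: "'s str"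
    by (cases y) (auto simp: cylinder_def intro!: exI[of _ "[]"])
  then have "\<Union> (range (\<lambda>w. {Word w}) \<union> range cylinder) = (UNIV :: 's str set)" by blast
  then show ?thesis by (simp only: str_topology_def topology_generated_by_topspace)
qed

lemma open_contains_cylinder:
  assumes "openin (subtopology str_topology seqs) S" "Seq p \<in> S"
  shows "\<exists>T. \<forall>p'. (\<forall>i<T. p' i = p i) \<longrightarrow> Seq p' \<in> S"
proof -
  have "generate_topology_on (range cylinder) S"
    using assms(1) by (simp add: str_topology_seqs openin_topology_generated_by_iff)
  then show ?thesis
    using assms(2)
  proof induction
    case (Int A B)
    from Int.prems have "Seq p \<in> A" "Seq p \<in> B" by auto
    from Int.IH(1)[OF this(1)] Int.IH(2)[OF this(2)]
    obtain T T' where "\<forall>p'. (\<forall>i<T. p' i = p i) \<longrightarrow> Seq p' \<in> A"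
      "\<forall>p'. (\<forall>i<T'. p' i = p i) \<longrightarrow> Seq p' \<in> B" by (elim exE)
    then show ?case by (intro exI[of _ "max T T'"]) simp
  next
    case (UN K)
    then obtain A where A: "A \<in> K" "Seq p \<in> A" by blast
    from UN.IH[OF this] obtain T where "\<forall>p'. (\<forall>i<T. p' i = p i) \<longrightarrow> Seq p' \<in> A" by (elim exE)
    then show ?case using A(1) by (intro exI[of _ T]) blast
  next
    case (Basis A)
    then obtain u where A: "A = cylinder u" by blast
    with Basis show ?case
      by (intro exI[of _ "length u"]) (auto simp: cylinder_def)
  qed auto
qed

lemma open_str_prefix:
  assumes "U0 = words \<or> U0 = seqs"
  shows "openin (subtopology str_topology U0) {y \<in> U0. str_prefix v y}"
proof (cases "U0 = words")
  case True
  then show ?thesis by (auto simp: str_topology_words)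
next
  case False
  then have "U0 = seqs" using assms by simp
  moreover have "{y \<in> seqs. str_prefix v y} = cylinder v"
    by (auto simp: seqs_def cylinder_def)
  ultimately show ?thesis
    by (simp add: str_topology_seqs topology_generated_by_Basis)
qed

text \<open>The values with prefix \<open>v\<close> form an open set, and an open neighbourhood of \<open>x\<close> in the product contains
  all arguments that agree with \<open>x\<close> in sufficiently long prefixes.\<close>

lemma continuous_pfun_determined:
  assumes cont: "continuous_pfun n (\<lambda>_. seqs) U0 f" and U0: "U0 = words \<or> U0 = seqs"
    and f: "f x = Some y" "str_prefix v y"
  shows "\<exists>T. \<forall>x' y'. f x' = Some y' \<longrightarrow> (\<forall>i<n. \<exists>u. T \<le> length u \<and> str_prefix u (x i) \<and> str_prefix u (x' i)) \<longrightarrow>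
    str_prefix v y'"
proof -
  let ?X = "\<lambda>i :: nat. subtopology str_topology seqs :: 'a str topology"
  have dom: "dom f \<subseteq> seq_tuples n" and ran: "ran f \<subseteq> U0"
    and map: "continuous_map (subtopology (product_topology ?X {..<n}) (dom f))
       (subtopology str_topology U0) (\<lambda>x. the (f x))"
    using cont by (auto simp: continuous_pfun_def partial_fun_def)
  let ?O = "{y \<in> U0. str_prefix v y}"
  have top: "topspace (subtopology (product_topology ?X {..<n}) (dom f)) = dom f"
    using dom by auto
  have "openin (subtopology (product_topology ?X {..<n}) (dom f)) {x \<in> dom f. the (f x) \<in> ?O}"
    using openin_continuous_map_preimage[OF map open_str_prefix[OF U0]] unfolding top .
  then obtain S where S: "openin (product_topology ?X {..<n}) S" "{x \<in> dom f. the (f x) \<in> ?O} = S \<inter> dom f"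
    by (auto simp: openin_subtopology)
  have "x \<in> {x \<in> dom f. the (f x) \<in> ?O}" using f ran by (auto simp: ran_def)
  then have "x \<in> S" using S(2) by blast
  then obtain U where U: "\<forall>i\<in>{..<n}. openin (?X i) (U i)" "x \<in> PiE {..<n} U" "PiE {..<n} U \<subseteq> S"
    using S(1) unfolding openin_product_topology_alt by blast
  have "\<exists>T. \<forall>p'. (\<exists>u. T \<le> length u \<and> str_prefix u (x i) \<and> str_prefix u (Seq p')) \<longrightarrow> Seq p' \<in> U i" if "i < n" for i
  proof -
    have "x i \<in> U i" "openin (?X i) (U i)" using U(1,2) that by auto
    moreover have "x i \<in> seqs" using f dom that by auto
    then obtain p where "x i = Seq p" by (auto simp: seqs_def)
    ultimately show ?thesis
      using open_contains_cylinder[of "U i" p] by (metis (no_types, lifting) order.strict_trans2 str_prefix.simps(2))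
  qed
  then obtain T where T: "\<And>i p' u. i < n \<Longrightarrow> T i \<le> length u \<Longrightarrow> str_prefix u (x i) \<Longrightarrow>
      str_prefix u (Seq p') \<Longrightarrow> Seq p' \<in> U i"
    by metis
  show ?thesis
  proof (intro exI[of _ "Max (insert 0 (T ` {..<n}))"] allI impI)
    fix x' y'
    assume f': "f x' = Some y'"
      and agree: "\<forall>i<n. \<exists>u. Max (insert 0 (T ` {..<n})) \<le> length u \<and> str_prefix u (x i) \<and> str_prefix u (x' i)"
    have x': "x' \<in> seq_tuples n" using dom f' by blast
    have "x' i \<in> U i" if i: "i < n" for i
    proof -
      obtain p' where p': "x' i = Seq p'" using PiE_mem[OF x', of i] i by (auto simp: seqs_def)
      obtain u where u: "Max (insert 0 (T ` {..<n})) \<le> length u" "str_prefix u (x i)" "str_prefix u (x' i)"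
        using agree i by blast
      have "T i \<le> Max (insert 0 (T ` {..<n}))" using i by (intro Max_ge) auto
      then show ?thesis using T[of i u p'] u i p' by auto
    qed
    then have "x' \<in> PiE {..<n} U" using x' by (auto simp: PiE_iff)
    then have "x' \<in> {x \<in> dom f. the (f x) \<in> ?O}" using U(3) S(2) f' by blast
    then show "str_prefix v y'" using f' by simp
  qed
qed

lemma str_prefix_linear:
  assumes "str_prefix u y" "str_prefix v y" "length u \<le> length v"
  shows "prefix u v"
proof (cases y)
  case (Word w)
  then show ?thesis using assms prefix_length_prefix by auto
next
  case (Seq q)
  then have "u = take (length u) v"
    using assms by (intro nth_equalityI) auto
  then show ?thesis using take_is_prefix by metis
qed

lemma str_prefix_trans: "prefix u v \<Longrightarrow> str_prefix v y \<Longrightarrow> str_prefix u y"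
  by (cases y) (auto simp: prefix_def, metis nth_append trans_less_add1)

text \<open>A continuous function is approximated by what its values at all arguments compatible with the given
  prefixes have in common. If there is no such argument, every word is a common prefix; the bound
  \<open>t\<close> on the length makes the maximum exist in this case too.\<close>

definition common_prefix :: "((nat \<Rightarrow> 's str) \<rightharpoonup> 's str) \<Rightarrow> nat \<Rightarrow> 's list list \<Rightarrow> 's list \<Rightarrow> bool" where
  "common_prefix f t ws v \<longleftrightarrow> length v \<le> t \<and>
     (\<forall>x y. f x = Some y \<and> (\<forall>i<length ws. str_prefix (ws ! i) (x i)) \<longrightarrow> str_prefix v y)"

definition longest_common_prefix :: "((nat \<Rightarrow> 's str) \<rightharpoonup> 's str) \<Rightarrow> nat \<Rightarrow> 's list list \<Rightarrow> 's list" where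
  "longest_common_prefix f t ws = (ARG_MAX length v. common_prefix f t ws v)"

lemma longest_common_prefix:
  shows "common_prefix f t ws (longest_common_prefix f t ws)"
    and "common_prefix f t ws v \<Longrightarrow> length v \<le> length (longest_common_prefix f t ws)"
proof -
  have "common_prefix f t ws []"
    unfolding common_prefix_def by (metis list.size(3) str_prefix.simps le0 Nil_prefix str.exhaust not_less0)
  moreover have "\<forall>v. common_prefix f t ws v \<longrightarrow> length v < Suc t"
    by (auto simp: common_prefix_def)
  ultimately show "common_prefix f t ws (longest_common_prefix f t ws)"
    "common_prefix f t ws v \<Longrightarrow> length v \<le> length (longest_common_prefix f t ws)"
    unfolding longest_common_prefix_def
    using arg_max_nat_lemma[of "common_prefix f t ws" "[]" length "Suc t"] by auto
qed

theorem continuous_approximation: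
  fixes f :: "(nat \<Rightarrow> 's :: countable str) \<rightharpoonup> 's str"
  assumes cont: "continuous_pfun n (\<lambda>_. seqs) U0 f" and U0: "U0 = words \<or> U0 = seqs"
  shows "\<exists>a. \<forall>x y. f x = Some y \<longrightarrow> approximates a n x y"
proof -
  define a where "a = (\<lambda>p. let (t, ws) = inv (\<lambda>(t, ws :: 's list list). input_code t ws) p
    in enc_word (longest_common_prefix f t ws))"
  have "inj (\<lambda>(t, ws :: 's list list). input_code t ws)"
    by (auto intro!: injI simp: input_code_inj)
  from inv_f_f[OF this] have a: "a (input_code t ws) = enc_word (longest_common_prefix f t ws)" for t ws
    by (metis (mono_tags, lifting) a_def case_prod_conv)
  have "approximates a n x y" if f: "f x = Some y" for x y
    unfolding approximates_def eventually_approx_filter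
  proof (intro conjI allI impI ballI)
    fix p assume "p \<in> approx_inputs n x 0"
    then obtain t ws where p: "p = (t, ws)" "length ws = n" "\<forall>i<n. str_prefix (ws ! i) (x i)"
      by (auto simp: approx_inputs_def)
    have "str_prefix (longest_common_prefix f t ws) y"
      using longest_common_prefix(1)[of f t ws] f p(2,3) by (auto simp: common_prefix_def)
    then show "case p of (t, ws) \<Rightarrow> \<exists>u. a (input_code t ws) = enc_word u \<and> str_prefix u y"
      by (auto simp: p(1) a)
  next
    fix v assume v: "str_prefix v y"
    obtain T where T: "\<And>x' y'. f x' = Some y' \<Longrightarrow>
        (\<forall>i<n. \<exists>u. T \<le> length u \<and> str_prefix u (x i) \<and> str_prefix u (x' i)) \<Longrightarrow> str_prefix v y'"
      using continuous_pfun_determined[OF cont U0 f v] by blast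
    have "prefix v (longest_common_prefix f t ws)"
      if "(t, ws) \<in> approx_inputs n x (max T (length v))" for t ws
    proof -
      have t: "length v \<le> t" and ws: "length ws = n"
        "\<And>i. i < n \<Longrightarrow> str_prefix (ws ! i) (x i) \<and> T \<le> length (ws ! i)"
        using that by (auto simp: approx_inputs_def)
      have "common_prefix f t ws v"
        unfolding common_prefix_def using t ws T by blast
      then have "length v \<le> length (longest_common_prefix f t ws)"
        by (rule longest_common_prefix(2))
      moreover have "str_prefix (longest_common_prefix f t ws) y"
        using longest_common_prefix(1)[of f t ws] f ws by (auto simp: common_prefix_def)
      ultimately show ?thesis using v str_prefix_linear by blast
    qed
    then show "\<exists>T. \<forall>p\<in>approx_inputs n x T. case p of (t, ws) \<Rightarrow>
        \<exists>u. a (input_code t ws) = enc_word u \<and> prefix v u"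
      by (intro exI[of _ "max T (length v)"]) (auto simp: a)
  qed
  then show ?thesis by blast
qed

lemma approx_inputs_nonempty:
  assumes "x \<in> seq_tuples n"
  shows "\<exists>ws. (T, ws) \<in> approx_inputs n x T"
proof -
  have "\<exists>u. str_prefix u (x i) \<and> length u = T" if "i < n" for i
  proof -
    have "x i \<in> seqs" using assms that by auto
    then obtain p where "x i = Seq p" by (auto simp: seqs_def)
    then show ?thesis by (intro exI[of _ "map p [0..<T]"]) auto
  qed
  then obtain u where "\<And>i. i < n \<Longrightarrow> str_prefix (u i) (x i) \<and> length (u i) = T" by metis
  then have "(T, map u [0..<n]) \<in> approx_inputs n x T"
    by (auto simp: approx_inputs_def)
  then show ?thesis ..
qed

lemma approx_inputs_antimono: "T \<le> T' \<Longrightarrow> approx_inputs n x T' \<subseteq> approx_inputs n x T"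
  by (auto simp: approx_inputs_def intro: order_trans)

lemma approximates_unique:
  assumes x: "x \<in> seq_tuples n"
    and "approximates a n x (Seq q)" "approximates a n x (Seq q')"
  shows "q = q'"
proof
  fix i
  let ?v = "map q [0..<Suc i]"
  have "str_prefix ?v (Seq q)" by (simp del: upt_Suc)
  then obtain T where T: "\<And>t ws. (t, ws) \<in> approx_inputs n x T \<Longrightarrow> \<exists>u. a (input_code t ws) = enc_word u \<and> prefix ?v u"
    using assms(2) unfolding approximates_def eventually_approx_filter by blast
  obtain ws where ws: "(T, ws) \<in> approx_inputs n x T"
    using approx_inputs_nonempty[OF x] by blast
  then obtain u where u: "a (input_code T ws) = enc_word u" "prefix ?v u" using T by blast
  obtain u' where u': "a (input_code T ws) = enc_word u'" "str_prefix u' (Seq q')"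
    using ws approx_inputs_antimono[of 0 T n x] assms(3) unfolding approximates_def by blast
  have "u = u'" using u(1) u'(1) by simp
  then have "str_prefix ?v (Seq q')" using u(2) u'(2) str_prefix_trans by blast
  then show "q i = q' i"
    by (auto simp del: upt_Suc dest!: spec[of _ i])
qed

text \<open>The arguments at which \<open>a\<close> approximates some sequence form the domain of a function. One value of \<open>a\<close>
  on finite prefixes of the arguments guarantees a prefix of the value, on the whole open set of
  arguments with these prefixes.\<close>

theorem approximation_continuous:
  fixes a :: "nat \<Rightarrow> nat"
  shows "\<exists>f. continuous_pfun n (\<lambda>_. seqs) seqs f \<and>
    (\<forall>(x :: nat \<Rightarrow> 's :: countable str) q. x \<in> seq_tuples n \<and> approximates a n x (Seq q) \<longrightarrow> f x = Some (Seq q))"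
proof -
  let ?X = "\<lambda>i :: nat. subtopology str_topology seqs :: 's str topology"
  define f where "f = (\<lambda>x :: nat \<Rightarrow> 's str. if x \<in> seq_tuples n \<and> (\<exists>q. approximates a n x (Seq q))
    then Some (Seq (THE q. approximates a n x (Seq q))) else None)"
  have f: "f x = Some (Seq q)" if "x \<in> seq_tuples n" "approximates a n x (Seq q)" for x q
    using that approximates_unique[OF that(1)] unfolding f_def by (auto intro!: the_equality)
  have f_dom: "\<exists>q. y = Seq q \<and> x \<in> seq_tuples n \<and> approximates a n x (Seq q)" if f_x: "f x = Some y" for x y
  proof -
    obtain q where q: "x \<in> seq_tuples n" "approximates a n x (Seq q)"
      using f_x unfolding f_def by (auto split: if_splits)
    then show ?thesis using f[OF q] f_x by auto
  qed
  have dom: "dom f \<subseteq> seq_tuples n" using f_dom by blast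
  have "y \<in> seqs" if "f x = Some y" for x y
    using f_dom[OF that] by (auto simp: seqs_def)
  then have ran: "ran f \<subseteq> seqs" by (auto simp: ran_def)
  let ?D = "subtopology (product_topology ?X {..<n}) (dom f)"
  have top: "topspace ?D = dom f"
    using dom by auto
  have "continuous_map ?D (topology_generated_by (range cylinder)) (\<lambda>x. the (f x))"
  proof (rule continuous_on_generated_topo)
    fix U :: "'s str set" assume "U \<in> range cylinder"
    then obtain v where U: "U = cylinder v" by blast
    have "\<exists>N. openin ?D N \<and> x \<in> N \<and> N \<subseteq> (\<lambda>x. the (f x)) -` U \<inter> topspace ?D"
      if x: "x \<in> (\<lambda>x. the (f x)) -` U \<inter> topspace ?D" for x
    proof -
      have x_dom: "x \<in> dom f" using x top by auto
      then obtain y where y: "f x = Some y" by blast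
      then obtain q where q: "y = Seq q" "x \<in> seq_tuples n" "approximates a n x (Seq q)"
        using f_dom by blast
      have "Seq q \<in> cylinder v" using x y q(1) U by simp
      then have "str_prefix v (Seq q)" by (auto simp: cylinder_def)
      then obtain T where T: "\<And>t ws. (t, ws) \<in> approx_inputs n x T \<Longrightarrow> \<exists>u. a (input_code t ws) = enc_word u \<and> prefix v u"
        using q(3) unfolding approximates_def eventually_approx_filter by blast
      obtain ws where ws: "(T, ws) \<in> approx_inputs n x T"
        using approx_inputs_nonempty[OF q(2)] by blast
      then obtain u where u: "a (input_code T ws) = enc_word u" "prefix v u" using T by blast
      let ?N = "PiE {..<n} (\<lambda>i. cylinder (ws ! i))"
      have "openin (product_topology ?X {..<n}) ?N"
        by (simp add: openin_PiE str_topology_seqs topology_generated_by_Basis)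
      then have "openin ?D (?N \<inter> dom f)" by (rule openin_subtopology_Int)
      moreover have cyl: "z i \<in> cylinder (ws ! i) \<longleftrightarrow> str_prefix (ws ! i) (z i)" if "z i \<in> seqs" for z i
        using that by (auto simp: seqs_def cylinder_def)
      have "x \<in> ?N"
        using q(2) ws cyl by (auto simp: approx_inputs_def PiE_iff)
      moreover have "?N \<inter> dom f \<subseteq> (\<lambda>x. the (f x)) -` U \<inter> topspace ?D"
      proof
        fix z assume z: "z \<in> ?N \<inter> dom f"
        then obtain y' q' where z': "f z = Some (Seq q')" "z \<in> seq_tuples n" "approximates a n z (Seq q')"
          using f_dom by blast
        have "(T, ws) \<in> approx_inputs n z 0"
          using z z'(2) ws cyl[of z] by (auto simp: approx_inputs_def PiE_iff)
        then obtain u' where u': "a (input_code T ws) = enc_word u'" "str_prefix u' (Seq q')"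
          using z'(3) unfolding approximates_def by blast
        have "u = u'" using u(1) u'(1) by simp
        then have "str_prefix v (Seq q')" using u(2) u'(2) str_prefix_trans by blast
        then have "the (f z) \<in> U" by (simp add: U z'(1) cylinder_def)
        then show "z \<in> (\<lambda>x. the (f x)) -` U \<inter> topspace ?D"
          using z top by auto
      qed
      ultimately show ?thesis using x_dom by blast
    qed
    then show "openin ?D ((\<lambda>x. the (f x)) -` U \<inter> topspace ?D)"
      using openin_subopen by blast
  next
    show "(\<lambda>x. the (f x)) ` topspace ?D \<subseteq> \<Union> (range cylinder)"
      unfolding top using f_dom by (fastforce simp: cylinder_def intro!: exI[of _ "[]"])
  qed
  then have "continuous_pfun n (\<lambda>_. seqs) seqs f"
    unfolding continuous_pfun_def partial_fun_def str_topology_seqs using dom ran by blast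
  with f show ?thesis by blast
qed

section \<open>The run of a generalized Turing machine on names\<close>

text \<open>In a configuration on names, a cell holds an auxiliary symbol or a name of its content.\<close>

type_synonym ('l, 'u, 's) name_conf = "'l \<times> (nat \<Rightarrow> int \<Rightarrow> 'u + 's str) \<times> (nat \<Rightarrow> int)"

definition name_args :: "(nat \<Rightarrow> int \<Rightarrow> 'u + 's str) \<Rightarrow> (nat \<Rightarrow> int) \<Rightarrow> nat list \<Rightarrow> nat \<Rightarrow> 's str" where
  "name_args \<beta> m is = (\<lambda>j \<in> {..<length is}. projr (\<beta> (is ! j) (m (is ! j))))"

fun name_exec :: "((nat \<Rightarrow> 's str) \<rightharpoonup> 's str) \<Rightarrow> ('l, 'u, 's :: zero_neq_one) gtm_stm \<Rightarrow>
    ('l, 'u, 's) name_conf \<Rightarrow> ('l, 'u, 's) name_conf" where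
  "name_exec F (GoRight i l') (l, \<beta>, m) = (l', \<beta>, m(i := m i + 1))"
| "name_exec F (GoLeft i l') (l, \<beta>, m) = (l', \<beta>, m(i := m i - 1))"
| "name_exec F (Write i b l') (l, \<beta>, m) = (l', \<beta>(i := (\<beta> i)(m i := Inl b)), m)"
| "name_exec F (IfSym i b l' l'') (l, \<beta>, m) = ((if \<beta> i (m i) = Inl b then l' else l''), \<beta>, m)"
| "name_exec F (Assign i f is l') (l, \<beta>, m) =
     (l', \<beta>(i := (\<beta> i)(m i := Inr (the (F (name_args \<beta> m is))))), m)"
| "name_exec F (Test f is l' l'') (l, \<beta>, m) =
     ((if the (F (name_args \<beta> m is)) = Word [0] then l' else l''), \<beta>, m)"

fun stm_args :: "('l, 'u, 's) gtm_stm \<Rightarrow> nat list" where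
  "stm_args (Assign i f is l') = is"
| "stm_args (Test f is l' l'') = is"
| "stm_args _ = []"

text \<open>The pair of a realization \<open>F\<close> of the function in the statement with label \<open>l\<close>, as it is used in a
  run on names, and an approximation \<open>a\<close> of \<open>F\<close>, as it is used in the simulation with finite words.\<close>

definition approximate_realization :: "('l, 'u, 's :: {finite, zero_neq_one}) gtm \<Rightarrow> (nat \<Rightarrow> 's str \<Rightarrow> 'u set) \<Rightarrow>
    'l \<Rightarrow> ((nat \<Rightarrow> 's str) \<rightharpoonup> 's str) \<Rightarrow> (nat \<Rightarrow> nat) \<Rightarrow> bool" where
  "approximate_realization P \<delta> l F a \<longleftrightarrow>
     (\<forall>i f is l'. stm P l = Assign i f is l' \<longrightarrow>
        realization (length is) (\<lambda>_. seqs) (\<lambda>j. \<delta> (is ! j)) (\<delta> i) (mfun_of F) f) \<and>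
     (\<forall>f is l' l''. stm P l = Test f is l' l'' \<longrightarrow>
        realization (length is) (\<lambda>_. seqs) (\<lambda>j. \<delta> (is ! j)) id_words (mfun_of F) (mfun_of f)) \<and>
     (\<forall>x y. F x = Some y \<longrightarrow> approximates a (length (stm_args (stm P l))) x y)"

locale approximated_gtm =
  fixes P :: "('l, 'u, 's :: {finite, zero_neq_one}) gtm" and \<delta> :: "nat \<Rightarrow> 's str \<Rightarrow> 'u set"
    and F :: "'l \<Rightarrow> (nat \<Rightarrow> 's str) \<rightharpoonup> 's str" and a :: "'l \<Rightarrow> nat \<Rightarrow> nat"
  assumes gtm: "is_gtm P"
    and rep: "\<And>i. i \<le> last_tape P \<Longrightarrow> multi_representation (tape_set P i) (\<delta> i)"
    and realizes: "\<And>l. l \<in> labels P - {final_label P} \<Longrightarrow> approximate_realization P \<delta> l (F l) (a l)"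
begin

definition name_step :: "('l, 'u, 's) name_conf \<Rightarrow> ('l, 'u, 's) name_conf" where
  "name_step \<nu> = (if fst \<nu> = final_label P then \<nu> else name_exec (F (fst \<nu>)) (stm P (fst \<nu>)) \<nu>)"

definition name_initial :: "(nat \<Rightarrow> 's str) \<Rightarrow> ('l, 'u, 's) name_conf" where
  "name_initial x = (init_label P,
     (\<lambda>i z. if 1 \<le> i \<and> i \<le> num_inputs P \<and> z = 0 then Inr (x (i - 1)) else Inl (blank P)), (\<lambda>_. 0))"

definition names_cell :: "nat \<Rightarrow> 'u + 's str \<Rightarrow> 'u \<Rightarrow> bool" where
  "names_cell i c u \<longleftrightarrow> (case c of Inl b \<Rightarrow> b \<in> aux_syms P \<and> u = b | Inr y \<Rightarrow> u \<in> \<delta> i y)"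

lemma names_cell_simps [simp]:
  "names_cell i (Inl b) u \<longleftrightarrow> b \<in> aux_syms P \<and> u = b" "names_cell i (Inr y) u \<longleftrightarrow> u \<in> \<delta> i y"
  by (simp_all add: names_cell_def)

definition names :: "('l, 'u, 's) name_conf \<Rightarrow> ('l, 'u) gtm_conf \<Rightarrow> bool" where
  "names = (\<lambda>(l, \<beta>, m) (l', \<alpha>, m'). l' = l \<and> m' = m \<and>
     (\<forall>i \<le> last_tape P. \<forall>z. names_cell i (\<beta> i z) (\<alpha> i z)))"

lemma names_update:
  assumes "\<And>j z. j \<le> last_tape P \<Longrightarrow> names_cell j (\<beta> j z) (\<alpha> j z)" "names_cell i c u"
  shows "names (l, \<beta>(i := (\<beta> i)(p := c)), m) (l, \<alpha>(i := (\<alpha> i)(p := u)), m)"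
  using assms by (auto simp: names_def)

text \<open>In a regular configuration the arguments of the statement are names, the realization is
  defined there, and a test has one of the values \<open>0\<close> and \<open>1\<close>.\<close>

definition regular :: "('l, 'u, 's) name_conf \<Rightarrow> bool" where
  "regular = (\<lambda>(l, \<beta>, m). l \<in> labels P - {final_label P} \<and>
     (\<forall>i \<in> set (stm_args (stm P l)). i \<le> last_tape P \<and> (\<exists>y \<in> seqs. \<beta> i (m i) = Inr y)) \<and>
     (\<forall>i f is l'. stm P l = Assign i f is l' \<longrightarrow> F l (name_args \<beta> m is) \<noteq> None) \<and>
     (\<forall>f is l' l''. stm P l = Test f is l' l'' \<longrightarrow>
        F l (name_args \<beta> m is) \<in> {Some (Word [0]), Some (Word [1])}))"

lemma wf: "l \<in> labels P - {final_label P} \<Longrightarrow> gtm_stm_wf P (stm P l)"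
  and finite_labels: "finite (labels P)" and init_label: "init_label P \<in> labels P"
  and final_label: "final_label P \<in> labels P" and finite_aux: "finite (aux_syms P)"
  and blank: "blank P \<in> aux_syms P" and num_inputs: "num_inputs P \<le> last_tape P"
  and disjoint: "i \<le> last_tape P \<Longrightarrow> tape_set P i \<inter> aux_syms P = {}"
  using gtm by (auto simp: is_gtm_def)

lemma rep_in: "i \<le> last_tape P \<Longrightarrow> u \<in> \<delta> i y \<Longrightarrow> u \<in> tape_set P i \<and> y \<in> seqs"
  using rep[of i] unfolding multi_representation_def multifun_def by blast

text \<open>The sets of the tapes contain no auxiliary symbols, so a cell whose content belongs to its set is
  represented by a name.\<close>

lemma names_args:
  assumes names: "names (l, \<beta>, m) (l, \<alpha>, m)" and args: "args \<alpha> m is \<in> arg_set P is"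
    and "is": "set is \<subseteq> {..last_tape P}"
  shows "\<forall>i \<in> set is. \<exists>y \<in> seqs. \<beta> i (m i) = Inr y"
    and "name_args \<beta> m is \<in> seq_tuples (length is)"
    and "args \<alpha> m is \<in> PiE {..<length is} (\<lambda>j. \<delta> (is ! j) (name_args \<beta> m is j))"
proof -
  have cell: "\<exists>y \<in> seqs. \<beta> (is ! j) (m (is ! j)) = Inr y \<and> \<alpha> (is ! j) (m (is ! j)) \<in> \<delta> (is ! j) y"
    if j: "j < length is" for j
  proof -
    have i: "is ! j \<le> last_tape P" using "is" j nth_mem by blast
    have in_set: "\<alpha> (is ! j) (m (is ! j)) \<in> tape_set P (is ! j)"
      using PiE_mem[OF args[unfolded arg_set_def], of j] j by (simp add: args_def)
    have *: "names_cell (is ! j) (\<beta> (is ! j) (m (is ! j))) (\<alpha> (is ! j) (m (is ! j)))"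
      using names i by (simp add: names_def)
    show ?thesis
    proof (cases "\<beta> (is ! j) (m (is ! j))")
      case (Inl b)
      then show ?thesis using * in_set disjoint[OF i] by auto
    next
      case (Inr y)
      then show ?thesis using * rep_in[OF i] by auto
    qed
  qed
  show "\<forall>i \<in> set is. \<exists>y \<in> seqs. \<beta> i (m i) = Inr y"
    using cell by (metis in_set_conv_nth)
  show "name_args \<beta> m is \<in> seq_tuples (length is)"
    unfolding name_args_def restrict_PiE_iff using cell by fastforce
  show "args \<alpha> m is \<in> PiE {..<length is} (\<lambda>j. \<delta> (is ! j) (name_args \<beta> m is j))"
  proof (rule PiE_I)
    fix j assume "j \<in> {..<length is}"
    then show "args \<alpha> m is j \<in> \<delta> (is ! j) (name_args \<beta> m is j)"
      using cell[of j] by (auto simp: name_args_def args_def)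
  qed (simp add: args_def)
qed

text \<open>The realization picks one of the successors: its value names some element of the value of the
  multi-function, and the computation of the machine may be continued with that element.\<close>

lemma step_names:
  assumes names: "names \<nu> \<kappa>" and label: "fst \<nu> \<in> labels P - {final_label P}"
    and step: "gtm_step P \<kappa> \<kappa>0"
  shows "regular \<nu> \<and> fst (name_step \<nu>) \<in> labels P \<and> (\<exists>\<kappa>'. gtm_step P \<kappa> \<kappa>' \<and> names (name_step \<nu>) \<kappa>')"
proof -
  obtain l \<beta> m where \<nu>: "\<nu> = (l, \<beta>, m)" by (cases \<nu>)
  then obtain \<alpha> where \<kappa>: "\<kappa> = (l, \<alpha>, m)" using names by (cases \<kappa>) (auto simp: names_def)
  have l: "l \<in> labels P - {final_label P}" using label \<nu> by simp
  then have not_final: "l \<noteq> final_label P" by simp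
  have cell: "names_cell i (\<beta> i z) (\<alpha> i z)"
    if "i \<le> last_tape P" for i z
    using names that by (simp add: names_def \<nu> \<kappa>)
  note wf_l = wf[OF l]
  show ?thesis
  proof (cases "stm P l")
    case (GoRight i l')
    have "gtm_step P \<kappa> (l', \<alpha>, m(i := m i + 1))"
      unfolding \<kappa> by (rule gtm_step.right[OF not_final GoRight])
    moreover have "names (name_step \<nu>) (l', \<alpha>, m(i := m i + 1))"
      using cell not_final by (simp add: \<nu> name_step_def GoRight names_def)
    ultimately show ?thesis
      using l wf_l by (auto simp: \<nu> regular_def GoRight name_step_def)
  next
    case (GoLeft i l')
    have "gtm_step P \<kappa> (l', \<alpha>, m(i := m i - 1))"
      unfolding \<kappa> by (rule gtm_step.left[OF not_final GoLeft])
    moreover have "names (name_step \<nu>) (l', \<alpha>, m(i := m i - 1))"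
      using cell not_final by (simp add: \<nu> name_step_def GoLeft names_def)
    ultimately show ?thesis
      using l wf_l by (auto simp: \<nu> regular_def GoLeft name_step_def)
  next
    case (Write i b l')
    have "gtm_step P \<kappa> (l', \<alpha>(i := (\<alpha> i)(m i := b)), m)"
      unfolding \<kappa> by (rule gtm_step.write_sym[OF not_final Write])
    moreover have "names (name_step \<nu>) (l', \<alpha>(i := (\<alpha> i)(m i := b)), m)"
      using not_final wf_l by (auto simp: \<nu> name_step_def Write intro!: names_update cell)
    ultimately show ?thesis
      using l wf_l by (auto simp: \<nu> regular_def Write name_step_def)
  next
    case (IfSym i b l' l'')
    have i: "i \<le> last_tape P" and b: "b \<in> aux_syms P" using wf_l by (auto simp: IfSym)
    have eq: "\<alpha> i (m i) = b \<longleftrightarrow> \<beta> i (m i) = Inl b"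
      using cell[OF i, of "m i"] rep_in[OF i] disjoint[OF i] b by (cases "\<beta> i (m i)") auto
    have "gtm_step P \<kappa> ((if \<beta> i (m i) = Inl b then l' else l''), \<alpha>, m)"
      unfolding \<kappa> using gtm_step.if_eq[OF not_final IfSym] gtm_step.if_neq[OF not_final IfSym] eq by simp
    moreover have "names (name_step \<nu>) ((if \<beta> i (m i) = Inl b then l' else l''), \<alpha>, m)"
      using cell not_final by (simp add: \<nu> name_step_def IfSym names_def)
    moreover have "regular \<nu>" "fst (name_step \<nu>) \<in> labels P"
      using l wf_l by (auto simp: \<nu> regular_def IfSym name_step_def)
    ultimately show ?thesis by blast
  next
    case (Assign i f "is" l')
    have i: "i \<le> last_tape P" and "is": "set is \<subseteq> {..last_tape P}" and l': "l' \<in> labels P"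
      and f: "multifun (arg_set P is) (tape_set P i) f" using wf_l by (auto simp: Assign)
    have dom: "f (args \<alpha> m is) \<noteq> {}"
      using step unfolding \<kappa> by (cases rule: gtm_step.cases) (auto simp: Assign)
    then have args: "args \<alpha> m is \<in> arg_set P is" using f by (auto simp: multifun_def)
    note na = names_args[OF names[unfolded \<nu> \<kappa>] args "is"]
    have "realization (length is) (\<lambda>_. seqs) (\<lambda>j. \<delta> (is ! j)) (\<delta> i) (mfun_of (F l)) f"
      using realizes[OF l] Assign by (auto simp: approximate_realization_def)
    then have realized: "mfun_of (F l) (name_args \<beta> m is) \<noteq> {} \<and>
        (\<forall>y \<in> mfun_of (F l) (name_args \<beta> m is). f (args \<alpha> m is) \<inter> \<delta> i y \<noteq> {})"
      using na(2,3) dom unfolding realization_def mdom_def by blast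
    then obtain y where y: "F l (name_args \<beta> m is) = Some y"
      by (auto simp: mfun_of_def)
    then have "f (args \<alpha> m is) \<inter> \<delta> i y \<noteq> {}" using realized by (simp add: mfun_of_def)
    then obtain u where u: "u \<in> f (args \<alpha> m is)" "u \<in> \<delta> i y" by blast
    have "gtm_step P \<kappa> (l', \<alpha>(i := (\<alpha> i)(m i := u)), m)"
      unfolding \<kappa> by (rule gtm_step.assign[where x = u, OF not_final Assign u(1)])
    moreover have "names (name_step \<nu>) (l', \<alpha>(i := (\<alpha> i)(m i := u)), m)"
      using not_final u(2) by (auto simp: \<nu> name_step_def Assign y intro!: names_update cell)
    moreover have "regular \<nu>"
      using l na(1) "is" y by (auto simp: \<nu> regular_def Assign)
    moreover have "fst (name_step \<nu>) \<in> labels P"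
      using l' not_final by (auto simp: \<nu> Assign name_step_def)
    ultimately show ?thesis by blast
  next
    case (Test f "is" l' l'')
    have "is": "set is \<subseteq> {..last_tape P}" and l': "l' \<in> labels P" "l'' \<in> labels P"
      and f: "partial_fun (arg_set P is) words f" "ran f \<subseteq> {Word [0], Word [1]}" using wf_l by (auto simp: Test)
    obtain w where w: "f (args \<alpha> m is) = Some w" "w = Word [0] \<or> w = Word [1]"
      using step unfolding \<kappa> by (cases rule: gtm_step.cases) (auto simp: Test)
    then have args: "args \<alpha> m is \<in> arg_set P is" using f(1) by (auto simp: partial_fun_def)
    note na = names_args[OF names[unfolded \<nu> \<kappa>] args "is"]
    have "realization (length is) (\<lambda>_. seqs) (\<lambda>j. \<delta> (is ! j)) id_words (mfun_of (F l)) (mfun_of f)"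
      using realizes[OF l] Test by (auto simp: approximate_realization_def)
    moreover have "args \<alpha> m is \<in> mdom (mfun_of f)" using w by (simp add: mdom_def mfun_of_def)
    ultimately have "mfun_of (F l) (name_args \<beta> m is) \<noteq> {} \<and>
        (\<forall>y \<in> mfun_of (F l) (name_args \<beta> m is). mfun_of f (args \<alpha> m is) \<inter> id_words y \<noteq> {})"
      using na(2,3) unfolding realization_def by blast
    then have y: "F l (name_args \<beta> m is) = Some w"
      using w(1) by (auto simp: mfun_of_def id_words_def split: if_splits)
    have "gtm_step P \<kappa> ((if w = Word [0] then l' else l''), \<alpha>, m)"
      unfolding \<kappa> using gtm_step.test_0[OF not_final Test] gtm_step.test_1[OF not_final Test] w by auto
    moreover have "names (name_step \<nu>) ((if w = Word [0] then l' else l''), \<alpha>, m)"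
      using cell not_final by (simp add: \<nu> name_step_def Test names_def y)
    moreover have "regular \<nu>"
      using l na(1) "is" y w(2) by (auto simp: \<nu> regular_def Test)
    moreover have "fst (name_step \<nu>) \<in> labels P"
      using l' not_final by (auto simp: \<nu> Test name_step_def)
    ultimately show ?thesis by blast
  qed
qed

lemma names_initial:
  assumes "z \<in> PiE {..<num_inputs P} (\<lambda>j. \<delta> (Suc j) (x j))"
  shows "names (name_initial x) (gtm_initial P z)"
proof -
  have "z (i - 1) \<in> \<delta> i (x (i - 1))" if "1 \<le> i" "i \<le> num_inputs P" for i
    using PiE_mem[OF assms, of "i - 1"] that by simp
  then show ?thesis using blank by (auto simp: names_def name_initial_def gtm_initial_def)
qed

text \<open>As long as the label is not final, the computation that is followed has a next step, since otherwise
  it would be maximal without being accepting. It cannot be infinite either, so it ends at the final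
  label, and it accepts.\<close>

theorem name_run:
  assumes z: "z \<in> PiE {..<num_inputs P} (\<lambda>j. \<delta> (Suc j) (x j))" and dom: "gtm_fun P z \<noteq> {}"
  shows "\<exists>n q. (\<forall>j<n. regular ((name_step ^^ j) (name_initial x))) \<and>
    fst ((name_step ^^ n) (name_initial x)) = final_label P \<and>
    fst (snd ((name_step ^^ n) (name_initial x))) 0 0 = Inr (Seq q) \<and> gtm_fun P z \<inter> \<delta> 0 (Seq q) \<noteq> {}"
proof -
  let ?\<nu> = "\<lambda>j. (name_step ^^ j) (name_initial x)"
  have inputs: "z \<in> gtm_inputs P" and all: "all_maximal_accepting P (gtm_initial P z)"
    using dom by (auto simp: gtm_fun_def)
  have max_acc: "accepting_computation P \<kappa>s"
    if "fin_computation P \<kappa>s" "hd \<kappa>s = gtm_initial P z" "\<nexists>\<kappa>'. gtm_step P (last \<kappa>s) \<kappa>'" for \<kappa>s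
    using all that unfolding all_maximal_accepting_def by blast
  \<comment> \<open>The computation that the run on names follows.\<close>
  define \<kappa> where "\<kappa> = rec_nat (gtm_initial P z) (\<lambda>j c. SOME c'. gtm_step P c c' \<and> names (?\<nu> (Suc j)) c')"
  have run: "names (?\<nu> j) (\<kappa> j) \<and> fst (?\<nu> j) \<in> labels P \<and>
      (\<forall>i<j. regular (?\<nu> i) \<and> gtm_step P (\<kappa> i) (\<kappa> (Suc i)))"
    if "\<forall>i<j. fst (?\<nu> i) \<noteq> final_label P" for j
    using that
  proof (induction j)
    case 0
    show ?case
      using names_initial[OF z] init_label by (simp add: \<kappa>_def name_initial_def)
  next
    case (Suc j)
    then have IH: "names (?\<nu> j) (\<kappa> j)" "fst (?\<nu> j) \<in> labels P - {final_label P}"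
      "\<forall>i<j. regular (?\<nu> i) \<and> gtm_step P (\<kappa> i) (\<kappa> (Suc i))" by auto
    let ?\<kappa>s = "map \<kappa> [0..<Suc j]"
    have "fst (\<kappa> j) = fst (?\<nu> j)" using IH(1) by (auto simp: names_def split: prod.splits)
    then have "\<not> accepting_computation P ?\<kappa>s"
      using IH(2) by (auto simp: accepting_computation_def gtm_accepting_def)
    moreover have "fin_computation P ?\<kappa>s"
      unfolding fin_computation_def successively_conv_nth
      using IH(3) by (auto simp del: upt_Suc)
    moreover have "hd ?\<kappa>s = gtm_initial P z"
      by (simp add: hd_map \<kappa>_def del: upt_Suc)
    ultimately obtain \<kappa>0 where "gtm_step P (\<kappa> j) \<kappa>0"
      using max_acc[of ?\<kappa>s] by auto
    from step_names[OF IH(1,2) this]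
    have new: "regular (?\<nu> j)" "fst (?\<nu> (Suc j)) \<in> labels P" "\<exists>c'. gtm_step P (\<kappa> j) c' \<and> names (?\<nu> (Suc j)) c'"
      by auto
    have "\<kappa> (Suc j) = (SOME c'. gtm_step P (\<kappa> j) c' \<and> names (?\<nu> (Suc j)) c')"
      by (simp add: \<kappa>_def)
    then have "gtm_step P (\<kappa> j) (\<kappa> (Suc j)) \<and> names (?\<nu> (Suc j)) (\<kappa> (Suc j))"
      using someI_ex[OF new(3)] by simp
    then show ?case using IH(3) new(1,2) less_Suc_eq by auto
  qed
  have "\<exists>n. fst (?\<nu> n) = final_label P"
  proof (rule ccontr)
    assume "\<nexists>n. fst (?\<nu> n) = final_label P"
    then have "gtm_step P (\<kappa> j) (\<kappa> (Suc j))" for j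
      using run[of "Suc j"] by blast
    then have "inf_computation P \<kappa>" by (simp add: inf_computation_def)
    moreover have "\<kappa> 0 = gtm_initial P z" by (simp add: \<kappa>_def)
    ultimately show False using all unfolding all_maximal_accepting_def by blast
  qed
  then obtain n where n: "fst (?\<nu> n) = final_label P" "\<And>i. i < n \<Longrightarrow> fst (?\<nu> i) \<noteq> final_label P"
    using exists_least_iff[of "\<lambda>n. fst (?\<nu> n) = final_label P"] by blast
  have run_n: "names (?\<nu> n) (\<kappa> n)" "\<And>i. i < n \<Longrightarrow> regular (?\<nu> i) \<and> gtm_step P (\<kappa> i) (\<kappa> (Suc i))"
    using run[of n] n(2) by auto
  obtain \<beta> m where \<nu>: "?\<nu> n = (final_label P, \<beta>, m)" using n(1) by (cases "?\<nu> n") auto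
  then obtain \<alpha> where \<kappa>_n: "\<kappa> n = (final_label P, \<alpha>, m)"
    using run_n(1) by (cases "\<kappa> n") (auto simp: names_def)
  let ?\<kappa>s = "map \<kappa> [0..<Suc n]"
  have "fin_computation P ?\<kappa>s"
    unfolding fin_computation_def successively_conv_nth
    using run_n(2) by (auto simp del: upt_Suc)
  moreover have hd: "hd ?\<kappa>s = gtm_initial P z"
    by (simp add: hd_map \<kappa>_def del: upt_Suc)
  moreover have "\<nexists>\<kappa>'. gtm_step P (last ?\<kappa>s) \<kappa>'"
    by (auto simp: \<kappa>_n elim: gtm_step.cases)
  ultimately have acc: "accepting_computation P ?\<kappa>s" by (rule max_acc)
  then have in_Z0: "\<alpha> 0 0 \<in> tape_set P 0"
    by (simp add: accepting_computation_def gtm_accepting_def \<kappa>_n)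
  have result: "\<alpha> 0 0 \<in> gtm_fun P z"
    using inputs all acc hd by (auto simp: gtm_fun_def \<kappa>_n intro!: exI[of _ ?\<kappa>s])
  have "names_cell 0 (\<beta> 0 0) (\<alpha> 0 0)"
    using run_n(1) by (simp add: names_def \<nu> \<kappa>_n)
  then obtain y where y: "\<beta> 0 0 = Inr y" "\<alpha> 0 0 \<in> \<delta> 0 y"
    using in_Z0 disjoint[of 0] by (cases "\<beta> 0 0") auto
  moreover have "y \<in> seqs" using rep_in[OF _ y(2)] by simp
  ultimately obtain q where "\<beta> 0 0 = Inr (Seq q)" "\<alpha> 0 0 \<in> \<delta> 0 (Seq q)"
    by (auto simp: seqs_def)
  then show ?thesis
    using run_n(2) \<nu> result by (intro exI[of _ n] exI[of _ q]) auto
qed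

end

section \<open>The simulation with finite words\<close>

definition arg_words :: "nat \<Rightarrow> nat list \<Rightarrow> nat" where
  "arg_words s is = list_encode (map (\<lambda>i. mem_get s (cell_key i (mem_get s (head_key i))) div 2) is)"

context approximated_gtm
begin

definition label_code :: "'l \<Rightarrow> nat" where
  "label_code = to_nat_on (labels P)"

definition aux_code :: "'u \<Rightarrow> nat" where
  "aux_code b = (if b = blank P then 0 else Suc (to_nat_on (aux_syms P) b))"

definition inner_labels :: "'l list" where
  "inner_labels = (SOME ls. set ls = labels P - {final_label P})"

text \<open>Cells with auxiliary symbols have even codes, and cells with finite words odd ones. The blank has
  the code \<open>0\<close>, the content of an address that has not been written. The value of a test is one of the words
  \<open>0\<close> and \<open>1\<close>, so a nonempty prefix is the whole word, and the empty prefix, with code \<open>0\<close>, means that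
  the simulation has to wait. A test that waits is never resumed with better data: the simulation is
  started anew for larger \<open>t\<close> and longer inputs.\<close>

fun sim_stm :: "(nat \<Rightarrow> nat) \<Rightarrow> ('l, 'u, 's) gtm_stm \<Rightarrow> nat \<Rightarrow> nat \<Rightarrow> nat" where
  "sim_stm c (GoRight i l') t s =
     mem_put (mem_put s (head_key i) (zsucc (mem_get s (head_key i)))) label_key (label_code l')"
| "sim_stm c (GoLeft i l') t s =
     mem_put (mem_put s (head_key i) (zpred (mem_get s (head_key i)))) label_key (label_code l')"
| "sim_stm c (Write i b l') t s =
     mem_put (mem_put s (cell_key i (mem_get s (head_key i))) (2 * aux_code b)) label_key (label_code l')"
| "sim_stm c (IfSym i b l' l'') t s =
     mem_put s label_key (if mem_get s (cell_key i (mem_get s (head_key i))) = 2 * aux_code b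
       then label_code l' else label_code l'')"
| "sim_stm c (Assign i f is l') t s =
     mem_put (mem_put s (cell_key i (mem_get s (head_key i))) (Suc (2 * c (pair t (arg_words s is)))))
       label_key (label_code l')"
| "sim_stm c (Test f is l' l'') t s =
     (if c (pair t (arg_words s is)) = 0 then s
      else mem_put s label_key (if c (pair t (arg_words s is)) = enc_word [0 :: 's]
        then label_code l' else label_code l''))"

definition sim_mem :: "nat \<Rightarrow> nat" where
  "sim_mem = dispatch (\<lambda>x. mem_get (psnd x) label_key) label_code
     (\<lambda>l x. sim_stm (a l) (stm P l) (pfst x) (psnd x)) (\<lambda>x. psnd x) inner_labels"

primrec sim_inputs :: "nat \<Rightarrow> nat \<Rightarrow> nat" where
  "sim_inputs 0 ws = mem_put 0 label_key (label_code (init_label P))"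
| "sim_inputs (Suc j) ws =
     mem_put (sim_inputs j ws) (cell_key (Suc j) 0) (Suc (2 * lhd (ldrop j ws)))"

definition simulation :: "nat \<Rightarrow> nat" where
  "simulation p = (let s = psnd (((\<lambda>x. pair (pfst x) (sim_mem x)) ^^ pfst p)
      (pair (pfst p) (sim_inputs (num_inputs P) (psnd p))))
    in if mem_get s label_key = label_code (final_label P) then mem_get s (cell_key 0 0) div 2 else 0)"

lemma set_inner_labels: "set inner_labels = labels P - {final_label P}"
  unfolding inner_labels_def
  by (rule someI_ex, rule finite_list) (simp add: finite_labels)

lemma label_code_eq: "l \<in> labels P \<Longrightarrow> l' \<in> labels P \<Longrightarrow> label_code l = label_code l' \<longleftrightarrow> l = l'"
  using finite_labels by (simp add: label_code_def countable_finite)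

lemma aux_code_eq: "b \<in> aux_syms P \<Longrightarrow> b' \<in> aux_syms P \<Longrightarrow> aux_code b = aux_code b' \<longleftrightarrow> b = b'"
  using finite_aux by (auto simp: aux_code_def countable_finite)

lemma prim_rec_arg_words: "prim_rec s \<Longrightarrow> prim_rec (\<lambda>x. arg_words (s x) is)"
  unfolding arg_words_def
  by (intro prim_rec_list prim_rec_mem_intros prim_rec_cell_key)

lemma prim_rec_sim_stm:
  assumes "prim_rec c" "prim_rec t" "prim_rec s"
  shows "prim_rec (\<lambda>x. sim_stm c stmt (t x) (s x))"
  by (cases stmt; simp only: sim_stm.simps;
      intro prim_rec_mem_intros prim_rec_cell_key compose[OF assms(1)] prim_rec_arg_words assms)

lemma prim_rec_sim_inputs: "prim_rec f \<Longrightarrow> prim_rec (\<lambda>x. sim_inputs j (f x))"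
proof (induction j)
  case 0
  show ?case unfolding sim_inputs.simps by (rule prim_rec_const)
next
  case (Suc j)
  then show ?case unfolding sim_inputs.simps by (intro prim_rec_mem_intros)
qed

lemma prim_rec_simulation:
  assumes "\<And>l. l \<in> labels P - {final_label P} \<Longrightarrow> prim_rec (a l)"
  shows "prim_rec simulation"
proof -
  have sim: "prim_rec sim_mem"
    unfolding sim_mem_def
    by (intro prim_rec_dispatch prim_rec_mem_intros prim_rec_sim_stm assms) (simp_all add: set_inner_labels)
  show ?thesis
    unfolding simulation_def[abs_def] Let_def
    by (intro prim_rec_mem_intros prim_rec_sim_inputs sim)
qed

definition approx_cell :: "nat \<Rightarrow> 'u + 's str \<Rightarrow> bool" where
  "approx_cell n c = (case c of Inl b \<Rightarrow> b \<in> aux_syms P \<and> n = 2 * aux_code b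
     | Inr y \<Rightarrow> \<exists>u. n = Suc (2 * enc_word u) \<and> str_prefix u y)"

lemma approx_cell_simps [simp]:
  "approx_cell n (Inl b) \<longleftrightarrow> b \<in> aux_syms P \<and> n = 2 * aux_code b"
  "approx_cell n (Inr y) \<longleftrightarrow> (\<exists>u. n = Suc (2 * enc_word u) \<and> str_prefix u y)"
  by (simp_all add: approx_cell_def)

text \<open>The memory \<open>s\<close> represents a configuration on names with each name replaced by some prefix.\<close>

definition approx_conf :: "nat \<Rightarrow> ('l, 'u, 's) name_conf \<Rightarrow> bool" where
  "approx_conf s = (\<lambda>(l, \<beta>, m). mem_get s label_key = label_code l \<and>
     (\<forall>i \<le> last_tape P. mem_get s (head_key i) = int_encode (m i) \<and>
        (\<forall>z. approx_cell (mem_get s (cell_key i (int_encode z))) (\<beta> i z))))"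

lemma sim_mem_eq:
  assumes "mem_get s label_key = label_code l" "l \<in> labels P - {final_label P}"
  shows "sim_mem (pair t s) = sim_stm (a l) (stm P l) t s"
  unfolding sim_mem_def
  by (subst dispatch_eq[where k = l]) (use assms in \<open>auto simp: set_inner_labels inj_on_def label_code_eq\<close>)

lemma sim_mem_final:
  assumes "mem_get s label_key = label_code (final_label P)"
  shows "sim_mem (pair t s) = s"
  unfolding sim_mem_def
  by (subst dispatch_default) (use assms final_label in \<open>auto simp: set_inner_labels label_code_eq\<close>)

lemma approx_args:
  assumes "regular (l, \<beta>, m)" "approx_conf s (l, \<beta>, m)" and is_def: "is = stm_args (stm P l)"
  shows "\<exists>us. arg_words s is = list_encode (map enc_word us) \<and> length us = length is \<and>
    (\<forall>j<length is. mem_get s (cell_key (is ! j) (int_encode (m (is ! j)))) = Suc (2 * enc_word (us ! j)) \<and>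
       str_prefix (us ! j) (name_args \<beta> m is j))"
proof -
  have "\<exists>u. mem_get s (cell_key (is ! j) (int_encode (m (is ! j)))) = Suc (2 * enc_word u) \<and>
       str_prefix u (name_args \<beta> m is j)" if j: "j < length is" for j
  proof -
    have "is ! j \<in> set is" using j by simp
    then have i: "is ! j \<le> last_tape P" "\<exists>y. \<beta> (is ! j) (m (is ! j)) = Inr y"
      using assms(1) is_def by (auto simp: regular_def)
    then have "approx_cell (mem_get s (cell_key (is ! j) (int_encode (m (is ! j))))) (\<beta> (is ! j) (m (is ! j)))"
      using assms(2) by (simp add: approx_conf_def)
    then show ?thesis using i(2) j by (auto simp: name_args_def)
  qed
  then obtain u where u: "\<And>j. j < length is \<Longrightarrow>
      mem_get s (cell_key (is ! j) (int_encode (m (is ! j)))) = Suc (2 * enc_word (u j)) \<and>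
      str_prefix (u j) (name_args \<beta> m is j)" by metis
  have "mem_get s (cell_key (is ! j) (mem_get s (head_key (is ! j)))) div 2 = enc_word (u j)"
    if j: "j < length is" for j
  proof -
    have "is ! j \<in> set is" using j by simp
    then have "is ! j \<le> last_tape P" using assms(1) is_def by (auto simp: regular_def)
    then have "mem_get s (head_key (is ! j)) = int_encode (m (is ! j))"
      using assms(2) by (simp add: approx_conf_def)
    then show ?thesis using u[OF j] by simp
  qed
  then have "arg_words s is = list_encode (map enc_word (map u [0..<length is]))"
    unfolding arg_words_def by (intro arg_cong[where f = list_encode] nth_equalityI) auto
  then show ?thesis using u by (intro exI[of _ "map u [0..<length is]"]) auto
qed

lemma approximates_F:
  assumes "regular (l, \<beta>, m)" "F l (name_args \<beta> m (stm_args (stm P l))) = Some y"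
  shows "approximates (a l) (length (stm_args (stm P l))) (name_args \<beta> m (stm_args (stm P l))) y"
  using realizes[of l] assms by (auto simp: regular_def approximate_realization_def)

lemma approx_value:
  assumes "regular (l, \<beta>, m)" "approx_conf s (l, \<beta>, m)"
    and "F l (name_args \<beta> m (stm_args (stm P l))) = Some y"
  shows "\<exists>u. a l (pair t (arg_words s (stm_args (stm P l)))) = enc_word u \<and> str_prefix u y"
proof -
  let ?is = "stm_args (stm P l)"
  obtain us where us: "arg_words s ?is = list_encode (map enc_word us)" "length us = length ?is"
    "\<forall>j<length ?is. str_prefix (us ! j) (name_args \<beta> m ?is j)"
    using approx_args[OF assms(1,2) refl] by blast
  then have "(t, us) \<in> approx_inputs (length ?is) (name_args \<beta> m ?is) 0"
    by (simp add: approx_inputs_def)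
  then have "\<exists>u. a l (input_code t us) = enc_word u \<and> str_prefix u y"
    using approximates_F[OF assms(1,3)] unfolding approximates_def by blast
  then show ?thesis by (simp add: input_code_def us(1))
qed

lemma approx_update:
  assumes "approx_conf s (l, \<beta>, m)" "approx_cell n c"
  shows "approx_conf (mem_put (mem_put s (cell_key i (int_encode z)) n) label_key (label_code l'))
    (l', \<beta>(i := (\<beta> i)(z := c)), m)"
  using assms by (auto simp: approx_conf_def int_encode_eq)

lemma approx_goto:
  assumes "approx_conf s (l, \<beta>, m)"
  shows "approx_conf (mem_put s label_key (label_code l')) (l', \<beta>, m)"
  using assms by (auto simp: approx_conf_def)

lemma approx_move:
  assumes "approx_conf s (l, \<beta>, m)" "n = int_encode z"
  shows "approx_conf (mem_put (mem_put s (head_key i) n) label_key (label_code l')) (l', \<beta>, m(i := z))"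
  using assms by (auto simp: approx_conf_def)

lemma sim_mem_step:
  assumes reg: "regular (l, \<beta>, m)" and approx: "approx_conf s (l, \<beta>, m)"
    and known: "\<And>f is l' l''. stm P l = Test f is l' l'' \<Longrightarrow> a l (pair t (arg_words s is)) \<noteq> 0"
  shows "approx_conf (sim_mem (pair t s)) (name_step (l, \<beta>, m))"
proof -
  have l: "l \<in> labels P - {final_label P}" using reg by (simp add: regular_def)
  then have not_final: "l \<noteq> final_label P" by simp
  have sim: "sim_mem (pair t s) = sim_stm (a l) (stm P l) t s"
    using approx l by (intro sim_mem_eq) (auto simp: approx_conf_def)
  have head: "mem_get s (head_key i) = int_encode (m i)" if "i \<le> last_tape P" for i
    using approx that by (simp add: approx_conf_def)
  note wf_l = wf[OF l]
  show ?thesis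
  proof (cases "stm P l")
    case (GoRight i l')
    then show ?thesis
      using not_final wf_l by (auto simp: sim name_step_def head intro!: approx_move[OF approx])
  next
    case (GoLeft i l')
    then show ?thesis
      using not_final wf_l by (auto simp: sim name_step_def head intro!: approx_move[OF approx])
  next
    case (Write i b l')
    then show ?thesis
      using not_final wf_l by (auto simp: sim name_step_def head intro!: approx_update[OF approx])
  next
    case (IfSym i b l' l'')
    then have i: "i \<le> last_tape P" and b: "b \<in> aux_syms P" using wf_l by auto
    have "approx_cell (mem_get s (cell_key i (int_encode (m i)))) (\<beta> i (m i))"
      using approx i by (simp add: approx_conf_def)
    then have "mem_get s (cell_key i (int_encode (m i))) = 2 * aux_code b \<longleftrightarrow> \<beta> i (m i) = Inl b"
      using b by (cases "\<beta> i (m i)") (auto simp: aux_code_eq, presburger)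
    then show ?thesis
      using not_final i approx_goto[OF approx] by (simp add: sim name_step_def head IfSym)
  next
    case (Assign i f "is" l')
    then have i: "i \<le> last_tape P" using wf_l by auto
    obtain y where y: "F l (name_args \<beta> m is) = Some y"
      using reg Assign by (auto simp: regular_def)
    then obtain u where "a l (pair t (arg_words s is)) = enc_word u" "str_prefix u y"
      using approx_value[OF reg approx, of y t] Assign by auto
    then have "approx_cell (Suc (2 * a l (pair t (arg_words s is)))) (Inr y)" by simp
    from approx_update[OF approx this, of i "m i" l'] show ?thesis
      using not_final i y by (simp add: sim name_step_def head Assign)
  next
    case (Test f "is" l' l'')
    obtain w where w: "F l (name_args \<beta> m is) = Some (Word w)" "w = [0] \<or> w = [1]"
      using reg Test by (auto simp: regular_def)
    then obtain u where u: "a l (pair t (arg_words s is)) = enc_word u" "prefix u w"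
      using approx_value[OF reg approx, of "Word w" t] Test by auto
    then have "u \<noteq> []" using known[OF Test] by auto
    then have "u = w" using u(2) w(2) by (auto simp: prefix_Cons)
    then show ?thesis
      using not_final known[OF Test] u(1) w approx_goto[OF approx] by (auto simp: sim name_step_def Test)
  qed
qed

lemma sim_mem_step_or_wait:
  assumes reg: "regular (l, \<beta>, m)" and approx: "approx_conf s (l, \<beta>, m)"
  shows "approx_conf (sim_mem (pair t s)) (name_step (l, \<beta>, m)) \<or> sim_mem (pair t s) = s"
proof (cases "\<exists>f is l' l''. stm P l = Test f is l' l'' \<and> a l (pair t (arg_words s is)) = 0")
  case True
  have "sim_mem (pair t s) = sim_stm (a l) (stm P l) t s"
    using approx reg by (intro sim_mem_eq) (auto simp: approx_conf_def regular_def)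
  then show ?thesis using True by auto
next
  case False
  then have "a l (pair t (arg_words s is)) \<noteq> 0" if "stm P l = Test f is l' l''" for f "is" l' l''
    using that by metis
  from sim_mem_step[OF reg approx this] show ?thesis by simp
qed

lemma name_step_cells:
  assumes reg: "regular (l, \<beta>, m)" and new: "fst (snd (name_step (l, \<beta>, m))) i z = Inr y"
  shows "\<lbrakk>\<And>f is l'. stm P l = Assign i f is l' \<Longrightarrow> z \<noteq> m i\<rbrakk> \<Longrightarrow> \<beta> i z = Inr y"
    and "stm P l = Assign i f is l' \<Longrightarrow> z = m i \<Longrightarrow> F l (name_args \<beta> m is) = Some y"
proof -
  have step: "name_step (l, \<beta>, m) = name_exec (F l) (stm P l) (l, \<beta>, m)"
    using reg by (simp add: name_step_def regular_def)
  show "\<beta> i z = Inr y" if "\<And>f is l'. stm P l = Assign i f is l' \<Longrightarrow> z \<noteq> m i"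
    using new that unfolding step by (cases "stm P l") (auto split: if_splits)
  show "F l (name_args \<beta> m is) = Some y" if "stm P l = Assign i f is l'" "z = m i"
    using new that reg unfolding step by (auto simp: regular_def)
qed

lemma sim_mem_cells:
  assumes reg: "regular (l, \<beta>, m)" and approx: "approx_conf s (l, \<beta>, m)" and i: "i \<le> last_tape P"
  shows "\<lbrakk>\<And>f is l'. stm P l = Assign i f is l' \<Longrightarrow> z \<noteq> m i; fst (snd (name_step (l, \<beta>, m))) i z = Inr y\<rbrakk> \<Longrightarrow>
      mem_get (sim_mem (pair t s)) (cell_key i (int_encode z)) = mem_get s (cell_key i (int_encode z))"
    and "stm P l = Assign i f is l' \<Longrightarrow> z = m i \<Longrightarrow>
      mem_get (sim_mem (pair t s)) (cell_key i (int_encode z)) = Suc (2 * a l (pair t (arg_words s is)))"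
proof -
  have l: "l \<in> labels P - {final_label P}" using reg by (simp add: regular_def)
  have sim: "sim_mem (pair t s) = sim_stm (a l) (stm P l) t s"
    using approx l by (intro sim_mem_eq) (auto simp: approx_conf_def)
  have step: "name_step (l, \<beta>, m) = name_exec (F l) (stm P l) (l, \<beta>, m)"
    using l by (simp add: name_step_def)
  have head: "mem_get s (head_key i) = int_encode (m i)" if "i \<le> last_tape P" for i
    using approx that by (simp add: approx_conf_def)
  show "mem_get (sim_mem (pair t s)) (cell_key i (int_encode z)) = mem_get s (cell_key i (int_encode z))"
    if "\<And>f is l'. stm P l = Assign i f is l' \<Longrightarrow> z \<noteq> m i" "fst (snd (name_step (l, \<beta>, m))) i z = Inr y"
    using that wf[OF l] unfolding sim step
    by (cases "stm P l") (auto simp: head int_encode_eq split: if_splits)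
  show "mem_get (sim_mem (pair t s)) (cell_key i (int_encode z)) = Suc (2 * a l (pair t (arg_words s is)))"
    if "stm P l = Assign i f is l'" "z = m i"
    using that i unfolding sim by (auto simp: head)
qed

definition sim_state :: "nat \<Rightarrow> nat \<times> 's list list \<Rightarrow> nat" where
  "sim_state j = (\<lambda>(t, ws). ((\<lambda>s. sim_mem (pair t s)) ^^ j)
     (sim_inputs (num_inputs P) (list_encode (map enc_word ws))))"

lemma sim_state_Suc: "sim_state (Suc j) (t, ws) = sim_mem (pair t (sim_state j (t, ws)))"
  by (simp add: sim_state_def)

lemma simulation_eq:
  "simulation (input_code t ws) = (let s = sim_state t (t, ws) in
     if mem_get s label_key = label_code (final_label P) then mem_get s (cell_key 0 0) div 2 else 0)"
proof -
  have "((\<lambda>x. pair (pfst x) (sim_mem x)) ^^ j) (pair t s) = pair t (((\<lambda>s. sim_mem (pair t s)) ^^ j) s)" for j s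
    by (induction j) auto
  then show ?thesis by (simp add: simulation_def sim_state_def input_code_def)
qed

lemma sim_inputs_get:
  "mem_get (sim_inputs j ws) label_key = label_code (init_label P)"
  "mem_get (sim_inputs j ws) (head_key i) = 0"
  "mem_get (sim_inputs j ws) (cell_key i z) =
    (if 1 \<le> i \<and> i \<le> j \<and> z = 0 then Suc (2 * lhd (ldrop (i - 1) ws)) else 0)"
  by (induction j) auto

lemma approx_initial:
  assumes "(t, ws) \<in> approx_inputs (num_inputs P) x T"
  shows "approx_conf (sim_state 0 (t, ws)) (name_initial x)"
proof -
  have len: "length ws = num_inputs P" and pre: "\<And>i. i < num_inputs P \<Longrightarrow> str_prefix (ws ! i) (x i)"
    using assms by (auto simp: approx_inputs_def)
  have "lhd (ldrop i (list_encode (map enc_word ws))) = enc_word (ws ! i)" if "i < num_inputs P" for i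
    using that len by (simp add: drop_map Cons_nth_drop_Suc[symmetric])
  moreover have "int_encode z = 0 \<longleftrightarrow> z = 0" for z
    using int_encode_eq[of z 0] by simp
  ultimately show ?thesis
    using pre blank by (auto simp: approx_conf_def sim_state_def name_initial_def sim_inputs_get aux_code_def)
qed

context
  fixes x n
  assumes regular: "\<And>j. j < n \<Longrightarrow> regular ((name_step ^^ j) (name_initial x))"
begin

abbreviation \<nu> where "\<nu> j \<equiv> (name_step ^^ j) (name_initial x)"

lemma sim_state_sound:
  assumes p: "(t, ws) \<in> approx_inputs (num_inputs P) x 0" and final: "fst (\<nu> n) = final_label P"
  shows "\<exists>j'\<le>n. approx_conf (sim_state j (t, ws)) (\<nu> j')"
proof (induction j)
  case 0
  show ?case using approx_initial[OF p] by (intro exI[of _ 0]) simp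
next
  case (Suc j)
  then obtain j' where j': "j' \<le> n" "approx_conf (sim_state j (t, ws)) (\<nu> j')" by blast
  show ?case
  proof (cases "j' < n")
    case True
    obtain l \<beta> m where c: "\<nu> j' = (l, \<beta>, m)" by (cases "\<nu> j'")
    from sim_mem_step_or_wait[of l \<beta> m "sim_state j (t, ws)" t]
    have "approx_conf (sim_state (Suc j) (t, ws)) (\<nu> (Suc j')) \<or> sim_state (Suc j) (t, ws) = sim_state j (t, ws)"
      using regular[OF True] j'(2) c by (simp add: sim_state_Suc)
    then show ?thesis using j' True by (metis Suc_leI)
  next
    case False
    then have "fst (\<nu> j') = final_label P" using final j'(1) by simp
    then have "mem_get (sim_state j (t, ws)) label_key = label_code (final_label P)"
      using j'(2) by (auto simp: approx_conf_def split: prod.splits)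
    then show ?thesis using j' by (auto simp: sim_state_Suc sim_mem_final)
  qed
qed

text \<open>Each fixed number of steps is simulated without waiting, and with arbitrarily long prefixes in the
  cells, if \<open>t\<close> is large and the input words are long. Both assertions are proved together, because a test
  is decided only if the prefixes of its arguments are long enough.\<close>

lemma eventually_approx_conf:
  assumes "j \<le> n"
  shows "(\<forall>\<^sub>F p in approx_filter (num_inputs P) x. approx_conf (sim_state j p) (\<nu> j)) \<and>
    (\<forall>i z y v. i \<le> last_tape P \<longrightarrow> fst (snd (\<nu> j)) i z = Inr y \<longrightarrow> str_prefix v y \<longrightarrow>
      (\<forall>\<^sub>F p in approx_filter (num_inputs P) x.
        \<exists>u. mem_get (sim_state j p) (cell_key i (int_encode z)) = Suc (2 * enc_word u) \<and> prefix v u))"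
    (is "?conf j \<and> ?cells j")
  using assms
proof (induction j)
  case 0
  let ?E = "approx_filter (num_inputs P) x"
  have conf: "?conf 0"
    unfolding eventually_approx_filter
    by (intro exI[of _ 0]) (use approx_initial in auto)
  moreover have "\<forall>\<^sub>F p in ?E. \<exists>u. mem_get (sim_state 0 p) (cell_key i (int_encode z)) = Suc (2 * enc_word u) \<and> prefix v u"
    if i: "i \<le> last_tape P" and y: "fst (snd (\<nu> 0)) i z = Inr y" and v: "str_prefix v y" for i z y v
    unfolding eventually_approx_filter
  proof (intro exI[of _ "length v"] ballI)
    fix p assume p: "p \<in> approx_inputs (num_inputs P) x (length v)"
    obtain t ws where tw: "p = (t, ws)" by fastforce
    have in_x: "1 \<le> i" "i \<le> num_inputs P" "z = 0" "y = x (i - 1)"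
      using y by (auto simp: name_initial_def split: if_splits)
    have w: "length ws = num_inputs P" "str_prefix (ws ! (i - 1)) y" "length v \<le> length (ws ! (i - 1))"
      using p in_x by (auto simp: tw approx_inputs_def)
    have "lhd (ldrop (i - 1) (list_encode (map enc_word ws))) = enc_word (ws ! (i - 1))"
      using w(1) in_x by (simp add: drop_map Cons_nth_drop_Suc[symmetric])
    then have "mem_get (sim_state 0 p) (cell_key i (int_encode z)) = Suc (2 * enc_word (ws ! (i - 1)))"
      using in_x by (simp add: sim_state_def tw sim_inputs_get)
    moreover have "prefix v (ws ! (i - 1))" using str_prefix_linear v w by blast
    ultimately show "\<exists>u. mem_get (sim_state 0 p) (cell_key i (int_encode z)) = Suc (2 * enc_word u) \<and> prefix v u"
      by blast
  qed
  ultimately show ?case by blast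
next
  case (Suc j)
  let ?E = "approx_filter (num_inputs P) x"
  obtain l \<beta> m where c: "\<nu> j = (l, \<beta>, m)" by (cases "\<nu> j")
  have reg: "regular (l, \<beta>, m)" using regular[of j] Suc.prems c by simp
  have conf: "\<forall>\<^sub>F p in ?E. approx_conf (sim_state j p) (l, \<beta>, m)" using Suc c by simp
  have cells: "\<forall>\<^sub>F p in ?E. \<exists>u. mem_get (sim_state j p) (cell_key i (int_encode z)) = Suc (2 * enc_word u) \<and> prefix v u"
    if "i \<le> last_tape P" "\<beta> i z = Inr y" "str_prefix v y" for i z y v
    using Suc that c by simp
  let ?is = "stm_args (stm P l)"
  let ?n = "length ?is" and ?x = "name_args \<beta> m ?is"
  have arg: "?is ! k \<le> last_tape P \<and> (\<exists>q. \<beta> (?is ! k) (m (?is ! k)) = Inr (Seq q) \<and> ?x k = Seq q)" if "k < ?n" for k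
  proof -
    have "?is ! k \<in> set ?is" using that by simp
    then have "?is ! k \<le> last_tape P \<and> (\<exists>y\<in>seqs. \<beta> (?is ! k) (m (?is ! k)) = Inr y)"
      using reg by (simp add: regular_def)
    then show ?thesis using that by (auto simp: name_args_def seqs_def)
  qed
  have long_args: "\<forall>\<^sub>F p in ?E. \<exists>us. arg_words (sim_state j p) ?is = list_encode (map enc_word us) \<and>
      (fst p, us) \<in> approx_inputs ?n ?x T" for T
  proof -
    have "\<forall>\<^sub>F p in ?E. \<exists>u :: 's list. mem_get (sim_state j p) (cell_key (?is ! k) (int_encode (m (?is ! k)))) =
        Suc (2 * enc_word u) \<and> T \<le> length u" if k: "k < ?n" for k
    proof -
      obtain q where q: "\<beta> (?is ! k) (m (?is ! k)) = Inr (Seq q)" using arg[OF k] by blast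
      have "\<forall>\<^sub>F p in ?E. \<exists>u. mem_get (sim_state j p) (cell_key (?is ! k) (int_encode (m (?is ! k)))) =
          Suc (2 * enc_word u) \<and> prefix (map q [0..<T]) u"
        by (rule cells[OF _ q]) (use arg[OF k] in auto)
      then show ?thesis
        by (rule eventually_mono) (auto dest!: prefix_length_le)
    qed
    then have "\<forall>\<^sub>F p in ?E. \<forall>k\<in>{..<?n}. \<exists>u :: 's list. mem_get (sim_state j p) (cell_key (?is ! k) (int_encode (m (?is ! k)))) =
        Suc (2 * enc_word u) \<and> T \<le> length u"
      by (intro eventually_ball_finite) auto
    moreover have "\<forall>\<^sub>F p in ?E. T \<le> fst p"
      unfolding eventually_approx_filter by (intro exI[of _ T]) (auto simp: approx_inputs_def)
    ultimately show ?thesis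
      using conf
    proof eventually_elim
      case (elim p)
      obtain us where us: "arg_words (sim_state j p) ?is = list_encode (map enc_word us)" "length us = ?n"
        "\<forall>k<?n. mem_get (sim_state j p) (cell_key (?is ! k) (int_encode (m (?is ! k)))) = Suc (2 * enc_word (us ! k)) \<and>
           str_prefix (us ! k) (?x k)"
        using approx_args[OF reg elim(3) refl] by blast
      have "T \<le> length (us ! k)" if "k < ?n" for k
        using elim(1) us(3) that by auto
      then show ?case
        using us elim(2) by (intro exI[of _ us]) (auto simp: approx_inputs_def)
    qed
  qed
  have vals: "\<forall>\<^sub>F p in ?E. \<exists>u. a l (pair (fst p) (arg_words (sim_state j p) ?is)) = enc_word u \<and> prefix v u"
    if y: "F l ?x = Some y" and v: "str_prefix v y" for y v
  proof -
    have "\<forall>\<^sub>F (t, us) in approx_filter ?n ?x. \<exists>u. a l (input_code t us) = enc_word u \<and> prefix v u"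
      using approximates_F[OF reg y] v unfolding approximates_def by blast
    then obtain T where T: "\<And>t us. (t, us) \<in> approx_inputs ?n ?x T \<Longrightarrow>
        \<exists>u. a l (input_code t us) = enc_word u \<and> prefix v u"
      unfolding eventually_approx_filter by blast
    from long_args[of T] show ?thesis
    proof eventually_elim
      case (elim p)
      then show ?case using T by (auto simp: input_code_def)
    qed
  qed
  have "\<forall>\<^sub>F p in ?E. \<forall>f is l' l''. stm P l = Test f is l' l'' \<longrightarrow> a l (pair (fst p) (arg_words (sim_state j p) is)) \<noteq> 0"
  proof (cases "\<exists>f is l' l''. stm P l = Test f is l' l''")
    case True
    then obtain f "is" l' l'' where test: "stm P l = Test f is l' l''" by blast
    obtain w where w: "F l ?x = Some (Word w)" "w \<noteq> []"
      using reg test by (auto simp: regular_def)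
    have "\<forall>\<^sub>F p in ?E. \<exists>u. a l (pair (fst p) (arg_words (sim_state j p) ?is)) = enc_word u \<and> prefix w u"
      by (rule vals[OF w(1)]) simp
    then show ?thesis
    proof eventually_elim
      case (elim p)
      then obtain u where u: "a l (pair (fst p) (arg_words (sim_state j p) is)) = enc_word u" "prefix w u"
        using test by auto
      then have "u \<noteq> []" using w(2) by auto
      then have "a l (pair (fst p) (arg_words (sim_state j p) is)) \<noteq> 0"
        unfolding u(1) enc_word_eq_0 .
      then show ?case using test by simp
    qed
  qed auto
  with conf have conf': "?conf (Suc j)"
  proof eventually_elim
    case (elim p)
    then show ?case
      using sim_mem_step[OF reg elim(1), of "fst p"] c by (cases p) (simp add: sim_state_Suc)
  qed
  have "\<forall>\<^sub>F p in ?E. \<exists>u. mem_get (sim_state (Suc j) p) (cell_key i (int_encode z)) = Suc (2 * enc_word u) \<and> prefix v u"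
    if i: "i \<le> last_tape P" and y: "fst (snd (\<nu> (Suc j))) i z = Inr y" and v: "str_prefix v y" for i z y v
  proof -
    have new: "fst (snd (name_step (l, \<beta>, m))) i z = Inr y" using y c by simp
    have Suc_eq: "sim_state (Suc j) p = sim_mem (pair (fst p) (sim_state j p))" for p
      by (cases p) (simp add: sim_state_Suc)
    show ?thesis
    proof (cases "(\<exists>f is l'. stm P l = Assign i f is l') \<and> z = m i")
      case True
      then obtain f "is" l' where assign: "stm P l = Assign i f is l'" "z = m i" by blast
      have "F l ?x = Some y"
        using name_step_cells(2)[OF reg new assign] assign(1) by simp
      from vals[OF this v] conf show ?thesis
      proof eventually_elim
        case (elim p)
        then show ?case
          using sim_mem_cells(2)[OF reg elim(2) i assign, of "fst p"] assign(1) by (simp add: Suc_eq)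
      qed
    next
      case False
      then have other: "\<And>f is l'. stm P l = Assign i f is l' \<Longrightarrow> z \<noteq> m i" by blast
      have "\<beta> i z = Inr y" by (rule name_step_cells(1)[OF reg new other])
      from cells[OF i this v] conf show ?thesis
      proof eventually_elim
        case (elim p)
        then show ?case
          using sim_mem_cells(1)[where t = "fst p", OF reg elim(2) i other new] by (simp add: Suc_eq)
      qed
    qed
  qed
  with conf' show ?case by blast
qed

text \<open>A simulation that has reached the final label represents the final configuration on names, and
  further steps leave it unchanged; one that has not yields the empty word.\<close>

lemma simulation_approximates:
  assumes final: "fst (\<nu> n) = final_label P" and result: "fst (snd (\<nu> n)) 0 0 = Inr (Seq q)"
  shows "approximates simulation (num_inputs P) x (Seq q)"
  unfolding approximates_def
proof (intro conjI allI impI ballI)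
  fix p assume p: "p \<in> approx_inputs (num_inputs P) x 0"
  obtain t ws where tw: "p = (t, ws)" by fastforce
  let ?s = "sim_state t (t, ws)"
  obtain j where j: "j \<le> n" "approx_conf ?s (\<nu> j)"
    using sim_state_sound[OF p[unfolded tw] final] by blast
  have "\<exists>u. simulation (input_code t ws) = enc_word u \<and> str_prefix u (Seq q)"
  proof (cases "mem_get ?s label_key = label_code (final_label P)")
    case True
    have "j = n"
    proof (rule ccontr)
      assume "j \<noteq> n"
      then have "fst (\<nu> j) \<in> labels P - {final_label P}"
        using regular[of j] j(1) by (auto simp: regular_def)
      moreover have "label_code (fst (\<nu> j)) = label_code (final_label P)"
        using True j(2) by (auto simp: approx_conf_def split: prod.splits)
      ultimately show False using label_code_eq final_label by auto
    qed
    obtain l \<beta> m where c: "\<nu> n = (l, \<beta>, m)" by (cases "\<nu> n")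
    have "approx_cell (mem_get ?s (cell_key 0 (int_encode z))) (\<beta> 0 z)" for z
      using j(2) unfolding \<open>j = n\<close> c by (simp add: approx_conf_def)
    from this[of 0] have "approx_cell (mem_get ?s (cell_key 0 0)) (fst (snd (\<nu> n)) 0 0)"
      by (simp add: c)
    then obtain u where "mem_get ?s (cell_key 0 0) = Suc (2 * enc_word u)" "str_prefix u (Seq q)"
      using result by auto
    then show ?thesis using True by (auto simp: simulation_eq)
  next
    case False
    then show ?thesis by (intro exI[of _ "[]"]) (simp add: simulation_eq)
  qed
  then show "case p of (t, ws) \<Rightarrow> \<exists>u. simulation (input_code t ws) = enc_word u \<and> str_prefix u (Seq q)"
    by (simp add: tw)
next
  fix v assume v: "str_prefix v (Seq q)"
  let ?E = "approx_filter (num_inputs P) x"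
  have "\<forall>\<^sub>F p in ?E. n \<le> fst p"
    unfolding eventually_approx_filter by (intro exI[of _ n]) (auto simp: approx_inputs_def)
  moreover have "\<forall>\<^sub>F p in ?E. approx_conf (sim_state n p) (\<nu> n)"
    using eventually_approx_conf[of n] by simp
  moreover have "\<forall>\<^sub>F p in ?E. \<exists>u. mem_get (sim_state n p) (cell_key 0 (int_encode 0)) = Suc (2 * enc_word u) \<and> prefix v u"
    using eventually_approx_conf[of n] result v by blast
  ultimately show "\<forall>\<^sub>F (t, ws) in ?E. \<exists>u. simulation (input_code t ws) = enc_word u \<and> prefix v u"
  proof eventually_elim
    case (elim p)
    obtain t ws where tw: "p = (t, ws)" by fastforce
    have label: "mem_get (sim_state n (t, ws)) label_key = label_code (final_label P)"
      using elim(2) final by (auto simp: approx_conf_def tw split: prod.splits)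
    have "sim_state (n + d) (t, ws) = sim_state n (t, ws)" for d
      by (induction d) (simp_all add: sim_state_Suc sim_mem_final[OF label])
    from this[of "t - n"] have "sim_state t (t, ws) = sim_state n (t, ws)"
      using elim(1) by (simp add: tw)
    then show ?case using elim(3) label by (auto simp: tw simulation_eq)
  qed
qed

end

theorem simulation_realizes:
  assumes z: "z \<in> PiE {..<num_inputs P} (\<lambda>j. \<delta> (Suc j) (x j))" and dom: "gtm_fun P z \<noteq> {}"
  shows "\<exists>q. approximates simulation (num_inputs P) x (Seq q) \<and> gtm_fun P z \<inter> \<delta> 0 (Seq q) \<noteq> {}"
proof -
  obtain n q where "\<And>j. j < n \<Longrightarrow> regular ((name_step ^^ j) (name_initial x))"
    "fst ((name_step ^^ n) (name_initial x)) = final_label P"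
    "fst (snd ((name_step ^^ n) (name_initial x))) 0 0 = Inr (Seq q)" "gtm_fun P z \<inter> \<delta> 0 (Seq q) \<noteq> {}"
    using name_run[OF z dom] by blast
  then show ?thesis using simulation_approximates[of n x q] by blast
qed

end

section \<open>Computable and continuous generalized Turing machines\<close>

lemma computable_pfun_approximation:
  fixes f :: "(nat \<Rightarrow> 's :: countable str) \<rightharpoonup> 's str"
  assumes "computable_pfun n (\<lambda>_. seqs) U0 f"
  shows "\<exists>a. prim_rec a \<and> (\<forall>x y. f x = Some y \<longrightarrow> approximates a n x y)"
proof -
  obtain h N M where h: "t2_wf n N M"
      "\<And>x y. h x = Some y \<longleftrightarrow> x \<in> seq_tuples n \<and> y \<in> U0 \<and> t2_yields n M x y" and le: "f \<subseteq>\<^sub>m h"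
    using assms unfolding computable_pfun_def turing_computable_def by blast
  have "h x = Some y" if "f x = Some y" for x y
    using le that by (metis domI map_le_def)
  then have hf: "x \<in> seq_tuples n \<and> t2_yields n M x y" if "f x = Some y" for x y
    using that h(2) by simp
  obtain a where "prim_rec a" "\<forall>x y. x \<in> seq_tuples n \<and> t2_yields n M x y \<longrightarrow> approximates a n x y"
    using machine_prim_rec_approximation[OF h(1)] by (elim exE conjE) (rule that)
  then show ?thesis using hf by (intro exI[of _ a]) simp
qed

lemma gtm_fun_realization:
  assumes gtm: "is_gtm P" and rep: "\<forall>i \<le> last_tape P. multi_representation (tape_set P i) (\<delta> i)"
    and stms: "\<And>l. l \<in> labels P - {final_label P} \<Longrightarrow> \<exists>F a. approximate_realization P \<delta> l F a \<and> C a"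
  shows "\<exists>F a. (\<forall>l \<in> labels P - {final_label P}. C (a l)) \<and> approximated_gtm P \<delta> F a"
proof -
  define F where "F = (\<lambda>l. SOME F. \<exists>a. approximate_realization P \<delta> l F a \<and> C a)"
  define a where "a = (\<lambda>l. SOME a. approximate_realization P \<delta> l (F l) a \<and> C a)"
  have "approximate_realization P \<delta> l (F l) (a l) \<and> C (a l)" if l: "l \<in> labels P - {final_label P}" for l
  proof -
    have "\<exists>a. approximate_realization P \<delta> l (F l) a \<and> C a"
      unfolding F_def by (rule someI_ex[of "\<lambda>F. \<exists>a. approximate_realization P \<delta> l F a \<and> C a"]) (rule stms[OF l])
    then show ?thesis
      unfolding a_def by (rule someI_ex[of "\<lambda>a. approximate_realization P \<delta> l (F l) a \<and> C a"])
  qed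
  then have "approximated_gtm P \<delta> F a" "\<forall>l \<in> labels P - {final_label P}. C (a l)"
    using gtm rep by (simp_all add: approximated_gtm_def)
  then show ?thesis by (intro exI conjI)
qed

lemma approximate_realization_exists:
  fixes P :: "('l, 'u, 's :: {finite, zero_neq_one}) gtm"
  assumes assign: "\<And>i f is l'. stm P l = Assign i f is l' \<Longrightarrow>
      \<exists>F a. realization (length is) (\<lambda>_. seqs) (\<lambda>j. \<delta> (is ! j)) (\<delta> i) (mfun_of F) f \<and> C a \<and>
        (\<forall>x y. F x = Some y \<longrightarrow> approximates a (length is) x y)"
    and test: "\<And>f is l' l''. stm P l = Test f is l' l'' \<Longrightarrow>
      \<exists>F a. realization (length is) (\<lambda>_. seqs) (\<lambda>j. \<delta> (is ! j)) id_words (mfun_of F) (mfun_of f) \<and> C a \<and>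
        (\<forall>x y. F x = Some y \<longrightarrow> approximates a (length is) x y)"
    and const: "C (\<lambda>_. 0)"
  shows "\<exists>F a. approximate_realization P \<delta> l F a \<and> C a"
proof -
  have trivial: ?thesis if "stm_args (stm P l) = []"
    "\<And>i f is l'. stm P l \<noteq> Assign i f is l'" "\<And>f is l' l''. stm P l \<noteq> Test f is l' l''"
  proof (intro exI conjI)
    show "approximate_realization P \<delta> l Map.empty (\<lambda>_. 0)"
      using that by (simp add: approximate_realization_def)
  qed (rule const)
  show ?thesis
  proof (cases "stm P l")
    case (Assign i f "is" l')
    obtain F a where "realization (length is) (\<lambda>_. seqs) (\<lambda>j. \<delta> (is ! j)) (\<delta> i) (mfun_of F) f" "C a"
        "\<forall>x y. F x = Some y \<longrightarrow> approximates a (length is) x y"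
      using assign[OF Assign] by (elim exE conjE) (rule that)
    then have "approximate_realization P \<delta> l F a \<and> C a"
      by (simp add: approximate_realization_def Assign)
    then show ?thesis by (intro exI)
  next
    case (Test f "is" l' l'')
    obtain F a where "realization (length is) (\<lambda>_. seqs) (\<lambda>j. \<delta> (is ! j)) id_words (mfun_of F) (mfun_of f)" "C a"
        "\<forall>x y. F x = Some y \<longrightarrow> approximates a (length is) x y"
      using test[OF Test] by (elim exE conjE) (rule that)
    then have "approximate_realization P \<delta> l F a \<and> C a"
      by (simp add: approximate_realization_def Test)
    then show ?thesis by (intro exI)
  qed (rule trivial; simp)+
qed

text \<open>The results of a machine on sequences define a function because it has at most one result.\<close>

lemma machine_computable:
  fixes M :: "'s t2_prog"
  assumes "t2_wf n N M"
  shows "\<exists>f. computable_pfun n (\<lambda>_. seqs) seqs f \<and>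
    (\<forall>x q. x \<in> seq_tuples n \<and> t2_yields n M x (Seq q) \<longrightarrow> f x = Some (Seq q))"
proof -
  let ?R = "\<lambda>x y. x \<in> seq_tuples n \<and> y \<in> seqs \<and> t2_yields n M x y"
  define f where "f = (\<lambda>x. if \<exists>y. ?R x y then Some (SOME y. ?R x y) else None)"
  have f: "f x = Some y \<longleftrightarrow> ?R x y" for x y
  proof
    assume "f x = Some y"
    then have "\<exists>y. ?R x y" "y = (SOME y. ?R x y)" by (auto simp: f_def split: if_splits)
    then show "?R x y" using someI_ex[of "?R x"] by blast
  next
    assume R: "?R x y"
    then have "?R x (SOME y. ?R x y)" by (rule someI[of "?R x"])
    then have "(SOME y. ?R x y) = y" using R t2_yields_unique by blast
    then show "f x = Some y" using R by (auto simp: f_def)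
  qed
  have "turing_computable n (\<lambda>_. seqs) seqs f"
    unfolding turing_computable_def using assms f by blast
  then have "computable_pfun n (\<lambda>_. seqs) seqs f"
    unfolding computable_pfun_def using map_le_refl by blast
  then show ?thesis using f by (auto simp: seqs_def)
qed

lemma realization_of_approximation:
  assumes f: "\<And>x q. x \<in> seq_tuples n \<Longrightarrow> approximates a n x (Seq q) \<Longrightarrow> f x = Some (Seq q)"
    and a: "\<And>x z. z \<in> PiE {..<n} (\<lambda>j. \<gamma> j (x j)) \<Longrightarrow> g z \<noteq> {} \<Longrightarrow>
      \<exists>q. approximates a n x (Seq q) \<and> g z \<inter> \<gamma>0 (Seq q) \<noteq> {}"
  shows "realization n (\<lambda>_. seqs) \<gamma> \<gamma>0 (mfun_of f) g"
  unfolding realization_def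
proof (intro ballI)
  fix x z assume x: "x \<in> seq_tuples n" and z: "z \<in> PiE {..<n} (\<lambda>j. \<gamma> j (x j)) \<inter> mdom g"
  then obtain q where q: "approximates a n x (Seq q)" "g z \<inter> \<gamma>0 (Seq q) \<noteq> {}"
    using a[of z x] by (auto simp: mdom_def)
  then show "mfun_of f x \<noteq> {} \<and> (\<forall>x0 \<in> mfun_of f x. g z \<inter> \<gamma>0 x0 \<noteq> {})"
    using f[OF x q(1)] by (simp add: mfun_of_def)
qed

theorem theorem6p2:
  fixes P :: "('l, 'u, 's :: {finite, zero_neq_one}) gtm"
    and \<delta> :: "nat \<Rightarrow> 's str \<Rightarrow> 'u set"
  assumes "is_gtm P"
    and "\<forall>i \<le> last_tape P. multi_representation (tape_set P i) (\<delta> i)"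
  shows "(gtm_computable P \<delta> \<longrightarrow>
            rel_computable (num_inputs P) (\<lambda>_. seqs) seqs (\<lambda>j. \<delta> (Suc j)) (\<delta> 0) (gtm_fun P))
       \<and> (gtm_continuous P \<delta> \<longrightarrow>
            rel_continuous (num_inputs P) (\<lambda>_. seqs) seqs (\<lambda>j. \<delta> (Suc j)) (\<delta> 0) (gtm_fun P))"
proof (intro conjI impI)
  assume comp: "gtm_computable P \<delta>"
  have "\<exists>F a. approximate_realization P \<delta> l F a \<and> prim_rec a" if l: "l \<in> labels P - {final_label P}" for l
  proof (rule approximate_realization_exists)
    fix i f "is" l' assume "stm P l = Assign i f is l'"
    then have "rel_computable (length is) (\<lambda>_. seqs) seqs (\<lambda>j. \<delta> (is ! j)) (\<delta> i) f"
      using comp l unfolding gtm_computable_def by blast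
    then show "\<exists>F a. realization (length is) (\<lambda>_. seqs) (\<lambda>j. \<delta> (is ! j)) (\<delta> i) (mfun_of F) f \<and> prim_rec a \<and>
        (\<forall>x y. F x = Some y \<longrightarrow> approximates a (length is) x y)"
      using computable_pfun_approximation unfolding rel_computable_def by blast
  next
    fix f "is" l' l'' assume "stm P l = Test f is l' l''"
    then have "rel_computable (length is) (\<lambda>_. seqs) words (\<lambda>j. \<delta> (is ! j)) id_words (mfun_of f)"
      using comp l unfolding gtm_computable_def by blast
    then show "\<exists>F a. realization (length is) (\<lambda>_. seqs) (\<lambda>j. \<delta> (is ! j)) id_words (mfun_of F) (mfun_of f) \<and>
        prim_rec a \<and> (\<forall>x y. F x = Some y \<longrightarrow> approximates a (length is) x y)"
      using computable_pfun_approximation unfolding rel_computable_def by blast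
  qed (rule prim_rec_const)
  from gtm_fun_realization[OF assms this]
  obtain F a where a: "\<And>l. l \<in> labels P - {final_label P} \<Longrightarrow> prim_rec (a l)" and "approximated_gtm P \<delta> F a"
    by blast
  then interpret approximated_gtm P \<delta> F a by simp
  have pr: "prim_rec simulation" by (rule prim_rec_simulation) (rule a)
  obtain N M where M: "t2_wf (num_inputs P) N M" "\<forall>(x :: nat \<Rightarrow> 's str) q.
      x \<in> seq_tuples (num_inputs P) \<and> approximates simulation (num_inputs P) x (Seq q) \<longrightarrow>
      t2_yields (num_inputs P) M x (Seq q)"
    using prim_rec_approximation_machine[OF pr, of "num_inputs P"]
    by (elim exE conjE) (rule that)
  obtain f where f: "computable_pfun (num_inputs P) (\<lambda>_. seqs) seqs f"
    "\<forall>x q. x \<in> seq_tuples (num_inputs P) \<and> t2_yields (num_inputs P) M x (Seq q) \<longrightarrow> f x = Some (Seq q)"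
    using machine_computable[OF M(1)] by (elim exE conjE) (rule that)
  have "realization (num_inputs P) (\<lambda>_. seqs) (\<lambda>j. \<delta> (Suc j)) (\<delta> 0) (mfun_of f) (gtm_fun P)"
    by (rule realization_of_approximation[where a = simulation])
      (use f(2) M(2) in blast, rule simulation_realizes)
  with f(1) show "rel_computable (num_inputs P) (\<lambda>_. seqs) seqs (\<lambda>j. \<delta> (Suc j)) (\<delta> 0) (gtm_fun P)"
    unfolding rel_computable_def by blast
next
  assume cont: "gtm_continuous P \<delta>"
  have "\<exists>F a. approximate_realization P \<delta> l F a \<and> True" if l: "l \<in> labels P - {final_label P}" for l
  proof (rule approximate_realization_exists)
    fix i f "is" l' assume "stm P l = Assign i f is l'"
    then have "rel_continuous (length is) (\<lambda>_. seqs) seqs (\<lambda>j. \<delta> (is ! j)) (\<delta> i) f"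
      using cont l unfolding gtm_continuous_def by blast
    then show "\<exists>F a. realization (length is) (\<lambda>_. seqs) (\<lambda>j. \<delta> (is ! j)) (\<delta> i) (mfun_of F) f \<and> True \<and>
        (\<forall>x y. F x = Some y \<longrightarrow> approximates a (length is) x y)"
      using continuous_approximation unfolding rel_continuous_def by blast
  next
    fix f "is" l' l'' assume "stm P l = Test f is l' l''"
    then have "rel_continuous (length is) (\<lambda>_. seqs) words (\<lambda>j. \<delta> (is ! j)) id_words (mfun_of f)"
      using cont l unfolding gtm_continuous_def by blast
    then show "\<exists>F a. realization (length is) (\<lambda>_. seqs) (\<lambda>j. \<delta> (is ! j)) id_words (mfun_of F) (mfun_of f) \<and>
        True \<and> (\<forall>x y. F x = Some y \<longrightarrow> approximates a (length is) x y)"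
      using continuous_approximation unfolding rel_continuous_def by blast
  qed simp
  from gtm_fun_realization[OF assms this] obtain F a where "approximated_gtm P \<delta> F a" by blast
  then interpret approximated_gtm P \<delta> F a .
  obtain f where f: "continuous_pfun (num_inputs P) (\<lambda>_. seqs) seqs f" "\<forall>(x :: nat \<Rightarrow> 's str) q.
      x \<in> seq_tuples (num_inputs P) \<and> approximates simulation (num_inputs P) x (Seq q) \<longrightarrow> f x = Some (Seq q)"
    using approximation_continuous[of "num_inputs P" simulation] by (elim exE conjE) (rule that)
  have "realization (num_inputs P) (\<lambda>_. seqs) (\<lambda>j. \<delta> (Suc j)) (\<delta> 0) (mfun_of f) (gtm_fun P)"
    by (rule realization_of_approximation[where a = simulation])
      (use f(2) in blast, rule simulation_realizes)
  with f(1) show "rel_continuous (num_inputs P) (\<lambda>_. seqs) seqs (\<lambda>j. \<delta> (Suc j)) (\<delta> 0) (gtm_fun P)"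
    unfolding rel_continuous_def by blast
qed

end
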